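(* Let $P=A_M^+$ be a right-angled Artin monoid with canonical generating set $S$, and let $\lambda:I_n\to P$ be a list of elements of $P$. Then the tree $(\lambda_\omega)$ of $\lambda$ is finite, and reduction of positivity to generators holds for $P$, that is: for every compactly aligned product system $\{X_p\}_{p\in P}$ of essential $C^*$-correspondences over $P$ with $X_e=A$, every multiplicative homomorphism $N:P\to(0,\infty)$ and every $\beta\in\mathbb{R}$, a tracial state $\tau$ on $A$ satisfies $$\tau(a)+\sum_{\emptyset\neq K\subset J}(-1)^{|K|}N(\vee K)^{-\beta}\,\mathrm{Tr}_\tau^{\vee K}(a)\ \geq\ 0$$ for all $a\in A_+$ and all finite $J\subset P\setminus\{e\}$ if and only if it satisfies this inequality for all $a\in A_+$ and all finite $J\subset S$. Summands with $\vee K=\infty$ are zero.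
   Context: Right-angled Artin monoids. Given a set $S$ and a symmetric matrix $M=(m_{st})_{s,t\in S}$ with $m_{ss}=1$ and $m_{st}\in\{2,\infty\}$ for $s\ne t$, $A_M^+$ is the monoid generated by $S$ with relations $st=ts$ whenever $m_{st}=2$. Its only invertible element is the identity $e$, it is cancellative, and its set of atoms is $S$. $p\le q$ means $q\in pP$, a partial order, and then $p^{-1}q$ is the unique $x$ with $px=q$. For finite nonempty $K\subset P$, either $\bigcap_{k\in K}kP=\emptyset$ and $\vee K:=\infty$, or $\bigcap_{k\in K}kP=(\vee K)P$ for a unique $\vee K\in P$; $p\vee q=\vee\{p,q\}$ and $p\vee\infty=\infty$. Lists and the tree. Let $I_n=\{1,\dots,n\}$. A list is a function $\lambda:I_n\to P\cup\{\infty\}$. It is a leaf if $\lambda(I_n)\subset S\cup\{\infty\}$ or $e\in\lambda(I_n)$. If $\lambda$ is not a leaf, let $i$ be the smallest index such that $\lambda(i)\in P$ and $\lambda(i)=pq$ with $p,q\in P\setminus\{e\}$, where $p$ is chosen in $S$, and define lists $\lambda_1,\lambda_2$ by $\lambda_1(i)=p$, $\lambda_1(j)=\lambda(j)$ for $j\ne i$; and $\lambda_2(j)=p^{-1}(p\vee\lambda(j))$ if $p\vee\lambda(j)<\infty$, $\lambda_2(j)=\infty$ otherwise. The tree $(\lambda_\omega)$ of $\lambda$ is the binary tree with root $\lambda$ in which each non-leaf node $\lambda_\omega$ ($\omega$ a word in $1,2$) has the two children $\lambda_{\omega1}=(\lambda_\omega)_1$ and $\lambda_{\omega2}=(\lambda_\omega)_2$;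 branches end at the first leaf encountered, if any. Product systems. A $C^*$-correspondence over a $C^*$-algebra $A$ is a right Hilbert $A$-module $X$ with a left action $\varphi:A\to\mathcal{L}(X)$; it is essential if $\overline{\varphi(A)X}=X$. A product system over $P$ is a family $(X_p)_{p\in P}$ of $C^*$-correspondences over $A$ with a monoid structure on $\bigcup_pX_p$ such that $\xi\zeta\in X_{pq}$ for $\xi\in X_p,\zeta\in X_q$, the map $\xi\otimes\zeta\mapsto\xi\zeta$ extends to an isometric isomorphism $X_p\otimes_AX_q\simeq X_{pq}$ for all $p,q\in P$ with $p\ne e$, $X_e={}_AA_A$, and multiplication by $X_e$ gives the bimodule structure. For $p\le r$ let $\iota_p^r:\mathcal{L}(X_p)\to\mathcal{L}(X_r)$ be $S\mapsto S\otimes I_{p^{-1}r}$ under $X_r\simeq X_p\otimes_AX_{p^{-1}r}$. $X$ is compactly aligned if $\iota^r_p(\mathcal{K}(X_p))\iota^r_q(\mathcal{K}(X_q))\subset\mathcal{K}(X_r)$ whenever $pP\cap qP=rP$. Induced traces. For a finite positive trace $\tau$ on $A$ and a $C^*$-correspondence $Y$, $\mathrm{Tr}^Y_\tau(T)=\sup_H\sum_{\xi\in H}\tau(\langle\xi,T\xi\rangle)$ for $T\in\mathcal{L}(Y)_+$, the supremum over finite $H\subset Y$ with $\sum_{\xi\in H}\theta_{\xi,\xi}\le1$, where $\theta_{\xi,\zeta}\eta=\xi\langle\zeta,\eta\rangle$. $\mathrm{Tr}^p_\tau(a)$ means $\mathrm{Tr}^{X_p}_\tau(\varphi_p(a))$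 for $a\in A_+$, a possibly infinite trace on $A$; the inequality for $J=\{q\}$ forces $\mathrm{Tr}^q_\tau(a)<\infty$. *)

theory Defs
  imports
    "HOL-Analysis.Analysis"
    "HOL-Algebra.Coset"
    "HOL-Library.Function_Algebras"
    "HOL-Library.Extended_Nat"
    "HOL-Library.Nonpos_Ints"
begin

section \<open>Complex vector spaces and C*-algebras\<close>

class complex_vector = ab_group_add +
  fixes scaleC :: "complex \<Rightarrow> 'a \<Rightarrow> 'a" (infixr "*\<^sub>C" 75)
  assumes scaleC_add_right: "a *\<^sub>C (x + y) = a *\<^sub>C x + a *\<^sub>C y"
    and scaleC_add_left: "(a + b) *\<^sub>C x = a *\<^sub>C x + b *\<^sub>C x"
    and scaleC_scaleC: "a *\<^sub>C b *\<^sub>C x = (a * b) *\<^sub>C x"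
    and scaleC_one: "1 *\<^sub>C x = x"

global_interpretation complex_vector: vector_space "scaleC :: complex \<Rightarrow> 'a \<Rightarrow> 'a::complex_vector"
  defines csubspace_def: csubspace = complex_vector.subspace
    and cspan_def: cspan = complex_vector.span
  by unfold_locales (simp_all add: scaleC_add_right scaleC_add_left scaleC_scaleC scaleC_one)

instantiation "fun" :: (type, complex_vector) complex_vector
begin
definition scaleC_fun :: "complex \<Rightarrow> ('a \<Rightarrow> 'b) \<Rightarrow> 'a \<Rightarrow> 'b"
  where "scaleC_fun c f = (\<lambda>x. c *\<^sub>C f x)"
instance
  by standard
    (simp_all add: scaleC_fun_def fun_eq_iff scaleC_add_right scaleC_add_left scaleC_scaleC scaleC_one)
end

text \<open>A C*-algebra, not assumed to be unital.\<close>

class cstar_algebra = complex_vector + real_normed_algebra + banach +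
  fixes star :: "'a \<Rightarrow> 'a"
  assumes scaleR_eq_scaleC: "r *\<^sub>R x = complex_of_real r *\<^sub>C x"
    and norm_scaleC: "norm (c *\<^sub>C x) = cmod c * norm x"
    and mult_scaleC_left: "(c *\<^sub>C x) * y = c *\<^sub>C (x * y)"
    and mult_scaleC_right: "x * (c *\<^sub>C y) = c *\<^sub>C (x * y)"
    and star_star: "star (star x) = x"
    and star_add: "star (x + y) = star x + star y"
    and star_scaleC: "star (c *\<^sub>C x) = cnj c *\<^sub>C star x"
    and star_mult: "star (x * y) = star y * star x"
    and cstar_identity: "norm (star x * x) = (norm x)\<^sup>2"

definition positive_elements :: "'a::cstar_algebra set"
  where "positive_elements = {star b * b | b. True}"

definition tracial_state :: "('a::cstar_algebra \<Rightarrow> complex) \<Rightarrow> bool"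
  where "tracial_state \<tau> \<longleftrightarrow>
    bounded_linear \<tau> \<and> (\<forall>c a. \<tau> (c *\<^sub>C a) = c * \<tau> a) \<and>
    (\<forall>a\<in>positive_elements. \<tau> a \<in> \<real>\<^sub>\<ge>\<^sub>0) \<and> onorm \<tau> = 1 \<and>
    (\<forall>a b. \<tau> (a * b) = \<tau> (b * a))"


section \<open>Hilbert modules and C*-correspondences\<close>

text \<open>
  A Hilbert module lives on a complex subspace \<open>vecs\<close> of its type, so that a family of modules
  indexed by a monoid can share one type. Inner products are linear in the second variable.
\<close>

record ('x, 'a) hilbert_module =
  vecs :: "'x set"
  rmult :: "'x \<Rightarrow> 'a \<Rightarrow> 'x"
  inprod :: "'x \<Rightarrow> 'x \<Rightarrow> 'a"

record ('x, 'a) correspondence = "('x, 'a) hilbert_module" +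
  lmult :: "'a \<Rightarrow> 'x \<Rightarrow> 'x"

definition mnorm :: "('x, 'a::cstar_algebra, 'm) hilbert_module_scheme \<Rightarrow> 'x \<Rightarrow> real"
  where "mnorm E \<xi> = sqrt (norm (inprod E \<xi> \<xi>))"

locale hilbert_module =
  fixes E :: "('x::complex_vector, 'a::cstar_algebra, 'm) hilbert_module_scheme"
  assumes subspace: "csubspace (vecs E)"
    and rmult_closed: "\<xi> \<in> vecs E \<Longrightarrow> rmult E \<xi> a \<in> vecs E"
    and rmult_add_left: "\<xi> \<in> vecs E \<Longrightarrow> \<eta> \<in> vecs E \<Longrightarrow>
          rmult E (\<xi> + \<eta>) a = rmult E \<xi> a + rmult E \<eta> a"
    and rmult_add_right: "\<xi> \<in> vecs E \<Longrightarrow> rmult E \<xi> (a + b) = rmult E \<xi> a + rmult E \<xi> b"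
    and rmult_scaleC_left: "\<xi> \<in> vecs E \<Longrightarrow> rmult E (c *\<^sub>C \<xi>) a = c *\<^sub>C rmult E \<xi> a"
    and rmult_scaleC_right: "\<xi> \<in> vecs E \<Longrightarrow> rmult E \<xi> (c *\<^sub>C a) = c *\<^sub>C rmult E \<xi> a"
    and rmult_assoc: "\<xi> \<in> vecs E \<Longrightarrow> rmult E (rmult E \<xi> a) b = rmult E \<xi> (a * b)"
    and inprod_add: "\<xi> \<in> vecs E \<Longrightarrow> \<eta> \<in> vecs E \<Longrightarrow> \<zeta> \<in> vecs E \<Longrightarrow>
          inprod E \<xi> (\<eta> + \<zeta>) = inprod E \<xi> \<eta> + inprod E \<xi> \<zeta>"
    and inprod_scaleC: "\<xi> \<in> vecs E \<Longrightarrow> \<eta> \<in> vecs E \<Longrightarrow>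
          inprod E \<xi> (c *\<^sub>C \<eta>) = c *\<^sub>C inprod E \<xi> \<eta>"
    and inprod_rmult: "\<xi> \<in> vecs E \<Longrightarrow> \<eta> \<in> vecs E \<Longrightarrow>
          inprod E \<xi> (rmult E \<eta> a) = inprod E \<xi> \<eta> * a"
    and inprod_star: "\<xi> \<in> vecs E \<Longrightarrow> \<eta> \<in> vecs E \<Longrightarrow> star (inprod E \<xi> \<eta>) = inprod E \<eta> \<xi>"
    and inprod_positive: "\<xi> \<in> vecs E \<Longrightarrow> inprod E \<xi> \<xi> \<in> positive_elements"
    and inprod_definite: "\<xi> \<in> vecs E \<Longrightarrow> inprod E \<xi> \<xi> = 0 \<Longrightarrow> \<xi> = 0"
    and complete: "(\<And>n. u n \<in> vecs E) \<Longrightarrow>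
          (\<And>\<epsilon>. \<epsilon> > 0 \<Longrightarrow> \<exists>N. \<forall>m\<ge>N. \<forall>n\<ge>N. mnorm E (u m - u n) < \<epsilon>) \<Longrightarrow>
          \<exists>\<xi>\<in>vecs E. (\<lambda>n::nat. mnorm E (u n - \<xi>)) \<longlonglongrightarrow> 0"

text \<open>
  An operator on \<open>E\<close> is a function that is zero off \<open>vecs E\<close>, so that equality, sums, multiples and
  composition of operators are those of functions; the identity operator is \<open>id_op E\<close>.
\<close>

definition is_adjoint ::
  "('x::complex_vector, 'a, 'm) hilbert_module_scheme \<Rightarrow> ('x \<Rightarrow> 'x) \<Rightarrow> ('x \<Rightarrow> 'x) \<Rightarrow> bool"
  where "is_adjoint E T T' \<longleftrightarrow>
    (\<forall>\<xi>\<in>vecs E. T \<xi> \<in> vecs E \<and> T' \<xi> \<in> vecs E) \<and>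
    (\<forall>\<xi>. \<xi> \<notin> vecs E \<longrightarrow> T \<xi> = 0 \<and> T' \<xi> = 0) \<and>
    (\<forall>\<xi>\<in>vecs E. \<forall>\<eta>\<in>vecs E. inprod E (T \<xi>) \<eta> = inprod E \<xi> (T' \<eta>))"

definition adjointable :: "('x::complex_vector, 'a, 'm) hilbert_module_scheme \<Rightarrow> ('x \<Rightarrow> 'x) set"
  where "adjointable E = {T. \<exists>T'. is_adjoint E T T'}"

definition id_op :: "('x::complex_vector, 'a, 'm) hilbert_module_scheme \<Rightarrow> 'x \<Rightarrow> 'x"
  where "id_op E = (\<lambda>\<xi>. if \<xi> \<in> vecs E then \<xi> else 0)"

definition positive_ops :: "('x::complex_vector, 'a, 'm) hilbert_module_scheme \<Rightarrow> ('x \<Rightarrow> 'x) set"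
  where "positive_ops E = {R' \<circ> R | R R'. is_adjoint E R R'}"

definition rank_one ::
  "('x::complex_vector, 'a, 'm) hilbert_module_scheme \<Rightarrow> 'x \<Rightarrow> 'x \<Rightarrow> 'x \<Rightarrow> 'x"
  where "rank_one E \<xi> \<zeta> = (\<lambda>\<eta>. if \<eta> \<in> vecs E then rmult E \<xi> (inprod E \<zeta> \<eta>) else 0)"

definition compact_ops ::
  "('x::complex_vector, 'a::cstar_algebra, 'm) hilbert_module_scheme \<Rightarrow> ('x \<Rightarrow> 'x) set"
  where "compact_ops E = {T \<in> adjointable E. \<forall>\<epsilon>>0.
    \<exists>F \<in> cspan {rank_one E \<xi> \<zeta> | \<xi> \<zeta>. \<xi> \<in> vecs E \<and> \<zeta> \<in> vecs E}.
      \<forall>\<eta>\<in>vecs E. mnorm E (T \<eta> - F \<eta>) \<le> \<epsilon> * mnorm E \<eta>}"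

locale cstar_correspondence = hilbert_module E
  for E :: "('x::complex_vector, 'a::cstar_algebra, 'm) correspondence_scheme" +
  assumes lmult_adjoint: "is_adjoint E (lmult E a) (lmult E (star a))"
    and lmult_add: "lmult E (a + b) = lmult E a + lmult E b"
    and lmult_scaleC: "lmult E (c *\<^sub>C a) = c *\<^sub>C lmult E a"
    and lmult_mult: "lmult E (a * b) = lmult E a \<circ> lmult E b"

definition essential ::
  "('x::complex_vector, 'a::cstar_algebra, 'm) correspondence_scheme \<Rightarrow> bool"
  where "essential E \<longleftrightarrow> (\<forall>\<xi>\<in>vecs E. \<forall>\<epsilon>>0.
    \<exists>\<eta> \<in> cspan {lmult E a \<zeta> | a \<zeta>. \<zeta> \<in> vecs E}. mnorm E (\<xi> - \<eta>) < \<epsilon>)"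

definition hilbert_module_iso ::
  "('x::complex_vector, 'a, 'm) hilbert_module_scheme \<Rightarrow>
   ('y::complex_vector, 'a, 'k) hilbert_module_scheme \<Rightarrow> ('x \<Rightarrow> 'y) \<Rightarrow> bool"
  where "hilbert_module_iso E F U \<longleftrightarrow>
    bij_betw U (vecs E) (vecs F) \<and>
    (\<forall>\<xi>\<in>vecs E. \<forall>\<eta>\<in>vecs E. U (\<xi> + \<eta>) = U \<xi> + U \<eta>) \<and>
    (\<forall>c. \<forall>\<xi>\<in>vecs E. U (c *\<^sub>C \<xi>) = c *\<^sub>C U \<xi>) \<and>
    (\<forall>\<xi>\<in>vecs E. \<forall>a. U (rmult E \<xi> a) = rmult F (U \<xi>) a) \<and>
    (\<forall>\<xi>\<in>vecs E. \<forall>\<eta>\<in>vecs E. inprod F (U \<xi>) (U \<eta>) = inprod E \<xi> \<eta>)"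

text \<open>The algebra as a correspondence over itself.\<close>

definition self_correspondence :: "('a::cstar_algebra, 'a) correspondence"
  where "self_correspondence =
    \<lparr>vecs = UNIV, rmult = (\<lambda>x a. x * a), inprod = (\<lambda>x y. star x * y), lmult = (\<lambda>a x. a * x)\<rparr>"


section \<open>Interior tensor products\<close>

text \<open>
  A list of pairs \<open>[(\<xi>\<^sub>1,\<zeta>\<^sub>1),\<dots>,(\<xi>\<^sub>k,\<zeta>\<^sub>k)]\<close> denotes the formal sum of the \<open>\<xi>\<^sub>i \<otimes> \<zeta>\<^sub>i\<close>; scalars are
  absorbed into the \<open>\<xi>\<^sub>i\<close>. The interior tensor product is the completion of the formal sums
  modulo vectors of length zero. The class of a Cauchy sequence \<open>u\<close> of formal sums is encoded as the
  function \<open>v \<mapsto> lim \<langle>v, u\<^sub>n\<rangle>\<close> on formal sums \<open>v\<close> (zero on lists that are not formal sums);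
  since formal sums are dense in the completion, two Cauchy sequences define the same function exactly if
  their difference tends to zero in the seminorm.
\<close>

definition formal_sums ::
  "('x, 'a, 'm) hilbert_module_scheme \<Rightarrow> ('y, 'a, 'k) hilbert_module_scheme \<Rightarrow> ('x \<times> 'y) list set"
  where "formal_sums E F = lists (vecs E \<times> vecs F)"

definition formal_inprod ::
  "('x, 'a::cstar_algebra, 'm) hilbert_module_scheme \<Rightarrow> ('y, 'a, 'k) correspondence_scheme \<Rightarrow>
   ('x \<times> 'y) list \<Rightarrow> ('x \<times> 'y) list \<Rightarrow> 'a"
  where "formal_inprod E F u v =
    (\<Sum>(\<xi>, \<zeta>)\<leftarrow>u. \<Sum>(\<xi>', \<zeta>')\<leftarrow>v. inprod F \<zeta> (lmult F (inprod E \<xi> \<xi>') \<zeta>'))"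

text \<open>The seminorm of \<open>u m - u n\<close> is written out by expanding the inner product.\<close>

definition formal_Cauchy ::
  "('x, 'a::cstar_algebra, 'm) hilbert_module_scheme \<Rightarrow> ('y, 'a, 'k) correspondence_scheme \<Rightarrow>
   (nat \<Rightarrow> ('x \<times> 'y) list) \<Rightarrow> bool"
  where "formal_Cauchy E F u \<longleftrightarrow>
    (\<forall>n. u n \<in> formal_sums E F) \<and>
    (\<forall>\<epsilon>>0. \<exists>N. \<forall>m\<ge>N. \<forall>n\<ge>N.
      sqrt (norm (formal_inprod E F (u m) (u m) - formal_inprod E F (u m) (u n)
                  - formal_inprod E F (u n) (u m) + formal_inprod E F (u n) (u n))) < \<epsilon>)"

definition represents ::
  "('x, 'a::cstar_algebra, 'm) hilbert_module_scheme \<Rightarrow> ('y, 'a, 'k) correspondence_scheme \<Rightarrow>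
   (nat \<Rightarrow> ('x \<times> 'y) list) \<Rightarrow> (('x \<times> 'y) list \<Rightarrow> 'a) \<Rightarrow> bool"
  where "represents E F u f \<longleftrightarrow>
    formal_Cauchy E F u \<and>
    (\<forall>v\<in>formal_sums E F. (\<lambda>n. formal_inprod E F v (u n)) \<longlonglongrightarrow> f v) \<and>
    (\<forall>v. v \<notin> formal_sums E F \<longrightarrow> f v = 0)"

definition tensor_module ::
  "('x, 'a::cstar_algebra, 'm) hilbert_module_scheme \<Rightarrow> ('y, 'a, 'k) correspondence_scheme \<Rightarrow>
   (('x \<times> 'y) list \<Rightarrow> 'a, 'a) hilbert_module"
  where "tensor_module E F =
    \<lparr>vecs = {f. \<exists>u. represents E F u f},
     rmult = (\<lambda>f a v. f v * a),
     inprod = (\<lambda>f g. THE c. \<forall>u. represents E F u f \<longrightarrow> (\<lambda>n. g (u n)) \<longlonglongrightarrow> c)\<rparr>"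

definition elem_tensor ::
  "('x, 'a::cstar_algebra, 'm) hilbert_module_scheme \<Rightarrow> ('y, 'a, 'k) correspondence_scheme \<Rightarrow>
   'x \<Rightarrow> 'y \<Rightarrow> ('x \<times> 'y) list \<Rightarrow> 'a"
  where "elem_tensor E F \<xi> \<zeta> =
    (\<lambda>v. if v \<in> formal_sums E F then formal_inprod E F v [(\<xi>, \<zeta>)] else 0)"

text \<open>The operator \<open>R \<otimes> I\<close>.\<close>

definition tensor_id ::
  "('x, 'a::cstar_algebra, 'm) hilbert_module_scheme \<Rightarrow> ('y, 'a, 'k) correspondence_scheme \<Rightarrow>
   ('x \<Rightarrow> 'x) \<Rightarrow> (('x \<times> 'y) list \<Rightarrow> 'a) \<Rightarrow> ('x \<times> 'y) list \<Rightarrow> 'a"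
  where "tensor_id E F R = (THE T. T \<in> adjointable (tensor_module E F) \<and>
    (\<forall>\<xi>\<in>vecs E. \<forall>\<zeta>\<in>vecs F. T (elem_tensor E F \<xi> \<zeta>) = elem_tensor E F (R \<xi>) \<zeta>))"


section \<open>Divisibility in monoids\<close>

text \<open>\<open>p <#\<^bsub>P\<^esub> carrier P\<close> is the right ideal \<open>pP\<close>; \<open>p \<le> q\<close> means \<open>q \<in> pP\<close>.\<close>

definition left_quotient :: "('p, 'm) monoid_scheme \<Rightarrow> 'p \<Rightarrow> 'p \<Rightarrow> 'p"
  where "left_quotient P p q = (THE x. x \<in> carrier P \<and> p \<otimes>\<^bsub>P\<^esub> x = q)"

text \<open>\<open>None\<close> stands for \<open>\<infinity>\<close>.\<close>

definition join :: "('p, 'm) monoid_scheme \<Rightarrow> 'p set \<Rightarrow> 'p option"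
  where "join P K =
    (let I = \<Inter>k\<in>K. k <#\<^bsub>P\<^esub> carrier P
     in if I = {} then None else Some (THE r. r \<in> carrier P \<and> I = r <#\<^bsub>P\<^esub> carrier P))"


section \<open>Right-angled Artin monoids\<close>

definition right_angled_matrix :: "'s set \<Rightarrow> ('s \<Rightarrow> 's \<Rightarrow> enat) \<Rightarrow> bool"
  where "right_angled_matrix S m \<longleftrightarrow>
    (\<forall>s\<in>S. m s s = 1) \<and>
    (\<forall>s\<in>S. \<forall>t\<in>S. m s t = m t s \<and> (s \<noteq> t \<longrightarrow> m s t \<in> {2, \<infinity>}))"

definition artin_step :: "'s set \<Rightarrow> ('s \<Rightarrow> 's \<Rightarrow> enat) \<Rightarrow> ('s list \<times> 's list) set"
  where "artin_step S m = {(u @ [s, t] @ v, u @ [t, s] @ v) | u v s t.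
    u \<in> lists S \<and> v \<in> lists S \<and> s \<in> S \<and> t \<in> S \<and> m s t = 2}"

definition artin_rel :: "'s set \<Rightarrow> ('s \<Rightarrow> 's \<Rightarrow> enat) \<Rightarrow> ('s list \<times> 's list) set"
  where "artin_rel S m = {(u, v). u \<in> lists S \<and> v \<in> lists S \<and>
    (u, v) \<in> (artin_step S m \<union> (artin_step S m)\<inverse>)\<^sup>*}"

definition artin_monoid :: "'s set \<Rightarrow> ('s \<Rightarrow> 's \<Rightarrow> enat) \<Rightarrow> 's list set monoid"
  where "artin_monoid S m =
    \<lparr>carrier = lists S // artin_rel S m,
     mult = (\<lambda>A B. \<Union>u\<in>A. \<Union>v\<in>B. artin_rel S m `` {u @ v}),
     one = artin_rel S m `` {[]}\<rparr>"

definition artin_generators :: "'s set \<Rightarrow> ('s \<Rightarrow> 's \<Rightarrow> enat) \<Rightarrow> 's list set set"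
  where "artin_generators S m = (\<lambda>s. artin_rel S m `` {[s]}) ` S"


section \<open>The tree of a list\<close>

text \<open>
  A map from \<open>{1,\<dots>,n}\<close> to \<open>P \<union> {\<infinity>}\<close> is a list of length \<open>n\<close> over \<open>'p option\<close>.
  \<open>G\<close> is the set of generators of \<open>P\<close>.
\<close>

definition is_leaf :: "('p, 'm) monoid_scheme \<Rightarrow> 'p set \<Rightarrow> 'p option list \<Rightarrow> bool"
  where "is_leaf P G xs \<longleftrightarrow> set xs \<subseteq> insert None (Some ` G) \<or> Some \<one>\<^bsub>P\<^esub> \<in> set xs"

definition split_index :: "('p, 'm) monoid_scheme \<Rightarrow> 'p option list \<Rightarrow> nat"
  where "split_index P xs = (LEAST i. i < length xs \<and>
    (\<exists>p \<in> carrier P - {\<one>\<^bsub>P\<^esub>}. \<exists>q \<in> carrier P - {\<one>\<^bsub>P\<^esub>}. xs ! i = Some (p \<otimes>\<^bsub>P\<^esub> q)))"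

definition left_child :: "('p, 'm) monoid_scheme \<Rightarrow> 'p \<Rightarrow> 'p option list \<Rightarrow> 'p option list"
  where "left_child P p xs = xs[split_index P xs := Some p]"

definition right_child :: "('p, 'm) monoid_scheme \<Rightarrow> 'p \<Rightarrow> 'p option list \<Rightarrow> 'p option list"
  where "right_child P p xs =
    map (\<lambda>x. case x of None \<Rightarrow> None | Some r \<Rightarrow> map_option (left_quotient P p) (join P {p, r})) xs"

text \<open>
  The factor \<open>p \<in> G\<close> split off at a node is in general not unique. A choice function prescribes
  it, depending on the word \<open>\<omega>\<close> in \<open>1, 2\<close> that labels the node and on the list at that node.
\<close>

definition splitting_choice ::
  "('p, 'm) monoid_scheme \<Rightarrow> 'p set \<Rightarrow> (nat list \<Rightarrow> 'p option list \<Rightarrow> 'p) \<Rightarrow> bool"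
  where "splitting_choice P G ch \<longleftrightarrow>
    (\<forall>\<omega> xs. set xs \<subseteq> insert None (Some ` carrier P) \<longrightarrow> \<not> is_leaf P G xs \<longrightarrow>
      ch \<omega> xs \<in> G \<and> ch \<omega> xs \<noteq> \<one>\<^bsub>P\<^esub> \<and>
      (\<exists>q \<in> carrier P - {\<one>\<^bsub>P\<^esub>}. xs ! split_index P xs = Some (ch \<omega> xs \<otimes>\<^bsub>P\<^esub> q)))"

inductive_set tree_nodes ::
  "('p, 'm) monoid_scheme \<Rightarrow> 'p set \<Rightarrow> (nat list \<Rightarrow> 'p option list \<Rightarrow> 'p) \<Rightarrow> 'p option list \<Rightarrow>
   (nat list \<times> 'p option list) set"
  for P G ch root
  where
    root: "([], root) \<in> tree_nodes P G ch root"
  | left: "(\<omega>, xs) \<in> tree_nodes P G ch root \<Longrightarrow> \<not> is_leaf P G xs \<Longrightarrow>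
      (\<omega> @ [1], left_child P (ch \<omega> xs) xs) \<in> tree_nodes P G ch root"
  | right: "(\<omega>, xs) \<in> tree_nodes P G ch root \<Longrightarrow> \<not> is_leaf P G xs \<Longrightarrow>
      (\<omega> @ [2], right_child P (ch \<omega> xs) xs) \<in> tree_nodes P G ch root"


section \<open>Product systems\<close>

definition multiplication_unitary ::
  "('p, 'k) monoid_scheme \<Rightarrow> ('p \<Rightarrow> ('x::complex_vector, 'a::cstar_algebra) correspondence) \<Rightarrow>
   ('p \<Rightarrow> 'p \<Rightarrow> 'x \<Rightarrow> 'x \<Rightarrow> 'x) \<Rightarrow> 'p \<Rightarrow> 'p \<Rightarrow> ((('x \<times> 'x) list \<Rightarrow> 'a) \<Rightarrow> 'x) \<Rightarrow> bool"
  where "multiplication_unitary P X mul p q U \<longleftrightarrow>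
    hilbert_module_iso (tensor_module (X p) (X q)) (X (p \<otimes>\<^bsub>P\<^esub> q)) U \<and>
    (\<forall>\<xi>\<in>vecs (X p). \<forall>\<zeta>\<in>vecs (X q). U (elem_tensor (X p) (X q) \<xi> \<zeta>) = mul p q \<xi> \<zeta>)"

text \<open>
  The union of the \<open>X p\<close> is a disjoint one, so the product \<open>mul p q\<close> carries the indices of its
  factors. The map \<open>j\<close> is the identification of \<open>A\<close> (the type \<open>'a\<close>) with \<open>X \<one>\<close> as
  correspondences. No unit is required beyond the action of \<open>X \<one>\<close>: for nonunital \<open>A\<close> there is none.
\<close>

locale product_system = monoid P
  for P :: "('p, 'k) monoid_scheme" (structure) +
  fixes X :: "'p \<Rightarrow> ('x::complex_vector, 'a::cstar_algebra) correspondence"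
    and mul :: "'p \<Rightarrow> 'p \<Rightarrow> 'x \<Rightarrow> 'x \<Rightarrow> 'x"
    and j :: "'a \<Rightarrow> 'x"
  assumes correspondence: "p \<in> carrier P \<Longrightarrow> cstar_correspondence (X p)"
    and mul_closed: "p \<in> carrier P \<Longrightarrow> q \<in> carrier P \<Longrightarrow> \<xi> \<in> vecs (X p) \<Longrightarrow> \<zeta> \<in> vecs (X q) \<Longrightarrow>
          mul p q \<xi> \<zeta> \<in> vecs (X (p \<otimes> q))"
    and mul_assoc: "p \<in> carrier P \<Longrightarrow> q \<in> carrier P \<Longrightarrow> r \<in> carrier P \<Longrightarrow>
          \<xi> \<in> vecs (X p) \<Longrightarrow> \<zeta> \<in> vecs (X q) \<Longrightarrow> \<eta> \<in> vecs (X r) \<Longrightarrow>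
          mul (p \<otimes> q) r (mul p q \<xi> \<zeta>) \<eta> = mul p (q \<otimes> r) \<xi> (mul q r \<zeta> \<eta>)"
    and mul_unitary: "p \<in> carrier P \<Longrightarrow> q \<in> carrier P \<Longrightarrow> p \<noteq> \<one> \<Longrightarrow>
          \<exists>U. multiplication_unitary P X mul p q U"
    and unit_iso: "hilbert_module_iso self_correspondence (X \<one>) j"
    and unit_lmult: "lmult (X \<one>) a (j b) = j (a * b)"
    and mul_unit_left: "p \<in> carrier P \<Longrightarrow> \<xi> \<in> vecs (X p) \<Longrightarrow> mul \<one> p (j a) \<xi> = lmult (X p) a \<xi>"
    and mul_unit_right: "p \<in> carrier P \<Longrightarrow> \<xi> \<in> vecs (X p) \<Longrightarrow> mul p \<one> \<xi> (j a) = rmult (X p) \<xi> a"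

text \<open>
  The map \<open>R \<mapsto> R \<otimes> I\<close> from the operators on \<open>X p\<close> to those on \<open>X r\<close>, for \<open>p \<le> r\<close>. For
  essential systems the multiplication unitary also exists when \<open>p = \<one>\<close>.
\<close>

definition iota ::
  "('p, 'k) monoid_scheme \<Rightarrow> ('p \<Rightarrow> ('x::complex_vector, 'a::cstar_algebra) correspondence) \<Rightarrow>
   ('p \<Rightarrow> 'p \<Rightarrow> 'x \<Rightarrow> 'x \<Rightarrow> 'x) \<Rightarrow> 'p \<Rightarrow> 'p \<Rightarrow> ('x \<Rightarrow> 'x) \<Rightarrow> 'x \<Rightarrow> 'x"
  where "iota P X mul p r R =
    (let q = left_quotient P p r;
         U = (SOME U. multiplication_unitary P X mul p q U);
         V = inv_into (vecs (tensor_module (X p) (X q))) U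
     in (\<lambda>\<eta>. if \<eta> \<in> vecs (X r) then U (tensor_id (X p) (X q) R (V \<eta>)) else 0))"

definition compactly_aligned ::
  "('p, 'k) monoid_scheme \<Rightarrow> ('p \<Rightarrow> ('x::complex_vector, 'a::cstar_algebra) correspondence) \<Rightarrow>
   ('p \<Rightarrow> 'p \<Rightarrow> 'x \<Rightarrow> 'x \<Rightarrow> 'x) \<Rightarrow> bool"
  where "compactly_aligned P X mul \<longleftrightarrow>
    (\<forall>p\<in>carrier P. \<forall>q\<in>carrier P. \<forall>r\<in>carrier P.
      (p <#\<^bsub>P\<^esub> carrier P) \<inter> (q <#\<^bsub>P\<^esub> carrier P) = r <#\<^bsub>P\<^esub> carrier P \<longrightarrow>
      (\<forall>R\<in>compact_ops (X p). \<forall>T\<in>compact_ops (X q).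
        iota P X mul p r R \<circ> iota P X mul q r T \<in> compact_ops (X r)))"


section \<open>Induced traces\<close>

definition induced_trace ::
  "('x::complex_vector, 'a::cstar_algebra, 'm) hilbert_module_scheme \<Rightarrow> ('a \<Rightarrow> complex) \<Rightarrow>
   ('x \<Rightarrow> 'x) \<Rightarrow> ereal"
  where "induced_trace Y \<tau> T =
    (SUP H \<in> {H. finite H \<and> H \<subseteq> vecs Y \<and> id_op Y - (\<Sum>\<xi>\<in>H. rank_one Y \<xi> \<xi>) \<in> positive_ops Y}.
      ereal (\<Sum>\<xi>\<in>H. Re (\<tau> (inprod Y \<xi> (T \<xi>)))))"

text \<open>
  The left hand side of the positivity condition. The sum is taken in \<open>ereal\<close>, where
  \<open>\<infinity> - \<infinity> = \<infinity>\<close>. This convention is immaterial once the condition is imposed for all singletons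
  \<open>J\<close> under consideration, since then all the traces that occur are finite.
\<close>

definition positivity_sum ::
  "('p, 'k) monoid_scheme \<Rightarrow> ('p \<Rightarrow> ('x::complex_vector, 'a::cstar_algebra) correspondence) \<Rightarrow>
   ('p \<Rightarrow> real) \<Rightarrow> real \<Rightarrow> ('a \<Rightarrow> complex) \<Rightarrow> 'a \<Rightarrow> 'p set \<Rightarrow> ereal"
  where "positivity_sum P X N \<beta> \<tau> a J =
    ereal (Re (\<tau> a)) +
    (\<Sum>K \<in> Pow J - {{}}. case join P K of
        None \<Rightarrow> 0
      | Some r \<Rightarrow> ereal ((- 1) ^ card K * N r powr (- \<beta>)) * induced_trace (X r) \<tau> (lmult (X r) a))"

end

theory Submission
  imports Defs
begin

text \<open>
  For \<open>r\<close> in the monoid \<open>P\<close> and a positive element \<open>a\<close> put \<open>F\<^sub>r(a) = N(r)\<^sup>-\<^sup>\<beta> Tr\<^bsup>r\<^esup>(a)\<close>. For a list \<open>\<lambda>\<close> of elements of \<open>P\<close> the left hand side of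
  the positivity condition is the alternating sum \<open>L(\<lambda>)(a)\<close> of the \<open>F\<^sub>r(a)\<close> over the joins \<open>r\<close> of sublists. If an
  entry of \<open>\<lambda>\<close> factors as \<open>g q\<close> with a generator \<open>g\<close>, then the difference of \<open>L(\<lambda>)\<close> and
  \<open>L(\<lambda>\<^sub>1)\<close> is the alternating sum of the \<open>F\<^bsub>gr\<^esub>\<close>, where \<open>r\<close> runs over the joins of sublists of \<open>\<lambda>\<^sub>2\<close>
  (\<open>altsum_split\<close>). So two facts are needed: positivity of the alternating sum of
  the \<open>F\<^sub>r\<close> must imply that of the \<open>F\<^bsub>gr\<^esub>\<close>, and the tree must be finite.

  The tree is finite because the sum of the lengths of the entries decreases in both children. In a
  right-angled Artin monoid \<open>g\<^sup>-\<^sup>1 (g \<or> x)\<close> is \<open>g\<^sup>-\<^sup>1 x\<close>, \<open>x\<close> or \<open>\<infinity>\<close>, so its length is at most that of \<open>x\<close>. This property, together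
  with a length function, left cancellation and generation by the elements of length one, is made into the locale \<open>graded_join_monoid\<close>;
  \<open>graded_join_monoid_artin\<close> verifies it on words.

  The first fact rests on the equation \<open>Tr\<^bsup>gr\<^esup>\<^sub>\<tau> = Tr\<^bsup>g\<^esup>\<^bsub>\<sigma>\<^esub>\<close> for \<open>\<sigma> = Tr\<^bsup>r\<^esup>\<^sub>\<tau>\<close>. It is proved in the following simultaneous
  form (\<open>tensor_traces_simultaneously\<close>): for finitely many \<open>r\<close> there is a single finite set
  \<open>H\<close> of vectors in \<open>X\<^sub>g\<close> such that \<open>Tr\<^bsup>gr\<^esup>(b\<^sup>* b)\<close> is approximately \<open>\<Sum>\<^bsub>\<xi>\<in>H\<^esub> Tr\<^bsup>r\<^esup>(\<langle>b\<^sup>* \<xi>, b\<^sup>* \<xi>\<rangle>)\<close>. Hence the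
  alternating sum of the \<open>F\<^bsub>gr\<^esub>\<close> at \<open>b\<^sup>* b\<close> is approximately a sum of values of the alternating sum
  of the \<open>F\<^sub>r\<close> at positive elements.

  The set \<open>H\<close> is an approximate unit \<open>k = \<Sum>\<^bsub>\<xi>\<in>H\<^esub> \<theta>\<^bsub>\<xi>,\<xi>\<^esub> \<le> 1\<close> of \<open>X\<^sub>g\<close> that nearly fixes finitely many vectors. Both estimates are obtained
  from one principle (\<open>weak_bound_le_induced_trace\<close>): a finite family of vectors \<open>v\<close> with \<open>\<Sum>\<^bsub>v\<^esub> \<theta>\<^bsub>v,v\<^esub> \<le> \<phi>(c)\<close>, where the
  inequality is only tested against the trace, satisfies \<open>\<Sum>\<^bsub>v\<^esub> \<tau>(\<langle>v, v\<rangle>) \<le> Tr(c)\<close>. To see this, one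
  expands \<open>\<langle>v, v\<rangle>\<close> in an approximate unit and interchanges the sums by the trace property. Inequalities under the trace can simply be added, whereas a sum of operators
  \<open>R\<^sup>* R\<close> would have to be brought into this form again.

  The approximate units are constructed from products of operators \<open>1 - \<theta>\<^bsub>y,y\<^esub>\<close>; the only square roots are those of
  \<open>1 - a\<close> for self-adjoint \<open>a\<close> with \<open>\<parallel>a\<parallel> < 1\<close>, which come from a contraction (\<open>square_root_below_one\<close>). What remains to
  be known about C*-algebras is that the norm is monotone on sums of elements \<open>b\<^sup>* b\<close>
  (\<open>norm_square_le_norm_sum\<close>). It yields the Cauchy-Schwarz inequality for Hilbert modules and is a consequence of the theorem of
  Kaplansky and Fukamiya (\<open>norm_one_minus_star_mult_self\<close>).
\<close>

section \<open>Positivity in unital C*-algebras\<close>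

lemma star_zero [simp]: "star (0::'a::cstar_algebra) = 0"
proof -
  have "star (0::'a) + star 0 = star 0 + 0" by (subst star_add [symmetric]) simp
  then show ?thesis by (simp only: add_left_cancel)
qed

lemma star_minus: "star (- x) = - star (x::'a::cstar_algebra)"
proof -
  have "star (- x) + star x = star (- x + x)" by (rule star_add [symmetric])
  then have "star (- x) + star x = 0" by simp
  then show ?thesis by (simp add: eq_neg_iff_add_eq_0)
qed

lemma star_diff: "star (x - y) = star x - star (y::'a::cstar_algebra)"
  using star_add [of x "- y"] by (simp add: star_minus)

lemma star_scaleR: "star (r *\<^sub>R x) = r *\<^sub>R star (x::'a::cstar_algebra)"
  by (simp add: scaleR_eq_scaleC star_scaleC)

lemma star_one [simp]: "star 1 = (1::'a::{cstar_algebra,real_normed_algebra_1})"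
  by (metis mult_1 mult_1_right star_mult star_star)

lemma star_of_real [simp]: "star (of_real r) = (of_real r::'a::{cstar_algebra,real_normed_algebra_1})"
  by (simp add: of_real_def star_scaleR)

lemma star_power: "star (x ^ n) = star (x::'a::{cstar_algebra,real_normed_algebra_1}) ^ n"
  by (induction n) (simp_all add: star_mult power_commutes)

lemma norm_star [simp]: "norm (star x) = norm (x::'a::cstar_algebra)"
proof -
  have *: "norm z \<le> norm (star z)" for z :: 'a
  proof (cases "norm z = 0")
    case False
    have "norm z * norm z \<le> norm (star z) * norm z"
      using norm_mult_ineq [of "star z" z] by (simp add: cstar_identity power2_eq_square)
    then show ?thesis using False by (simp add: mult_le_cancel_right)
  qed simp
  show ?thesis using * [of x] * [of "star x"] by (simp add: star_star)
qed

lemma bounded_linear_star: "bounded_linear (star :: 'a::cstar_algebra \<Rightarrow> 'a)"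
  by (rule bounded_linear_intro [where K = 1]) (simp_all add: star_add star_scaleR)

lemma tendsto_star [tendsto_intros]:
  "(f \<longlongrightarrow> a) F \<Longrightarrow> ((\<lambda>x. star (f x :: 'a::cstar_algebra)) \<longlongrightarrow> star a) F"
  by (rule bounded_linear.tendsto [OF bounded_linear_star])

lemma cstar_identity_right: "norm (x * star x) = (norm (x::'a::cstar_algebra))\<^sup>2"
  using cstar_identity [of "star x"] by (simp add: star_star)

lemma norm_selfadjoint_square: "star x = x \<Longrightarrow> norm (x * x) = (norm (x::'a::cstar_algebra))\<^sup>2"
  using cstar_identity [of x] by simp

text \<open>
  In a unital algebra \<open>r = 1 - sqrt (1 - y)\<close>; writing the equation \<open>(1 - r)\<^sup>2 = 1 - y\<close> as a
  fixed-point equation without a unit makes it solvable by contraction in every C*-algebra.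
\<close>

lemma square_root_below_one:
  fixes y :: "'a::cstar_algebra"
  assumes y: "norm y < 1" "star y = y"
  obtains r where "r + r = y + r * r" "star r = r" "norm r \<le> norm y"
    "\<forall>z. z * y = y * z \<longrightarrow> z * r = r * z"
proof -
  define C where "C = cball 0 (norm y) \<inter> {r. star r = r} \<inter> (\<Inter>z\<in>{z. z * y = y * z}. {r. z * r = r * z})"
  define f where "f r = (1/2) *\<^sub>R (y + r * r)" for r
  have cl: "closed C"
    unfolding C_def
  proof (intro closed_Int closed_cball closed_INT ballI)
    show "closed {r::'a. star r = r}"
      by (rule closed_Collect_eq) (auto intro!: linear_continuous_on bounded_linear_star continuous_on_id)
    show "closed {r. z * r = r * z}" for z :: 'a
      by (rule closed_Collect_eq) (auto intro!: continuous_intros)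
  qed
  have "0 \<in> C" by (simp add: C_def)
  have self: "f r \<in> C" if "r \<in> C" for r
  proof -
    have r: "norm r \<le> norm y" "star r = r" using that by (simp_all add: C_def)
    have "norm (f r) \<le> (1/2) * (norm y + norm r * norm r)"
      unfolding f_def norm_scaleR
      by (simp, rule order_trans [OF norm_triangle_ineq], simp add: norm_mult_ineq)
    also have "norm r * norm r \<le> norm y * 1"
      using r y by (intro mult_mono) auto
    finally have "norm (f r) \<le> norm y" by simp
    moreover have "star (f r) = f r"
      using r y by (simp add: f_def star_scaleR star_add star_mult)
    moreover have "z * f r = f r * z" if z: "z * y = y * z" for z
    proof -
      have zr: "z * r = r * z" using \<open>r \<in> C\<close> z by (auto simp: C_def)
      then have "z * (r * r) = r * r * z" by (metis mult.assoc)
      then show ?thesis using z by (simp add: f_def algebra_simps)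
    qed
    ultimately show ?thesis by (auto simp: C_def)
  qed
  have lip: "dist (f r) (f s) \<le> norm y * dist r s" if "r \<in> C" "s \<in> C" for r s
  proof -
    have "f r - f s = (1/2) *\<^sub>R (r * (r - s) + (r - s) * s)"
      unfolding f_def scaleR_diff_right [symmetric] by (simp add: left_diff_distrib right_diff_distrib)
    then have "norm (f r - f s) \<le> (1/2) * (norm r * norm (r - s) + norm (r - s) * norm s)"
      by (simp, intro order_trans [OF norm_triangle_ineq] add_mono norm_mult_ineq)
    also have "\<dots> \<le> (1/2) * (norm y * norm (r - s) + norm (r - s) * norm y)"
      using that by (intro mult_left_mono add_mono mult_right_mono mult_left_mono) (auto simp: C_def)
    finally show ?thesis by (simp add: dist_norm)
  qed
  have "\<exists>!x\<in>C. f x = x"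
    using y cl \<open>0 \<in> C\<close> self lip
    by (intro Banach_fix [where c = "norm y"]) (auto simp: complete_eq_closed)
  then obtain r where r: "r \<in> C" "f r = r" by blast
  have "r + r = 2 *\<^sub>R f r" using r by (simp add: scaleR_2)
  also have "\<dots> = y + r * r" by (simp add: f_def)
  finally have "r + r = y + r * r" .
  moreover have "star r = r" "norm r \<le> norm y" using r(1) by (simp_all add: C_def)
  moreover have "z * r = r * z" if "z * y = y * z" for z
    using r(1) that unfolding C_def by blast
  ultimately show thesis using that by blast
qed

text \<open>
  For self-adjoint \<open>a\<close> the condition \<open>\<parallel>t - a\<parallel> \<le> t\<close> says that the spectrum of \<open>a\<close> lies in \<open>[0, 2t]\<close>.
  In this form positivity is visibly preserved by sums.
\<close>

definition pos :: "'a::{cstar_algebra,real_normed_algebra_1} \<Rightarrow> bool"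
  where "pos a \<longleftrightarrow> star a = a \<and> (\<exists>t\<ge>0. norm (of_real t - a) \<le> t)"

lemma pos_selfadjoint: "pos a \<Longrightarrow> star a = a"
  by (simp add: pos_def)

lemma pos_add:
  assumes "pos a" "pos b" shows "pos (a + b)"
proof -
  obtain s t where st: "s \<ge> 0" "norm (of_real s - a) \<le> s" "t \<ge> 0" "norm (of_real t - b) \<le> t"
    using assms by (auto simp: pos_def)
  have "norm (of_real (s + t) - (a + b)) \<le> norm (of_real s - a) + norm (of_real t - b)"
    using norm_triangle_ineq [of "of_real s - a" "of_real t - b"] by (simp add: algebra_simps)
  then show ?thesis using st assms unfolding pos_def by (intro conjI exI [of _ "s + t"]) (auto simp: star_add)
qed

lemma pos_scale:
  assumes "pos a" "0 \<le> c" shows "pos (of_real c * a)"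
proof -
  obtain t where t: "t \<ge> 0" "norm (of_real t - a) \<le> t" using assms by (auto simp: pos_def)
  have "norm (of_real (c * t) - of_real c * a) = c * norm (of_real t - a)"
    using assms by (simp add: of_real_def flip: scaleR_scaleR scaleR_diff_right)
  then have "norm (of_real (c * t) - of_real c * a) \<le> c * t"
    using t assms by (simp add: mult_left_mono)
  moreover have "star (of_real c * a) = of_real c * a"
    using assms by (simp add: of_real_def star_scaleR pos_def)
  ultimately show ?thesis using t assms unfolding pos_def by (intro conjI exI [of _ "c * t"]) auto
qed

lemma pos_of_real: "0 \<le> c \<Longrightarrow> pos (of_real c)"
  by (auto simp: pos_def intro!: exI [of _ c])

lemma pos_of_real_diff: "star a = a \<Longrightarrow> norm a \<le> c \<Longrightarrow> pos (of_real c - a)"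
  unfolding pos_def using norm_ge_zero [of a]
  by (intro conjI exI [of _ c]) (auto simp: star_diff simp del: norm_ge_zero)

lemma pos_perturbed_square:
  assumes a: "pos a" and "\<delta> > 0"
  obtains s where "star s = s" "s * s = a + of_real \<delta>" "\<forall>z. z * a = a * z \<longrightarrow> z * s = s * z"
proof -
  obtain t where t: "t \<ge> 0" "norm (of_real t - a) \<le> t" using a by (auto simp: pos_def)
  define y where "y = (1 / (t + \<delta>)) *\<^sub>R (of_real t - a)"
  have "norm y \<le> t / (t + \<delta>)" using t \<open>\<delta> > 0\<close> by (simp add: y_def divide_right_mono)
  also have "t / (t + \<delta>) < 1" using t \<open>\<delta> > 0\<close> by simp
  finally have "norm y < 1" .
  moreover have "star y = y"
    using a by (simp add: y_def star_scaleR star_diff pos_def)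
  ultimately obtain r where r: "r + r = y + r * r" "star r = r" "norm r \<le> norm y"
      "\<forall>z. z * y = y * z \<longrightarrow> z * r = r * z"
    by (rule square_root_below_one)
  define s where "s = sqrt (t + \<delta>) *\<^sub>R (1 - r)"
  have "(1 - r) * (1 - r) = 1 - (r + r) + r * r" by (simp add: algebra_simps)
  also have "\<dots> = 1 - y" using r(1) by simp
  finally have "s * s = (t + \<delta>) *\<^sub>R (1 - y)" using t \<open>\<delta> > 0\<close> by (simp add: s_def)
  also have "\<dots> = a + of_real \<delta>"
    using t \<open>\<delta> > 0\<close> by (simp add: y_def scaleR_diff_right, simp add: of_real_def scaleR_add_left)
  finally have "s * s = a + of_real \<delta>" .
  moreover have "star s = s" by (simp add: s_def star_scaleR star_diff r(2))
  moreover have "z * s = s * z" if "z * a = a * z" for z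
  proof -
    have "z * y = y * z" using that by (simp add: y_def algebra_simps of_real_def)
    then have "z * r = r * z" by (rule r(4) [rule_format])
    then show ?thesis by (simp add: s_def algebra_simps)
  qed
  ultimately show thesis using that by blast
qed

text \<open>
  The element \<open>a + i s\<close> is a multiple of a unitary, and \<open>a\<close> is its real part.
\<close>

lemma norm_le_if_sum_of_squares:
  fixes a s :: "'a::{cstar_algebra,real_normed_algebra_1}"
  assumes sa: "star a = a" "star s = s" and comm: "a * s = s * a" and eq: "a * a + s * s = of_real (c\<^sup>2)" and "0 \<le> c"
  shows "norm a \<le> c"
proof -
  define u where "u = a + \<i> *\<^sub>C s"
  have su: "star u = a + (- \<i>) *\<^sub>C s" by (simp add: u_def star_add star_scaleC sa)
  have "star u * u = a * a + s * s"
    unfolding su unfolding u_def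
    by (simp add: algebra_simps mult_scaleC_left mult_scaleC_right scaleC_scaleC comm scaleC_one)
  then have "(norm u)\<^sup>2 = norm (of_real (c\<^sup>2) :: 'a)" unfolding eq by (metis cstar_identity)
  then have "(norm u)\<^sup>2 = c\<^sup>2" by (simp only: norm_of_real) simp
  then have nu: "norm u = c" using \<open>0 \<le> c\<close> by (simp add: power2_eq_iff_nonneg)
  have "u + star u = 2 *\<^sub>R a"
    unfolding su unfolding u_def by (simp add: scaleR_2 flip: scaleC_add_left)
  then have "2 * norm a = norm (u + star u)" by simp
  also have "\<dots> \<le> norm u + norm (star u)" by (rule norm_triangle_ineq)
  finally show ?thesis using nu by simp
qed

text \<open>
  If \<open>s\<^sup>2 = a\<close> and \<open>s'\<^sup>2 = c - a\<close> for commuting self-adjoint elements, then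
  \<open>(2 a - c)\<^sup>2 + (2 s s')\<^sup>2 = c\<^sup>2\<close>, and the preceding lemma applies. The square roots exist only for the elements
  shifted by some \<open>\<delta> > 0\<close>.
\<close>

lemma norm_le_if_pos_between:
  assumes a: "pos a" and ca: "pos (of_real c - a)" and "0 \<le> c"
  shows "norm (2 *\<^sub>R a - of_real c) \<le> c" "norm a \<le> c"
proof -
  have *: "norm (2 *\<^sub>R a - of_real c) \<le> c + 2 * \<delta>" if "\<delta> > 0" for \<delta>
  proof -
    obtain s where s: "star s = s" "s * s = a + of_real \<delta>" "\<forall>z. z * a = a * z \<longrightarrow> z * s = s * z"
      by (rule pos_perturbed_square [OF a \<open>\<delta> > 0\<close>])
    obtain s' where s': "star s' = s'" "s' * s' = of_real c - a + of_real \<delta>"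
      "\<forall>z. z * (of_real c - a) = (of_real c - a) * z \<longrightarrow> z * s' = s' * z"
      by (rule pos_perturbed_square [OF ca \<open>\<delta> > 0\<close>])
    have as: "a * s = s * a" using s(3) by blast
    then have "s * (of_real c - a) = (of_real c - a) * s" by (simp add: algebra_simps of_real_def)
    then have ss: "s * s' = s' * s" by (rule s'(3) [rule_format])
    have as': "a * s' = s' * a" by (rule s'(3) [rule_format]) (simp add: algebra_simps of_real_def)
    define b where "b = 2 *\<^sub>R a - of_real c"
    have b: "star b = b" using a by (simp add: b_def star_diff star_scaleR pos_def)
    have S: "star (2 *\<^sub>R (s * s')) = 2 *\<^sub>R (s * s')" by (simp add: star_scaleR star_mult s(1) s'(1) ss)
    have ass: "a * (s * s') = s * s' * a" using as as' by (metis mult.assoc)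
    have bs: "b * (2 *\<^sub>R (s * s')) = (2 *\<^sub>R (s * s')) * b"
      using ass by (simp add: b_def algebra_simps of_real_def)
    have "(s * s') * (s * s') = (s * s) * (s' * s')" using ss by (metis mult.assoc)
    also have "\<dots> = (a + of_real \<delta>) * (of_real c - a + of_real \<delta>)" by (simp only: s(2) s'(2))
    finally have "b * b + (2 *\<^sub>R (s * s')) * (2 *\<^sub>R (s * s'))
        = b * b + 4 *\<^sub>R ((a + of_real \<delta>) * (of_real c - a + of_real \<delta>))" by simp
    also have "\<dots> = of_real ((c + 2 * \<delta>)\<^sup>2)"
      by (simp add: b_def of_real_def algebra_simps power2_eq_square) (simp flip: scaleR_add_left)
    finally show ?thesis
      using norm_le_if_sum_of_squares [OF b S bs, of "c + 2 * \<delta>"] \<open>\<delta> > 0\<close> \<open>0 \<le> c\<close> by (simp add: b_def)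
  qed
  show **: "norm (2 *\<^sub>R a - of_real c) \<le> c"
  proof (rule field_le_epsilon)
    fix e :: real assume "e > 0" then show "norm (2 *\<^sub>R a - of_real c) \<le> c + e" using * [of "e/2"] by simp
  qed
  have "2 * norm a = norm ((2 *\<^sub>R a - of_real c) + of_real c)" by simp
  also have "\<dots> \<le> norm (2 *\<^sub>R a - of_real c) + norm (of_real c :: 'a)" by (rule norm_triangle_ineq)
  also have "\<dots> \<le> 2 * c" using ** \<open>0 \<le> c\<close> by simp
  finally show "norm a \<le> c" by simp
qed

lemma pos_norm_mono:
  assumes "pos a" "pos b" shows "norm a \<le> norm (a + b)"
proof (rule norm_le_if_pos_between(2) [OF \<open>pos a\<close>])
  have "pos (of_real (norm (a + b)) - (a + b) + b)"
    using assms by (intro pos_add pos_of_real_diff) (auto simp: star_add pos_def)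
  then show "pos (of_real (norm (a + b)) - a)" by simp
qed simp

text \<open>
  The radius in the definition of positivity can be any bound for the norm; in particular it can be chosen uniformly
  along convergent sequences, which makes positivity a closed condition.
\<close>

lemma pos_norm_diff:
  assumes "pos a" "norm a \<le> t" shows "norm (of_real t - a) \<le> t"
proof -
  have t: "0 \<le> t" using assms norm_ge_zero order_trans by blast
  have "norm (2 *\<^sub>R a - of_real t) \<le> t"
    by (rule norm_le_if_pos_between(1) [OF assms(1) pos_of_real_diff t])
      (rule pos_selfadjoint assms)+
  moreover have "2 *\<^sub>R (of_real t - a) = of_real t - (2 *\<^sub>R a - of_real t)"
    by (simp add: algebra_simps of_real_def flip: scaleR_add_left)
  then have "2 * norm (of_real t - a) = norm (of_real t - (2 *\<^sub>R a - of_real t))"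
    by (metis norm_scaleR abs_numeral)
  moreover have "\<dots> \<le> norm (of_real t :: 'a) + norm (2 *\<^sub>R a - of_real t)"
    by (rule norm_triangle_ineq4)
  ultimately show ?thesis using t by simp
qed

lemma pos_limit:
  assumes a: "star a = a" and b: "\<And>e. e > 0 \<Longrightarrow> \<exists>b. pos b \<and> norm (a - b) \<le> e"
  shows "pos a"
proof -
  have "norm (of_real (norm a + 1) - a) \<le> norm a + 1 + e" if e: "e > 0" for e
  proof -
    obtain b where b: "pos b" "norm (a - b) \<le> min e 1" using assms(2) [of "min e 1"] e by auto
    have "norm b \<le> norm a + 1" using b norm_triangle_ineq3 [of a b] by linarith
    then have "norm (of_real (norm a + 1) - b) \<le> norm a + 1" by (rule pos_norm_diff [OF b(1)])
    moreover have "norm (of_real (norm a + 1) - a) \<le> norm (of_real (norm a + 1) - b) + norm (a - b)"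
      using norm_triangle_ineq4 [of "of_real (norm a + 1) - b" "a - b"] by simp
    ultimately show ?thesis using b by linarith
  qed
  then have "norm (of_real (norm a + 1) - a) \<le> norm a + 1" by (rule field_le_epsilon)
  then show ?thesis using a unfolding pos_def by (intro conjI exI [of _ "norm a + 1"]) auto
qed

text \<open>
  For \<open>c > \<parallel>h\<parallel>\<close> write \<open>c\<^sup>2 - h\<^sup>2 = s\<^sup>2\<close>; then \<open>h\<^sup>2 + s\<^sup>2 = c\<^sup>2\<close> gives \<open>\<parallel>s\<parallel> \<le> c\<close>, that is,
  \<open>\<parallel>c\<^sup>2 - h\<^sup>2\<parallel> \<le> c\<^sup>2\<close>.
\<close>

lemma pos_square:
  assumes h: "star h = h" shows "pos (h * h)"
proof -
  define c where "c = norm h + 1"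
  have c: "norm h < c" "0 < c" by (auto simp: c_def intro: add_nonneg_pos)
  \<comment> \<open>The perturbation in \<open>pos_perturbed_square\<close> is absorbed by the gap between \<open>\<parallel>h\<parallel>\<close> and \<open>c\<close>.\<close>
  define \<delta> where "\<delta> = c\<^sup>2 - (norm h)\<^sup>2"
  have d: "\<delta> > 0" using c by (simp add: \<delta>_def power_strict_mono)
  have p: "pos (of_real ((norm h)\<^sup>2) - h * h)"
    using h by (intro pos_of_real_diff) (auto simp: star_mult norm_selfadjoint_square)
  obtain s where s: "star s = s" "s * s = of_real ((norm h)\<^sup>2) - h * h + of_real \<delta>"
    "\<forall>z. z * (of_real ((norm h)\<^sup>2) - h * h) = (of_real ((norm h)\<^sup>2) - h * h) * z \<longrightarrow> z * s = s * z"
    by (rule pos_perturbed_square [OF p d])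
  have "h * s = s * h"
    by (rule s(3) [rule_format]) (simp add: algebra_simps of_real_def)
  moreover have eq: "s * s = of_real (c\<^sup>2) - h * h" by (simp add: s(2) \<delta>_def)
  ultimately have "norm s \<le> c"
    using c s(1) h by (intro norm_le_if_sum_of_squares [of s h]) auto
  then have "norm (s * s) \<le> c\<^sup>2" by (simp add: norm_selfadjoint_square [OF s(1)] power_mono)
  then show ?thesis
    using h unfolding pos_def eq by (intro conjI exI [of _ "c\<^sup>2"]) (auto simp: star_mult)
qed

text \<open>
  Square roots of \<open>a + \<delta>\<close> and \<open>b + \<delta>\<close> commute, so \<open>(a + \<delta>) (b + \<delta>)\<close> is a square.
\<close>

lemma pos_mult:
  assumes a: "pos a" and b: "pos b" and ab: "a * b = b * a"
  shows "pos (a * b)"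
proof (rule pos_limit)
  show "star (a * b) = a * b" using a b ab by (simp add: star_mult pos_def)
  fix e :: real assume e: "e > 0"
  define K where "K = norm (a + b) + 1"
  have K: "K > 0" by (auto simp: K_def intro: add_nonneg_pos)
  define \<delta> where "\<delta> = min 1 (e / K)"
  have d: "\<delta> > 0" "\<delta> \<le> 1" "\<delta> * K \<le> e" using K e
    by (auto simp: \<delta>_def min_def field_simps)
  obtain s where s: "star s = s" "s * s = a + of_real \<delta>" "\<forall>z. z * a = a * z \<longrightarrow> z * s = s * z"
    by (rule pos_perturbed_square [OF a d(1)])
  obtain s' where s': "star s' = s'" "s' * s' = b + of_real \<delta>" "\<forall>z. z * b = b * z \<longrightarrow> z * s' = s' * z"
    by (rule pos_perturbed_square [OF b d(1)])
  have "b * s = s * b" using s(3) ab [symmetric] by blast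
  then have ss: "s * s' = s' * s" using s'(3) by simp
  have "(s * s') * (s * s') = (s * s) * (s' * s')" using ss by (metis mult.assoc)
  also have "\<dots> = a * b + (\<delta> *\<^sub>R (a + b) + of_real (\<delta> * \<delta>))"
    by (simp only: s(2) s'(2)) (simp add: of_real_def algebra_simps)
  finally have eq: "(s * s') * (s * s') = a * b + (\<delta> *\<^sub>R (a + b) + of_real (\<delta> * \<delta>))" .
  have "norm (\<delta> *\<^sub>R (a + b) + of_real (\<delta> * \<delta>)) \<le> norm (\<delta> *\<^sub>R (a + b)) + norm (of_real (\<delta> * \<delta>) :: 'a)"
    by (rule norm_triangle_ineq)
  also have "\<dots> = \<delta> * norm (a + b) + \<delta> * \<delta>"
    unfolding norm_of_real norm_scaleR using d(1) by simp
  also have "\<dots> \<le> \<delta> * norm (a + b) + \<delta> * 1" using d by (intro add_left_mono mult_left_mono) auto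
  also have "\<dots> \<le> e" using d(3) by (simp add: K_def algebra_simps)
  finally have "norm (a * b - (s * s') * (s * s')) \<le> e" unfolding eq
    by (metis add_diff_cancel_left' norm_minus_commute)
  moreover have "pos ((s * s') * (s * s'))" by (rule pos_square) (simp add: star_mult s(1) s'(1) ss)
  ultimately show "\<exists>c. pos c \<and> norm (a * b - c) \<le> e" by blast
qed

lemma pos_power: "pos a \<Longrightarrow> pos (a ^ n)"
  by (induction n) (auto simp: pos_of_real [of 1, simplified] intro!: pos_mult simp: power_commutes)

lemma pos_power_one_minus:
  assumes e: "pos e" "norm e \<le> 1" shows "pos (1 - e ^ n)"
proof -
  have "norm (e ^ n) \<le> 1" by (rule order_trans [OF norm_power_ineq]) (use e in \<open>simp add: power_le_one\<close>)
  then show ?thesis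
    using e pos_of_real_diff [of "e ^ n" 1] by (simp add: star_power pos_def)
qed

text \<open>
  Up to a constant this is the maximum of \<open>x\<^sup>n (1 - x)\<close> on \<open>[0, 1]\<close>. If \<open>d\<^sub>n = 1 - (n + 1) e\<^sup>n (1 - e)\<close>, then
  \<open>d\<^bsub>n+1\<^esub> = e d\<^sub>n + (1 - e) (1 - e\<^bsup>n+1\<^esup>)\<close>, so all \<open>d\<^sub>n\<close> are positive.
\<close>

lemma norm_power_mult_one_minus:
  assumes e: "pos e" "norm e \<le> 1"
  shows "norm (e ^ n * (1 - e)) \<le> 1 / (real n + 1)"
proof -
  have e1: "pos (1 - e)" using pos_power_one_minus [OF e, of 1] by simp
  define y where "y = e ^ n * (1 - e)"
  have "pos (1 - (real n + 1) *\<^sub>R (e ^ n * (1 - e)))"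
  proof (induction n)
    case 0 then show ?case using e by simp
  next
    case (Suc n)
    have c: "e * e ^ n = e ^ n * e" by (simp add: power_commutes)
    then have c': "e * (e ^ n * z) = e ^ n * (e * z)" for z by (metis mult.assoc)
    have "1 - (real (Suc n) + 1) *\<^sub>R (e ^ Suc n * (1 - e))
      = e * (1 - (real n + 1) *\<^sub>R (e ^ n * (1 - e))) + (1 - e) * (1 - e ^ Suc n)"
      by (simp add: algebra_simps c c' scaleR_2 flip: power_Suc power_Suc2)
    moreover have "e * (1 - (real n + 1) *\<^sub>R (e ^ n * (1 - e))) = (1 - (real n + 1) *\<^sub>R (e ^ n * (1 - e))) * e"
      by (simp add: algebra_simps c c')
    moreover have "(1 - e) * (1 - e ^ Suc n) = (1 - e ^ Suc n) * (1 - e)"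
      by (simp add: algebra_simps c c')
    ultimately show ?case
      using Suc e e1 pos_power_one_minus [OF e, of "Suc n"]
      by (auto intro!: pos_add pos_mult)
  qed
  then have "pos (1 - (real n + 1) *\<^sub>R y)" by (simp only: y_def)
  moreover have "pos ((real n + 1) *\<^sub>R y)"
  proof -
    have "pos y"
      unfolding y_def by (intro pos_mult pos_power e e1) (simp add: algebra_simps power_commutes)
    from pos_scale [OF this, of "real n + 1"] show ?thesis by (simp add: scaleR_conv_of_real)
  qed
  ultimately have "norm ((real n + 1) *\<^sub>R y) \<le> 1"
    using norm_le_if_pos_between(2) [of "(real n + 1) *\<^sub>R y" 1] by simp
  then have "\<bar>real n + 1\<bar> * norm y \<le> 1" by (simp only: norm_scaleR)
  then have "norm y \<le> 1 / (real n + 1)" by (simp add: field_simps)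
  then show ?thesis by (simp only: y_def)
qed

lemma norm_selfadjoint_power_of_two: "star e = e \<Longrightarrow> norm (e ^ (2 ^ k)) = norm e ^ (2 ^ k)"
  for e :: "'a::{cstar_algebra,real_normed_algebra_1}"
proof (induction k)
  case (Suc k)
  have "norm (e ^ (2 ^ Suc k)) = norm (e ^ 2 ^ k * e ^ 2 ^ k)" by (simp add: mult_2 power_add)
  also have "\<dots> = (norm (e ^ 2 ^ k))\<^sup>2"
    using Suc.prems by (intro norm_selfadjoint_square) (simp add: star_power)
  also have "\<dots> = norm e ^ (2 ^ Suc k)"
    using Suc by (simp add: mult.commute flip: power_mult)
  finally show ?case .
qed simp

text \<open>
  This is the theorem of Kaplansky and Fukamiya that \<open>x\<^sup>* x\<close> has no negative spectrum. If
  \<open>e\<close> is \<open>1 - x\<^sup>* x\<close> divided by its norm \<open>1 + \<mu> > 1\<close>, then a high power \<open>E\<close> of \<open>e\<close> selects the most negative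
  part of \<open>x\<^sup>* x\<close>: for \<open>z = x \<surd>E\<close> one has \<open>b = z\<^sup>* z \<approx> - \<mu> E\<close>. As \<open>z\<^sup>* z + z z\<^sup>*\<close> is a
  sum of squares of self-adjoint elements, \<open>c = z z\<^sup>*\<close> is then nearly positive, so that
  \<open>\<parallel>\<mu> - c\<parallel>\<close> is at most about \<open>\<mu>\<close>. But
  \<open>b (\<mu> - b) = z\<^sup>* (\<mu> - c) z\<close> makes \<open>\<mu>\<^sup>2 E (1 + E)\<close>, whose norm is \<open>2 \<mu>\<^sup>2\<close>, have norm at most about \<open>\<mu>\<^sup>2\<close>.
\<close>

lemma norm_one_minus_star_mult_self:
  fixes x :: "'a::{cstar_algebra,real_normed_algebra_1}"
  assumes x: "norm x \<le> 1"
  shows "norm (1 - star x * x) \<le> 1"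
proof (rule ccontr)
  define g where "g = 1 - star x * x"
  define l where "l = norm g"
  define \<mu> where "\<mu> = l - 1"
  assume "\<not> ?thesis"
  then have l: "l > 1" by (simp add: l_def g_def)
  then have mu: "\<mu> > 0" "l = \<mu> + 1" by (simp_all add: \<mu>_def)
  have "pos g"
    using pos_of_real_diff [of "star x * x" 1] x
    by (simp add: g_def star_mult star_star cstar_identity power_le_one)
  define e where "e = of_real (1/l) * g"
  have e: "pos e" using \<open>pos g\<close> l by (simp only: e_def) (rule pos_scale, auto)
  have "g \<noteq> 0" using l by (auto simp: l_def)
  then have ne: "norm e = 1" by (simp add: e_def l_def of_real_def)
  have se: "star e = e" using e by (rule pos_selfadjoint)
  obtain k where k: "20 * l / \<mu> < 2 ^ k" using real_arch_pow [of 2 "20 * l / \<mu>"] by auto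
  define E where "E = e ^ (2 ^ Suc k)"
  define z where "z = x * e ^ (2 ^ k)"
  define b where "b = star z * z"
  define c where "c = z * star z"
  define \<kappa> where "\<kappa> = (norm z)\<^sup>2"
  define w where "w = l *\<^sub>R (E * (1 - e))"
  define \<eta> where "\<eta> = \<mu> / 20"
  have E: "pos E" "star E = E" "norm E = 1"
    using e se norm_selfadjoint_power_of_two [OF se, of "Suc k"] by (simp_all add: E_def pos_power star_power ne)
  have EE: "norm (E * E) = 1" using norm_selfadjoint_square [OF E(2)] E(3) by simp
  have "norm (E * (1 - e)) \<le> 1 / (real (2 ^ Suc k) + 1)"
    unfolding E_def by (rule norm_power_mult_one_minus) (use e ne in auto)
  also have "\<dots> \<le> 1 / (20 * l / \<mu>)"
  proof (rule divide_left_mono)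
    have "0 < 20 * l / \<mu>" using l mu by simp
    moreover have "20 * l / \<mu> \<le> 2 * 2 ^ k + 1" using k zero_le_power [of "2::real" k] by linarith
    then show "20 * l / \<mu> \<le> real (2 ^ Suc k) + 1" by simp
    ultimately show "0 < (real (2 ^ Suc k) + 1) * (20 * l / \<mu>)" by (intro mult_pos_pos) auto
  qed simp
  also have "\<dots> = \<eta> / l" by (simp add: \<eta>_def)
  finally have "l * norm (E * (1 - e)) \<le> \<eta>" using l by (simp only: field_simps)
  then have w: "norm w \<le> \<eta>" unfolding w_def norm_scaleR using l by simp
  have sw: "star w = w"
    by (simp add: w_def E_def star_scaleR star_mult star_diff star_power se)
      (simp add: algebra_simps power_commutes)
  have "star x * x = 1 - of_real l * e" using l by (simp add: e_def g_def of_real_def)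
  then have "b = e ^ 2 ^ k * (1 - of_real l * e) * e ^ 2 ^ k"
    by (simp add: b_def z_def star_mult star_power se mult.assoc) (metis mult.assoc)
  also have "\<dots> = E - l *\<^sub>R (e * E)"
    by (simp add: E_def of_real_def algebra_simps mult_2 power_add power_commutes)
  also have "\<dots> = w - \<mu> *\<^sub>R E"
    by (simp add: w_def mu(2) E_def algebra_simps power_commutes)
  finally have b: "b = w - \<mu> *\<^sub>R E" .
  have nb: "norm b = \<kappa>" "norm c = \<kappa>" by (simp_all add: b_def c_def \<kappa>_def cstar_identity cstar_identity_right)
  have kappa: "\<kappa> \<le> \<mu> + \<eta>" "\<mu> - \<eta> \<le> \<kappa>"
  proof -
    have "norm b \<le> norm w + norm (\<mu> *\<^sub>R E)" unfolding b by (rule norm_triangle_ineq4)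
    then show "\<kappa> \<le> \<mu> + \<eta>" using nb w E mu by simp
    have "norm (\<mu> *\<^sub>R E) \<le> norm w + norm b" using norm_triangle_ineq4 [of w b] by (simp add: b)
    then show "\<mu> - \<eta> \<le> \<kappa>" using nb w E mu by simp
  qed
  have bc: "pos (b + c)"
  proof -
    define u where "u = z + star z"
    define v where "v = \<i> *\<^sub>C (z - star z)"
    have "star u = u" by (simp add: u_def star_add star_star add.commute)
    moreover have "star v = v"
      by (simp add: v_def star_scaleC star_diff star_star complex_vector.scale_right_diff_distrib)
    ultimately have "pos (u * u + v * v)" by (intro pos_add pos_square)
    then have "pos (of_real (1/2) * (u * u + v * v))" by (rule pos_scale) simp
    moreover have "u * u + v * v = 2 *\<^sub>R (b + c)"
      by (simp add: u_def v_def b_def c_def mult_scaleC_left mult_scaleC_right scaleC_scaleC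
          algebra_simps scaleR_2)
    ultimately show ?thesis by (simp add: of_real_def)
  qed
  have "pos (b + c + of_real \<mu> * E + (of_real \<eta> - w))"
    using mu by (intro pos_add bc pos_scale E pos_of_real_diff sw w) auto
  then have pc: "pos (c + of_real \<eta>)" by (simp add: b of_real_def algebra_simps)
  have "norm (c + of_real \<eta>) \<le> \<kappa> + \<eta>"
    using norm_triangle_ineq [of c "of_real \<eta>"] nb mu by (simp add: \<eta>_def)
  from pos_norm_diff [OF pc this] have "norm (of_real \<kappa> - c) \<le> \<kappa> + \<eta>" by simp
  moreover have "norm (of_real \<mu> - c) \<le> norm (of_real \<kappa> - c) + norm (of_real (\<mu> - \<kappa>) :: 'a)"
    using norm_triangle_ineq [of "of_real \<kappa> - c" "of_real (\<mu> - \<kappa>)"] by simp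
  moreover have "norm (of_real (\<mu> - \<kappa>) :: 'a) \<le> \<eta>" unfolding norm_of_real using kappa by simp
  ultimately have muc: "norm (of_real \<mu> - c) \<le> \<kappa> + 2 * \<eta>" by simp
  have "b * (of_real \<mu> - b) = star z * (of_real \<mu> - c) * z"
    by (simp add: b_def c_def right_diff_distrib left_diff_distrib mult.assoc of_real_def)
  then have "norm (b * (of_real \<mu> - b)) \<le> norm (star z) * norm (of_real \<mu> - c) * norm z"
    using norm_mult_ineq [of "star z * (of_real \<mu> - c)" z]
      mult_right_mono [OF norm_mult_ineq [of "star z" "of_real \<mu> - c"] norm_ge_zero [of z]] by simp
  also have "\<dots> = \<kappa> * norm (of_real \<mu> - c)" by (simp add: \<kappa>_def power2_eq_square)
  also have "\<dots> \<le> \<kappa> * (\<kappa> + 2 * \<eta>)" using muc by (intro mult_left_mono) (simp_all add: \<kappa>_def)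
  finally have 1: "norm (b * (of_real \<mu> - b)) \<le> \<kappa> * (\<kappa> + 2 * \<eta>)" .
  have "norm (w * (of_real \<mu> - b)) \<le> norm w * norm (of_real \<mu> - b)" by (rule norm_mult_ineq)
  also have "\<dots> \<le> \<eta> * (\<mu> + \<kappa>)"
    using norm_triangle_ineq4 [of "of_real \<mu>" b] mu nb w by (intro mult_mono) (auto simp: \<eta>_def)
  finally have 2: "norm (w * (of_real \<mu> - b)) \<le> \<eta> * (\<mu> + \<kappa>)" .
  have 3: "norm (\<mu> *\<^sub>R (E * w)) \<le> \<mu> * \<eta>"
    using norm_mult_ineq [of E w] E w mu by simp
  have "\<mu>\<^sup>2 *\<^sub>R (E * (1 + E)) = w * (of_real \<mu> - b) + \<mu> *\<^sub>R (E * w) - b * (of_real \<mu> - b)"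
    by (simp add: b of_real_def algebra_simps power2_eq_square)
  then have "norm (\<mu>\<^sup>2 *\<^sub>R (E * (1 + E))) \<le> \<eta> * (\<mu> + \<kappa>) + \<mu> * \<eta> + \<kappa> * (\<kappa> + 2 * \<eta>)"
    using 1 2 3 norm_triangle_ineq4 [of "w * (of_real \<mu> - b) + \<mu> *\<^sub>R (E * w)" "b * (of_real \<mu> - b)"]
      norm_triangle_ineq [of "w * (of_real \<mu> - b)" "\<mu> *\<^sub>R (E * w)"] by simp
  moreover have "2 \<le> norm (E * (1 + E))"
  proof -
    have "pos (1 - E)" unfolding E_def by (rule pos_power_one_minus) (use e ne in auto)
    then have "pos (E * (1 - E))" by (intro pos_mult E) (simp_all add: algebra_simps)
    moreover have "pos (of_real 2 * (E * E))" by (intro pos_scale pos_square E) simp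
    ultimately have "norm (of_real 2 * (E * E)) \<le> norm (of_real 2 * (E * E) + E * (1 - E))"
      by (intro pos_norm_mono)
    moreover have "of_real 2 * (E * E) + E * (1 - E) = E * (1 + E)"
      by (simp add: algebra_simps mult_2)
    moreover have "norm (of_real 2 * (E * E)) = 2"
      using EE norm_scaleR [of 2 "E * E"] by (simp add: scaleR_2 mult_2)
    ultimately show ?thesis by simp
  qed
  then have "\<mu>\<^sup>2 * 2 \<le> norm (\<mu>\<^sup>2 *\<^sub>R (E * (1 + E)))" by (simp add: mult_left_mono)
  ultimately have "\<mu>\<^sup>2 * 2 \<le> \<eta> * (\<mu> + \<kappa>) + \<mu> * \<eta> + \<kappa> * (\<kappa> + 2 * \<eta>)" by linarith
  also have "\<dots> \<le> \<eta> * (\<mu> + (\<mu> + \<eta>)) + \<mu> * \<eta> + (\<mu> + \<eta>) * ((\<mu> + \<eta>) + 2 * \<eta>)"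
    using kappa(1) mu by (intro add_mono mult_mono) (auto simp: \<eta>_def \<kappa>_def)
  also have "\<dots> < \<mu>\<^sup>2 * 2" using mu by (simp add: \<eta>_def power2_eq_square field_simps)
  finally show False by simp
qed

lemma pos_star_mult_self: "pos (star x * x)"
proof (cases "x = 0")
  case True then show ?thesis using pos_of_real [of 0] by simp
next
  case False
  define y where "y = (1 / norm x) *\<^sub>R x"
  have "norm (1 - star y * y) \<le> 1" using False by (intro norm_one_minus_star_mult_self) (simp add: y_def)
  then have "pos (star y * y)"
    unfolding pos_def by (intro conjI exI [of _ 1]) (simp_all add: star_mult star_star)
  then have "pos (of_real ((norm x)\<^sup>2) * (star y * y))" by (rule pos_scale) simp
  moreover have "of_real ((norm x)\<^sup>2) * (star y * y) = star x * x"
    using False by (simp add: y_def star_scaleR of_real_def power2_eq_square)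
  ultimately show ?thesis by simp
qed


section \<open>Adjoining a unit\<close>

text \<open>
  The pair \<open>(a, c)\<close> stands for \<open>a + c 1\<close>. Its norm is the larger one of \<open>\<bar>c\<bar>\<close> and of the operator
  norm of left multiplication on the algebra; the first term is there because the
  algebra may have a unit already.
\<close>

typedef (overloaded) 'a unitization = "UNIV :: ('a::cstar_algebra \<times> complex) set"
  morphisms unpair Unit_pair by simp

setup_lifting type_definition_unitization

definition left_mult_norm :: "'a::cstar_algebra \<times> complex \<Rightarrow> real"
  where "left_mult_norm u = onorm (\<lambda>x. fst u * x + snd u *\<^sub>C x)"

lemma bounded_linear_left_mult: "bounded_linear (\<lambda>x. a * x + c *\<^sub>C x)" for a :: "'a::cstar_algebra"
proof (rule bounded_linear_intro [where K = "norm a + cmod c"])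
  fix x y :: 'a and r :: real
  show "a * (x + y) + c *\<^sub>C (x + y) = a * x + c *\<^sub>C x + (a * y + c *\<^sub>C y)"
    by (simp add: algebra_simps scaleC_add_right)
  show "a * r *\<^sub>R x + c *\<^sub>C r *\<^sub>R x = r *\<^sub>R (a * x + c *\<^sub>C x)"
    by (simp add: scaleR_eq_scaleC mult_scaleC_right scaleC_scaleC scaleC_add_right mult.commute)
  have "norm (a * x + c *\<^sub>C x) \<le> norm (a * x) + norm (c *\<^sub>C x)" by (rule norm_triangle_ineq)
  also have "\<dots> \<le> norm x * (norm a + cmod c)"
    using norm_mult_ineq [of a x] by (simp add: norm_scaleC algebra_simps)
  finally show "norm (a * x + c *\<^sub>C x) \<le> norm x * (norm a + cmod c)" .
qed

lemma left_mult_norm_bound: "norm (a * x + c *\<^sub>C x) \<le> left_mult_norm (a, c) * norm x"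
  unfolding left_mult_norm_def using onorm [OF bounded_linear_left_mult [of a c], of x] by simp

lemma left_mult_norm_least:
  assumes "\<And>x. norm (a * x + c *\<^sub>C x) \<le> b * norm x" "0 \<le> b" shows "left_mult_norm (a, c) \<le> b"
  unfolding left_mult_norm_def by (rule onorm_bound) (simp_all add: assms)

lemma left_mult_norm_nonneg: "0 \<le> left_mult_norm u"
  unfolding left_mult_norm_def by (rule onorm_pos_le [OF bounded_linear_left_mult])

lemma left_mult_norm_zero_scalar: "left_mult_norm (a, 0) = norm a"
proof (rule antisym)
  show "left_mult_norm (a, 0) \<le> norm a" by (rule left_mult_norm_least) (simp_all add: norm_mult_ineq)
  have "norm (a * star a) \<le> left_mult_norm (a, 0) * norm (star a)"
    using left_mult_norm_bound [of a "star a" 0] by simp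
  then have "norm a * norm a \<le> left_mult_norm (a, 0) * norm a"
    by (simp add: cstar_identity_right power2_eq_square)
  then show "norm a \<le> left_mult_norm (a, 0)"
    using left_mult_norm_nonneg [of "(a, 0)"] by (cases "norm a = 0") (auto simp: mult_le_cancel_right)
qed

lemma left_mult_norm_scaleC: "left_mult_norm (k *\<^sub>C a, k * c) = cmod k * left_mult_norm (a, c)"
proof (rule antisym)
  have *: "left_mult_norm (k *\<^sub>C a, k * c) \<le> cmod k * left_mult_norm (a, c)" for k a c
  proof (rule left_mult_norm_least)
    fix x
    have "norm (k *\<^sub>C a * x + (k * c) *\<^sub>C x) = cmod k * norm (a * x + c *\<^sub>C x)"
      by (simp add: mult_scaleC_left flip: scaleC_scaleC scaleC_add_right norm_scaleC)
    then show "norm (k *\<^sub>C a * x + (k * c) *\<^sub>C x) \<le> cmod k * left_mult_norm (a, c) * norm x"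
      using left_mult_norm_bound [of a x c] by (simp add: mult_left_mono mult.assoc)
  qed (simp add: left_mult_norm_nonneg)
  show "left_mult_norm (k *\<^sub>C a, k * c) \<le> cmod k * left_mult_norm (a, c)" by (rule *)
  show "cmod k * left_mult_norm (a, c) \<le> left_mult_norm (k *\<^sub>C a, k * c)"
  proof (cases "k = 0")
    case False
    have "left_mult_norm (inverse k *\<^sub>C k *\<^sub>C a, inverse k * (k * c)) \<le> cmod (inverse k) * left_mult_norm (k *\<^sub>C a, k * c)"
      by (rule *)
    then show ?thesis using False by (simp add: scaleC_scaleC scaleC_one norm_divide field_simps)
  qed (simp add: left_mult_norm_nonneg)
qed

lemma left_mult_norm_triangle:
  "left_mult_norm (a + b, c + d) \<le> left_mult_norm (a, c) + left_mult_norm (b, d)"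
proof (rule left_mult_norm_least)
  fix x
  have "(a + b) * x + (c + d) *\<^sub>C x = (a * x + c *\<^sub>C x) + (b * x + d *\<^sub>C x)"
    by (simp add: algebra_simps scaleC_add_left)
  then show "norm ((a + b) * x + (c + d) *\<^sub>C x) \<le> (left_mult_norm (a, c) + left_mult_norm (b, d)) * norm x"
    using left_mult_norm_bound [of a x c] left_mult_norm_bound [of b x d]
      norm_triangle_ineq [of "a * x + c *\<^sub>C x" "b * x + d *\<^sub>C x"] by (simp add: algebra_simps)
qed (simp add: left_mult_norm_nonneg)

lemma left_mult_norm_mult:
  "left_mult_norm (a * b + c *\<^sub>C b + d *\<^sub>C a, c * d) \<le> left_mult_norm (a, c) * left_mult_norm (b, d)"
proof (rule left_mult_norm_least)
  fix x
  have "(a * b + c *\<^sub>C b + d *\<^sub>C a) * x + (c * d) *\<^sub>C x = a * (b * x + d *\<^sub>C x) + c *\<^sub>C (b * x + d *\<^sub>C x)"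
    by (simp add: algebra_simps scaleC_add_right mult_scaleC_left mult_scaleC_right scaleC_scaleC)
  then have "norm ((a * b + c *\<^sub>C b + d *\<^sub>C a) * x + (c * d) *\<^sub>C x) \<le> left_mult_norm (a, c) * norm (b * x + d *\<^sub>C x)"
    by (simp add: left_mult_norm_bound)
  also have "\<dots> \<le> left_mult_norm (a, c) * (left_mult_norm (b, d) * norm x)"
    by (intro mult_left_mono left_mult_norm_bound left_mult_norm_nonneg)
  finally show "norm ((a * b + c *\<^sub>C b + d *\<^sub>C a) * x + (c * d) *\<^sub>C x) \<le> left_mult_norm (a, c) * left_mult_norm (b, d) * norm x"
    by (simp add: mult.assoc)
qed (simp add: left_mult_norm_nonneg)

text \<open>
  For \<open>y = (a + c) x\<close> the C*-identity of the algebra gives \<open>\<parallel>y\<parallel>\<^sup>2 = \<parallel>x\<^sup>* (a + c)\<^sup>* (a + c) x\<parallel>\<close>.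
\<close>

lemma left_mult_norm_cstar_le:
  "(left_mult_norm (a, c))\<^sup>2 \<le> left_mult_norm (star a * a + cnj c *\<^sub>C a + c *\<^sub>C star a, cnj c * c)"
    (is "_ \<le> ?N")
proof -
  have "left_mult_norm (a, c) \<le> sqrt ?N"
  proof (rule left_mult_norm_least)
    fix x
    define y where "y = a * x + c *\<^sub>C x"
    have "star y * y = star x * ((star a * a + cnj c *\<^sub>C a + c *\<^sub>C star a) * x + (cnj c * c) *\<^sub>C x)"
      by (simp add: y_def star_add star_mult star_scaleC algebra_simps scaleC_add_right
          mult_scaleC_left mult_scaleC_right scaleC_scaleC)
    then have "(norm y)\<^sup>2 = norm (star x * ((star a * a + cnj c *\<^sub>C a + c *\<^sub>C star a) * x + (cnj c * c) *\<^sub>C x))"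
      by (metis cstar_identity)
    also have "\<dots> \<le> norm x * (?N * norm x)"
      by (rule order_trans [OF norm_mult_ineq])
        (simp only: norm_star, intro mult_left_mono left_mult_norm_bound norm_ge_zero)
    also have "\<dots> = (sqrt ?N * norm x)\<^sup>2"
      by (simp add: power_mult_distrib left_mult_norm_nonneg power2_eq_square)
    finally show "norm (a * x + c *\<^sub>C x) \<le> sqrt ?N * norm x"
      unfolding y_def [symmetric] by (rule power2_le_imp_le) (simp add: left_mult_norm_nonneg)
  qed (simp add: left_mult_norm_nonneg)
  then show ?thesis using left_mult_norm_nonneg power_mono [of "left_mult_norm (a, c)" "sqrt ?N" 2]
    by (simp add: left_mult_norm_nonneg)
qed

lemma left_mult_norm_star: "left_mult_norm (star a, cnj c) = left_mult_norm (a, c)"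
proof -
  have *: "left_mult_norm (a, c) \<le> left_mult_norm (star a, cnj c)" for a :: 'a and c
  proof (cases "left_mult_norm (a, c) = 0")
    case False
    have "(left_mult_norm (a, c))\<^sup>2 \<le> left_mult_norm (star a, cnj c) * left_mult_norm (a, c)"
      by (rule order_trans [OF left_mult_norm_cstar_le left_mult_norm_mult])
    then show ?thesis
      using False left_mult_norm_nonneg [of "(a, c)"] by (simp add: power2_eq_square mult_le_cancel_right)
  qed (simp add: left_mult_norm_nonneg)
  show ?thesis using * [of a c] * [of "star a" "cnj c"] by (simp add: star_star)
qed

instantiation unitization :: (cstar_algebra) "{complex_vector, real_normed_algebra_1}"
begin

lift_definition zero_unitization :: "'a unitization" is "(0, 0)" .
lift_definition one_unitization :: "'a unitization" is "(0, 1)" .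
lift_definition plus_unitization :: "'a unitization \<Rightarrow> 'a unitization \<Rightarrow> 'a unitization"
  is "\<lambda>u v. (fst u + fst v, snd u + snd v)" .
lift_definition minus_unitization :: "'a unitization \<Rightarrow> 'a unitization \<Rightarrow> 'a unitization"
  is "\<lambda>u v. (fst u - fst v, snd u - snd v)" .
lift_definition uminus_unitization :: "'a unitization \<Rightarrow> 'a unitization"
  is "\<lambda>u. (- fst u, - snd u)" .
lift_definition times_unitization :: "'a unitization \<Rightarrow> 'a unitization \<Rightarrow> 'a unitization"
  is "\<lambda>u v. (fst u * fst v + snd u *\<^sub>C fst v + snd v *\<^sub>C fst u, snd u * snd v)" .
lift_definition scaleC_unitization :: "complex \<Rightarrow> 'a unitization \<Rightarrow> 'a unitization"
  is "\<lambda>k u. (k *\<^sub>C fst u, k * snd u)" .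
lift_definition scaleR_unitization :: "real \<Rightarrow> 'a unitization \<Rightarrow> 'a unitization"
  is "\<lambda>r u. (complex_of_real r *\<^sub>C fst u, complex_of_real r * snd u)" .
lift_definition norm_unitization :: "'a unitization \<Rightarrow> real"
  is "\<lambda>u. max (left_mult_norm u) (cmod (snd u))" .

definition sgn_unitization :: "'a unitization \<Rightarrow> 'a unitization"
  where "sgn_unitization u = inverse (norm u) *\<^sub>R u"
definition dist_unitization :: "'a unitization \<Rightarrow> 'a unitization \<Rightarrow> real"
  where "dist_unitization u v = norm (u - v)"
definition uniformity_unitization :: "('a unitization \<times> 'a unitization) filter"
  where "uniformity_unitization = (INF e\<in>{0<..}. principal {(x, y). dist x y < e})"
definition open_unitization :: "'a unitization set \<Rightarrow> bool"
  where "open_unitization U = (\<forall>x\<in>U. eventually (\<lambda>(x', y). x' = x \<longrightarrow> y \<in> U) uniformity)"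

lemma unitization_norm_component_bounds:
  fixes u :: "'a unitization"
  shows "cmod (snd (unpair u)) \<le> norm u" "norm (fst (unpair u)) \<le> 2 * norm u"
proof -
  obtain a c where u: "unpair u = (a, c)" by fastforce
  have n: "norm u = max (left_mult_norm (a, c)) (cmod c)" by (simp add: norm_unitization.rep_eq u)
  show "cmod (snd (unpair u)) \<le> norm u" by (simp add: n u)
  have "left_mult_norm (a + 0, c + - c) \<le> left_mult_norm (a, c) + left_mult_norm (0 :: 'a, - c)"
    by (rule left_mult_norm_triangle)
  moreover have "left_mult_norm (0 :: 'a, - c) \<le> cmod c"
    by (rule left_mult_norm_least) (simp_all add: norm_scaleC)
  ultimately show "norm (fst (unpair u)) \<le> 2 * norm u"
    by (simp add: n u left_mult_norm_zero_scalar)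
qed

instance
proof
  fix u v w :: "'a unitization" and k l :: complex and r s :: real
  note alg = algebra_simps scaleC_add_left scaleC_add_right mult_scaleC_left mult_scaleC_right
    scaleC_scaleC scaleC_one
  show "u + v + w = u + (v + w)" by transfer (simp add: add.assoc)
  show "u + v = v + u" by transfer (simp add: add.commute)
  show "0 + u = u" by transfer simp
  show "- u + u = 0" by transfer simp
  show "u - v = u + - v" by transfer simp
  show "k *\<^sub>C (u + v) = k *\<^sub>C u + k *\<^sub>C v" by transfer (simp add: alg)
  show "(k + l) *\<^sub>C u = k *\<^sub>C u + l *\<^sub>C u" by transfer (simp add: alg)
  show "k *\<^sub>C l *\<^sub>C u = (k * l) *\<^sub>C u" by transfer (simp add: alg)
  show "1 *\<^sub>C u = u" by transfer (simp add: alg)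
  show "r *\<^sub>R (u + v) = r *\<^sub>R u + r *\<^sub>R v" by transfer (simp add: alg)
  show "(r + s) *\<^sub>R u = r *\<^sub>R u + s *\<^sub>R u" by transfer (simp add: alg)
  show "r *\<^sub>R s *\<^sub>R u = (r * s) *\<^sub>R u" by transfer (simp add: alg)
  show "1 *\<^sub>R u = u" by transfer (simp add: alg)
  show "u * v * w = u * (v * w)" by transfer (simp add: alg)
  show "(u + v) * w = u * w + v * w" by transfer (simp add: alg)
  show "u * (v + w) = u * v + u * w" by transfer (simp add: alg)
  show "r *\<^sub>R u * v = r *\<^sub>R (u * v)" by transfer (simp add: alg)
  show "u * r *\<^sub>R v = r *\<^sub>R (u * v)" by transfer (simp add: alg)
  show "1 * u = u" by transfer (simp add: alg)
  show "u * 1 = u" by transfer (simp add: alg)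
  show "(0::'a unitization) \<noteq> 1" by transfer simp
  show "dist u v = norm (u - v)" by (rule dist_unitization_def)
  show "sgn u = inverse (norm u) *\<^sub>R u" by (rule sgn_unitization_def)
  show "(uniformity :: ('a unitization \<times> 'a unitization) filter) = (INF e\<in>{0<..}. principal {(x, y). dist x y < e})"
    by (rule uniformity_unitization_def)
  show "open U = (\<forall>x\<in>U. eventually (\<lambda>(x', y). x' = x \<longrightarrow> y \<in> U) uniformity)" for U :: "'a unitization set"
    by (rule open_unitization_def)
  have nC: "norm (k *\<^sub>C u) = cmod k * norm u" for k and u :: "'a unitization"
    by transfer (simp add: left_mult_norm_scaleC norm_mult max_mult_distrib_left)
  show "norm (r *\<^sub>R u) = \<bar>r\<bar> * norm u"
    using nC [of "complex_of_real r" u] by (metis norm_of_real scaleR_unitization.abs_eq scaleC_unitization.abs_eq unpair_inverse)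
  show tri: "norm (u + v) \<le> norm u + norm v"
    by transfer (use left_mult_norm_triangle norm_triangle_ineq in \<open>fastforce simp: max_def intro: order_trans\<close>)
  show "norm u = 0 \<longleftrightarrow> u = 0"
  proof
    assume "norm u = 0"
    then have "snd (unpair u) = 0" "fst (unpair u) = 0"
      using unitization_norm_component_bounds [of u] by simp_all
    then show "u = 0" by transfer (simp add: prod_eq_iff)
  next
    assume "u = 0" then show "norm u = 0"
      by (simp, transfer, simp add: left_mult_norm_zero_scalar)
  qed
  show "norm (u * v) \<le> norm u * norm v"
  proof -
    obtain a c b d where u: "unpair u = (a, c)" and v: "unpair v = (b, d)" by fastforce
    have "left_mult_norm (a, c) * left_mult_norm (b, d) \<le> norm u * norm v"
      by (intro mult_mono) (simp_all add: norm_unitization.rep_eq u v left_mult_norm_nonneg max.coboundedI1)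
    then have "left_mult_norm (a * b + c *\<^sub>C b + d *\<^sub>C a, c * d) \<le> norm u * norm v"
      by (rule order_trans [OF left_mult_norm_mult])
    moreover have "cmod (c * d) \<le> norm u * norm v"
      unfolding norm_mult by (intro mult_mono) (simp_all add: norm_unitization.rep_eq u v max.coboundedI2 left_mult_norm_nonneg)
    ultimately show ?thesis by (simp add: norm_unitization.rep_eq [of "u * v"] times_unitization.rep_eq u v)
  qed
  show "norm (1::'a unitization) = 1"
  proof -
    have "left_mult_norm (0::'a, 1) \<le> 1" by (rule left_mult_norm_least) (simp_all add: scaleC_one)
    then show ?thesis by transfer (simp add: max_def)
  qed
qed

end

instance unitization :: (cstar_algebra) banach
proof
  fix f :: "nat \<Rightarrow> 'a unitization"
  assume f: "Cauchy f"
  define F where "F n = fst (unpair (f n))" for n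
  define g where "g n = snd (unpair (f n))" for n
  have cauchy_comp: "norm (F m - F n) \<le> 2 * dist (f m) (f n)" "cmod (g m - g n) \<le> dist (f m) (f n)" for m n
    using unitization_norm_component_bounds [of "f m - f n"]
    by (simp_all add: F_def g_def dist_unitization_def minus_unitization.rep_eq)
  have "Cauchy F"
  proof (rule metric_CauchyI)
    fix e :: real assume "e > 0"
    then obtain M where M: "\<forall>m\<ge>M. \<forall>n\<ge>M. dist (f m) (f n) < e / 2" using metric_CauchyD [OF f, of "e/2"] by auto
    have "dist (F m) (F n) < e" if "m \<ge> M" "n \<ge> M" for m n
    proof -
      have "dist (f m) (f n) < e / 2" using M that by blast
      then show ?thesis using cauchy_comp(1) [of m n] by (simp add: dist_norm)
    qed
    then show "\<exists>M. \<forall>m\<ge>M. \<forall>n\<ge>M. dist (F m) (F n) < e" by blast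
  qed
  then obtain A where A: "F \<longlonglongrightarrow> A" using Cauchy_convergent convergent_def by blast
  have "Cauchy g"
  proof (rule metric_CauchyI)
    fix e :: real assume "e > 0"
    then obtain M where M: "\<forall>m\<ge>M. \<forall>n\<ge>M. dist (f m) (f n) < e" using metric_CauchyD [OF f, of e] by auto
    have "dist (g m) (g n) < e" if "m \<ge> M" "n \<ge> M" for m n
    proof -
      have "dist (f m) (f n) < e" using M that by blast
      then show ?thesis using cauchy_comp(2) [of m n] by (simp add: dist_norm)
    qed
    then show "\<exists>M. \<forall>m\<ge>M. \<forall>n\<ge>M. dist (g m) (g n) < e" by blast
  qed
  then obtain C where C: "g \<longlonglongrightarrow> C" using Cauchy_convergent convergent_def by blast
  have bound: "norm (f n - Unit_pair (A, C)) \<le> norm (F n - A) + cmod (g n - C)" for n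
  proof -
    have "unpair (f n - Unit_pair (A, C)) = (F n - A, g n - C)"
      by (simp add: minus_unitization.rep_eq F_def g_def Unit_pair_inverse)
    moreover have "left_mult_norm (F n - A + 0, 0 + (g n - C)) \<le> left_mult_norm (F n - A, 0) + left_mult_norm (0 :: 'a, g n - C)"
      by (rule left_mult_norm_triangle)
    moreover have "left_mult_norm (0 :: 'a, g n - C) \<le> cmod (g n - C)"
      by (rule left_mult_norm_least) (simp_all add: norm_scaleC)
    ultimately show ?thesis by (simp add: norm_unitization.rep_eq left_mult_norm_zero_scalar)
  qed
  have "(\<lambda>n. norm (F n - A) + cmod (g n - C)) \<longlonglongrightarrow> 0"
    using tendsto_add [OF tendsto_norm_zero [OF LIM_zero [OF A]] tendsto_norm_zero [OF LIM_zero [OF C]]] by simp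
  then have to0: "(\<lambda>n. norm (f n - Unit_pair (A, C))) \<longlonglongrightarrow> 0"
    by (rule Lim_null_comparison [rotated]) (simp add: bound)
  have "f \<longlonglongrightarrow> Unit_pair (A, C)"
    unfolding lim_sequentially
  proof (intro allI impI)
    fix e :: real assume "e > 0"
    with to0 show "\<exists>N. \<forall>n\<ge>N. dist (f n) (Unit_pair (A, C)) < e"
      unfolding lim_sequentially by (simp add: dist_unitization_def)
  qed
  then show "convergent f" by (auto simp: convergent_def)
  qed

instantiation unitization :: (cstar_algebra) cstar_algebra
begin

lift_definition star_unitization :: "'a unitization \<Rightarrow> 'a unitization"
  is "\<lambda>u. (star (fst u), cnj (snd u))" .

instance
proof
  fix u v :: "'a unitization" and k :: complex and r :: real
  note alg = algebra_simps scaleC_add_left scaleC_add_right mult_scaleC_left mult_scaleC_right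
    scaleC_scaleC scaleC_one
  show "r *\<^sub>R u = complex_of_real r *\<^sub>C u" by transfer simp
  show "k *\<^sub>C u * v = k *\<^sub>C (u * v)" by transfer (simp add: alg)
  show "u * k *\<^sub>C v = k *\<^sub>C (u * v)" by transfer (simp add: alg)
  show "star (star u) = u" by transfer (simp add: star_star)
  show "star (u + v) = star u + star v" by transfer (simp add: star_add)
  show "star (k *\<^sub>C u) = cnj k *\<^sub>C star u" by transfer (simp add: star_scaleC)
  show "star (u * v) = star v * star u" by transfer (simp add: star_add star_mult star_scaleC alg)
  show "norm (k *\<^sub>C u) = cmod k * norm u"
    by transfer (simp add: left_mult_norm_scaleC norm_mult max_mult_distrib_left)
  show "norm (star u * u) = (norm u)\<^sup>2"
  proof -
    obtain a c where u: "unpair u = (a, c)" by fastforce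
    have "left_mult_norm (star a * a + cnj c *\<^sub>C a + c *\<^sub>C star a, cnj c * c) \<le> left_mult_norm (star a, cnj c) * left_mult_norm (a, c)"
      by (rule left_mult_norm_mult)
    then have "left_mult_norm (star a * a + cnj c *\<^sub>C a + c *\<^sub>C star a, cnj c * c) = (left_mult_norm (a, c))\<^sup>2"
      using left_mult_norm_cstar_le [of a c] by (simp add: left_mult_norm_star power2_eq_square)
    moreover have "cmod (cnj c * c) = (cmod c)\<^sup>2" by (simp add: norm_mult power2_eq_square)
    moreover have "max (x\<^sup>2) (y\<^sup>2) = (max x y)\<^sup>2" if "0 \<le> x" "0 \<le> y" for x y :: real
      using that by (simp add: max_def power_mono_iff)
    ultimately show ?thesis
      by (simp add: norm_unitization.rep_eq times_unitization.rep_eq star_unitization.rep_eq u left_mult_norm_nonneg)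
  qed
qed

end

lift_definition embed :: "'a::cstar_algebra \<Rightarrow> 'a unitization" is "\<lambda>a. (a, 0)" .

lemma embed_add: "embed (a + b) = embed a + embed b" by transfer simp
lemma embed_mult: "embed (a * b) = embed a * embed b" by transfer simp
lemma embed_star: "embed (star a) = star (embed a)" by transfer simp
lemma norm_embed: "norm (embed a) = norm a"
  by transfer (simp add: left_mult_norm_zero_scalar)

text \<open>
  Monotonicity of the norm on positive elements, in a form that mentions no unit. It is all that the
  theory of Hilbert modules below needs to know about the order of the algebra.
\<close>

lemma norm_square_le_norm_sum:
  fixes x :: "'a::cstar_algebra"
  assumes "x = star a * a + sum_list (map (\<lambda>b. star b * b) bs)"
  shows "(norm a)\<^sup>2 \<le> norm x"
proof -
  have "pos (embed (sum_list (map (\<lambda>b. star b * b) bs)))"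
  proof (induction bs)
    case Nil
    have "embed (0::'a) = 0" by transfer simp
    then show ?case using pos_of_real [of 0] by simp
  qed (simp add: embed_add embed_mult embed_star pos_add pos_star_mult_self)
  then have "norm (embed (star a * a)) \<le> norm (embed (star a * a) + embed (sum_list (map (\<lambda>b. star b * b) bs)))"
    by (intro pos_norm_mono) (simp_all add: embed_mult embed_star pos_star_mult_self)
  then show ?thesis by (simp add: assms norm_embed cstar_identity flip: embed_add)
qed

section \<open>Hilbert modules\<close>

lemma star_mult_self_positive [simp]: "star b * b \<in> positive_elements"
  by (auto simp: positive_elements_def)

context hilbert_module
begin

lemma vecs_zero: "0 \<in> vecs E"
  using subspace by (rule complex_vector.subspace_0)

lemma vecs_add: "x \<in> vecs E \<Longrightarrow> y \<in> vecs E \<Longrightarrow> x + y \<in> vecs E"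
  using subspace by (rule complex_vector.subspace_add)

lemma vecs_diff: "x \<in> vecs E \<Longrightarrow> y \<in> vecs E \<Longrightarrow> x - y \<in> vecs E"
  using subspace by (rule complex_vector.subspace_diff)

lemma vecs_scaleC: "x \<in> vecs E \<Longrightarrow> c *\<^sub>C x \<in> vecs E"
  using subspace by (rule complex_vector.subspace_scale)

lemma vecs_sum_list: "(\<And>x. x \<in> set xs \<Longrightarrow> f x \<in> vecs E) \<Longrightarrow> sum_list (map f xs) \<in> vecs E"
  by (induction xs) (auto intro: vecs_zero vecs_add)

lemma inprod_add_left:
  assumes "x \<in> vecs E" "y \<in> vecs E" "z \<in> vecs E"
  shows "inprod E (x + y) z = inprod E x z + inprod E y z"
proof -
  have "star (inprod E z (x + y)) = star (inprod E z x) + star (inprod E z y)"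
    by (simp add: inprod_add assms star_add)
  then show ?thesis using assms by (simp add: inprod_star vecs_add)
qed

lemma inprod_scaleC_left:
  assumes "x \<in> vecs E" "z \<in> vecs E"
  shows "inprod E (c *\<^sub>C x) z = cnj c *\<^sub>C inprod E x z"
proof -
  have "star (inprod E z (c *\<^sub>C x)) = cnj c *\<^sub>C star (inprod E z x)"
    by (simp add: inprod_scaleC assms star_scaleC)
  then show ?thesis using assms by (simp add: inprod_star vecs_scaleC)
qed

lemma inprod_rmult_left:
  assumes "x \<in> vecs E" "z \<in> vecs E"
  shows "inprod E (rmult E x a) z = star a * inprod E x z"
proof -
  have "star (inprod E z (rmult E x a)) = star a * star (inprod E z x)"
    by (simp add: inprod_rmult assms star_mult)
  then show ?thesis using assms by (simp add: inprod_star rmult_closed)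
qed

lemma inprod_diff:
  assumes "x \<in> vecs E" "y \<in> vecs E" "z \<in> vecs E"
  shows "inprod E x (y - z) = inprod E x y - inprod E x z"
  using inprod_add [of x "y - z" z] assms by (simp add: vecs_diff algebra_simps)

lemma inprod_diff_left:
  assumes "x \<in> vecs E" "y \<in> vecs E" "z \<in> vecs E"
  shows "inprod E (x - y) z = inprod E x z - inprod E y z"
  using inprod_add_left [of "x - y" y z] assms by (simp add: vecs_diff algebra_simps)

lemma inprod_zero [simp]: "x \<in> vecs E \<Longrightarrow> inprod E x 0 = 0"
  using inprod_diff [of x x x] by simp

lemma inprod_zero_left [simp]: "x \<in> vecs E \<Longrightarrow> inprod E 0 x = 0"
  using inprod_diff_left [of x x x] by simp

lemma inprod_sum_list:
  "x \<in> vecs E \<Longrightarrow> (\<And>y. y \<in> set ys \<Longrightarrow> f y \<in> vecs E) \<Longrightarrow>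
    inprod E x (sum_list (map f ys)) = sum_list (map (\<lambda>y. inprod E x (f y)) ys)"
  by (induction ys) (auto simp: inprod_add vecs_sum_list)

lemma inprod_sum_list_left:
  "x \<in> vecs E \<Longrightarrow> (\<And>y. y \<in> set ys \<Longrightarrow> f y \<in> vecs E) \<Longrightarrow>
    inprod E (sum_list (map f ys)) x = sum_list (map (\<lambda>y. inprod E (f y) x) ys)"
  by (induction ys) (auto simp: inprod_add_left vecs_sum_list)

lemma eq_if_inprod_eq:
  assumes "x \<in> vecs E" "y \<in> vecs E" "\<And>z. z \<in> vecs E \<Longrightarrow> inprod E z x = inprod E z y"
  shows "x = y"
proof -
  have "x - y \<in> vecs E" using assms vecs_diff by blast
  then have "inprod E (x - y) (x - y) = 0" using assms by (simp add: inprod_diff)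
  then show ?thesis using inprod_definite \<open>x - y \<in> vecs E\<close> by fastforce
qed

text \<open>
  Apart from the square of \<open>z - x \<langle>x, z\<rangle>\<close> the remainder is \<open>\<langle>z, x\<rangle> (1 - \<langle>x, x\<rangle>) \<langle>x, z\<rangle>\<close>, and
  \<open>1 - \<langle>x, x\<rangle>\<close> has a square root.
\<close>

lemma inprod_split:
  assumes x: "x \<in> vecs E" and z: "z \<in> vecs E" and "norm (inprod E x x) < 1"
  obtains b c where "inprod E z z = star (inprod E x z) * inprod E x z + (star b * b + star c * c)"
proof -
  define a where "a = inprod E x z"
  define h where "h = inprod E x x"
  have sh: "star h = h" by (simp add: h_def inprod_star x)
  have zx: "inprod E z x = star a" by (simp add: a_def inprod_star x z)
  obtain r where r: "r + r = h + r * r" "star r = r"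
    using square_root_below_one [OF _ sh] assms(3) unfolding h_def by metis
  define w where "w = z - rmult E x a"
  have w: "w \<in> vecs E" by (simp add: w_def vecs_diff rmult_closed x z)
  then obtain b where b: "inprod E w w = star b * b"
    using inprod_positive unfolding positive_elements_def by blast
  have "inprod E w w = inprod E z z - star a * a - star a * a + star a * h * a"
    using x z by (simp add: w_def inprod_diff inprod_diff_left inprod_rmult inprod_rmult_left
        vecs_diff rmult_closed zx algebra_simps flip: a_def h_def)
  moreover have "star (a - r * a) * (a - r * a) = star a * a - star a * (r + r - r * r) * a"
    by (simp add: star_diff star_mult r(2) algebra_simps)
  ultimately have "inprod E z z = star a * a + (star b * b + star (a - r * a) * (a - r * a))"
    using r(1) b by simp
  then show thesis using that a_def by blast
qed

lemma norm_inprod_unit_ball: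
  assumes "x \<in> vecs E" "z \<in> vecs E" "norm (inprod E x x) < 1"
  shows "(norm (inprod E x z))\<^sup>2 \<le> norm (inprod E z z)"
proof -
  obtain b c where *: "inprod E z z = star (inprod E x z) * inprod E x z + (star b * b + star c * c)"
    using inprod_split assms by blast
  show ?thesis by (rule norm_square_le_norm_sum [where bs = "[b, c]"]) (simp add: *)
qed

lemma mnorm_nonneg [simp]: "0 \<le> mnorm E x"
  by (simp add: mnorm_def)

lemma mnorm_square: "(mnorm E x)\<^sup>2 = norm (inprod E x x)"
  by (simp add: mnorm_def)

lemma mnorm_scaleC: "x \<in> vecs E \<Longrightarrow> mnorm E (c *\<^sub>C x) = cmod c * mnorm E x"
proof -
  assume x: "x \<in> vecs E"
  then have "norm (inprod E (c *\<^sub>C x) (c *\<^sub>C x)) = (cmod c)\<^sup>2 * norm (inprod E x x)"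
    by (simp add: inprod_scaleC inprod_scaleC_left vecs_scaleC norm_scaleC norm_mult power2_eq_square)
  then show ?thesis by (simp add: mnorm_def real_sqrt_mult)
qed

lemma mnorm_rescaled:
  assumes "x \<in> vecs E" "mnorm E x < t"
  shows "norm (inprod E (complex_of_real (1/t) *\<^sub>C x) (complex_of_real (1/t) *\<^sub>C x)) < 1"
proof -
  have t: "0 < t" using assms mnorm_nonneg [of x] by linarith
  then have "mnorm E (complex_of_real (1/t) *\<^sub>C x) < 1"
    using assms by (simp add: mnorm_scaleC norm_divide)
  then have "(mnorm E (complex_of_real (1/t) *\<^sub>C x))\<^sup>2 < 1"
    by (simp add: power_less_one_iff)
  then show ?thesis by (simp add: mnorm_square)
qed

text \<open>
  By monotonicity of the norm, \<open>inprod_split\<close> gives \<open>\<parallel>\<langle>x, z\<rangle>\<parallel> \<le> \<parallel>z\<parallel>\<close> for \<open>\<parallel>x\<parallel> < 1\<close>; the rest is scaling.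
\<close>

lemma cauchy_schwarz:
  assumes x: "x \<in> vecs E" and z: "z \<in> vecs E"
  shows "norm (inprod E x z) \<le> mnorm E x * mnorm E z"
proof -
  have *: "norm (inprod E x z) \<le> t * mnorm E z" if t: "mnorm E x < t" for t
  proof -
    have t0: "0 < t" using t mnorm_nonneg [of x] by linarith
    define y where "y = complex_of_real (1/t) *\<^sub>C x"
    have "(norm (inprod E y z))\<^sup>2 \<le> norm (inprod E z z)"
      unfolding y_def by (intro norm_inprod_unit_ball mnorm_rescaled vecs_scaleC x z t)
    then have "norm (inprod E y z) \<le> mnorm E z"
      by (simp add: mnorm_def real_le_rsqrt)
    moreover have "norm (inprod E y z) = norm (inprod E x z) / t"
      using t0 by (simp only: y_def inprod_scaleC_left x z) (simp add: norm_scaleC norm_divide)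
    ultimately show ?thesis using t0 by (simp add: field_simps)
  qed
  show ?thesis
  proof (rule field_le_epsilon)
    fix e :: real assume e: "e > 0"
    have "norm (inprod E x z) \<le> (mnorm E x + e / (mnorm E z + 1)) * mnorm E z"
      using e mnorm_nonneg [of z] by (intro *) (simp add: add_nonneg_pos)
    also have "\<dots> = mnorm E x * mnorm E z + e * (mnorm E z / (mnorm E z + 1))"
      by (simp add: algebra_simps)
    also have "\<dots> \<le> mnorm E x * mnorm E z + e * 1"
      using e mnorm_nonneg [of z]
      by (intro add_left_mono mult_left_mono) (auto simp: divide_le_eq_1 add_nonneg_pos)
    finally show "norm (inprod E x z) \<le> mnorm E x * mnorm E z + e" by simp
  qed
qed

lemma mnorm_triangle:
  assumes x: "x \<in> vecs E" and y: "y \<in> vecs E"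
  shows "mnorm E (x + y) \<le> mnorm E x + mnorm E y"
proof (rule power2_le_imp_le)
  have "(mnorm E (x + y))\<^sup>2 = norm (inprod E x x + inprod E x y + (inprod E y x + inprod E y y))"
    unfolding mnorm_square using x y by (simp add: inprod_add inprod_add_left vecs_add algebra_simps)
  also have "\<dots> \<le> norm (inprod E x x) + norm (inprod E x y) + (norm (inprod E y x) + norm (inprod E y y))"
    by (intro order_trans [OF norm_triangle_ineq] add_mono norm_triangle_ineq)
  also have "\<dots> \<le> (mnorm E x)\<^sup>2 + mnorm E x * mnorm E y + (mnorm E y * mnorm E x + (mnorm E y)\<^sup>2)"
    unfolding mnorm_square by (intro add_mono cauchy_schwarz x y order_refl)
  also have "\<dots> = (mnorm E x + mnorm E y)\<^sup>2" by (simp add: power2_eq_square algebra_simps)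
  finally show "(mnorm E (x + y))\<^sup>2 \<le> (mnorm E x + mnorm E y)\<^sup>2" .
qed simp

lemma tendsto_inprod:
  assumes y: "y \<in> vecs E" and x: "x \<in> vecs E" and u: "\<And>n. u n \<in> vecs E" and lim: "(\<lambda>n. mnorm E (u n - x)) \<longlonglongrightarrow> 0"
  shows "(\<lambda>n. inprod E y (u n)) \<longlonglongrightarrow> inprod E y x" "(\<lambda>n. inprod E (u n) y) \<longlonglongrightarrow> inprod E x y"
    "(\<lambda>n. inprod E (u n) (u n)) \<longlonglongrightarrow> inprod E x x"
proof -
  have z: "(\<lambda>n. inprod E y (u n - x)) \<longlonglongrightarrow> 0" if y: "y \<in> vecs E" for y
  proof (rule Lim_null_comparison)
    show "\<forall>\<^sub>F n in sequentially. norm (inprod E y (u n - x)) \<le> mnorm E y * mnorm E (u n - x)"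
      using y x u by (intro always_eventually allI cauchy_schwarz vecs_diff)
    show "(\<lambda>n. mnorm E y * mnorm E (u n - x)) \<longlonglongrightarrow> 0" using tendsto_mult_right_zero [OF lim] .
  qed
  then show 1: "(\<lambda>n. inprod E y (u n)) \<longlonglongrightarrow> inprod E y x"
    using LIM_zero_cancel [of "\<lambda>n. inprod E y (u n)"] y x u by (simp add: inprod_diff)
  show 2: "(\<lambda>n. inprod E (u n) y) \<longlonglongrightarrow> inprod E x y"
    using tendsto_star [OF 1] y x u by (simp add: inprod_star)
  have xx: "(\<lambda>n. inprod E x (u n - x)) \<longlonglongrightarrow> 0" using z x by blast
  have "(\<lambda>n. inprod E (u n - x) (u n - x)) \<longlonglongrightarrow> 0"
  proof (rule Lim_null_comparison)
    show "\<forall>\<^sub>F n in sequentially. norm (inprod E (u n - x) (u n - x)) \<le> mnorm E (u n - x) * mnorm E (u n - x)"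
      using x u by (intro always_eventually allI cauchy_schwarz vecs_diff)
    show "(\<lambda>n. mnorm E (u n - x) * mnorm E (u n - x)) \<longlonglongrightarrow> 0" using tendsto_mult [OF lim lim] by simp
  qed
  moreover have "(\<lambda>n. star (inprod E x (u n - x))) \<longlonglongrightarrow> 0" using tendsto_star [OF xx] by simp
  ultimately have "(\<lambda>n. inprod E (u n - x) (u n - x) + inprod E x (u n - x) + star (inprod E x (u n - x)) + inprod E x x)
      \<longlonglongrightarrow> 0 + 0 + 0 + inprod E x x"
    by (intro tendsto_add tendsto_const xx)
  moreover have "inprod E (u n - x) (u n - x) + inprod E x (u n - x) + star (inprod E x (u n - x)) + inprod E x x
      = inprod E (u n) (u n)" for n
    using x u [of n] by (simp add: inprod_diff inprod_diff_left vecs_diff star_diff inprod_star)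
  ultimately show "(\<lambda>n. inprod E (u n) (u n)) \<longlonglongrightarrow> inprod E x x" by simp
qed

end

section \<open>Approximate units of finite rank\<close>

text \<open>
  For an adjoint pair \<open>A, A'\<close> the third clause says \<open>1 - A A' = \<Sum>\<^bsub>v\<^esub> \<theta>\<^bsub>v,v\<^esub>\<close>. Products with further
  factors \<open>1 - \<theta>\<^bsub>y,y\<^esub>\<close> keep this form.
\<close>

definition resolves :: "('x::complex_vector, 'a::cstar_algebra, 'm) hilbert_module_scheme \<Rightarrow> ('x \<Rightarrow> 'x) \<Rightarrow> 'x list \<Rightarrow> bool"
  where "resolves E A' V \<longleftrightarrow> (\<exists>A. is_adjoint E A A') \<and> set V \<subseteq> vecs E \<and>
    (\<forall>x\<in>vecs E. \<forall>x'\<in>vecs E.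
      inprod E x x' = (\<Sum>v\<leftarrow>V. inprod E x v * inprod E v x') + inprod E (A' x) (A' x'))"

definition shrink :: "('x::complex_vector, 'a::cstar_algebra, 'm) hilbert_module_scheme \<Rightarrow> 'x \<Rightarrow> 'x \<Rightarrow> 'x"
  where "shrink E y w = (if w \<in> vecs E then w - rmult E y (inprod E y w) else 0)"

context hilbert_module
begin

lemma is_adjoint_sym: "is_adjoint E T T' \<Longrightarrow> is_adjoint E T' T"
  unfolding is_adjoint_def by (metis inprod_star)

lemma shrink_closed: "y \<in> vecs E \<Longrightarrow> w \<in> vecs E \<Longrightarrow> shrink E y w \<in> vecs E"
  by (simp add: shrink_def vecs_diff rmult_closed)

lemma shrink_adjoint: "y \<in> vecs E \<Longrightarrow> is_adjoint E (shrink E y) (shrink E y)"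
  by (simp add: is_adjoint_def shrink_closed)
    (simp add: shrink_def inprod_diff inprod_diff_left inprod_rmult inprod_rmult_left rmult_closed
      inprod_star)

lemma is_adjoint_zero: "is_adjoint E T T' \<Longrightarrow> T 0 = 0"
proof -
  assume T: "is_adjoint E T T'"
  then have T0: "T 0 \<in> vecs E" "T' (T 0) \<in> vecs E" using vecs_zero by (simp_all add: is_adjoint_def)
  then have "inprod E (T 0) (T 0) = inprod E 0 (T' (T 0))" using T vecs_zero by (simp add: is_adjoint_def)
  then show ?thesis using T0 by (simp add: inprod_definite)
qed

lemma is_adjoint_comp:
  assumes S: "is_adjoint E S S'" and T: "is_adjoint E T T'"
  shows "is_adjoint E (S \<circ> T) (T' \<circ> S')"
proof -
  have "S 0 = 0" "T' 0 = 0" using is_adjoint_zero S is_adjoint_sym [OF T] by blast+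
  then show ?thesis using S T by (simp add: is_adjoint_def)
qed

text \<open>
  The identity \<open>1 - (1 - \<theta>\<^bsub>y,y\<^esub>)\<^sup>2 = \<theta>\<^bsub>y,y\<^esub> + \<theta>\<^bsub>y',y'\<^esub>\<close> with \<open>y' = y (1 - \<langle>y, y\<rangle>)\<^bsup>1/2\<^esup> = y - y r\<close>.
\<close>

lemma inprod_shrink:
  assumes y: "y \<in> vecs E" and w: "w \<in> vecs E" "w' \<in> vecs E"
    and r: "r + r = inprod E y y + r * r" "star r = r"
  shows "inprod E w w' = inprod E w y * inprod E y w' + inprod E w (y - rmult E y r) * inprod E (y - rmult E y r) w'
    + inprod E (shrink E y w) (shrink E y w')"
proof -
  have "inprod E w (y - rmult E y r) * inprod E (y - rmult E y r) w'
      = inprod E w y * inprod E y w' - inprod E w y * (r + r - r * r) * inprod E y w'"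
    using y w r(2)
    by (simp add: inprod_diff inprod_diff_left inprod_rmult inprod_rmult_left rmult_closed algebra_simps)
  moreover have "inprod E (shrink E y w) (shrink E y w')
      = inprod E w w' - inprod E w y * inprod E y w' - inprod E w y * inprod E y w'
        + inprod E w y * inprod E y y * inprod E y w'"
    using y w
    by (simp add: shrink_def inprod_diff inprod_diff_left inprod_rmult inprod_rmult_left rmult_closed
        vecs_diff inprod_star algebra_simps)
  ultimately show ?thesis using r(1) by simp
qed

lemma resolves_shrink:
  assumes A': "resolves E A' V" and y: "y \<in> vecs E" and "norm (inprod E y y) < 1"
  shows "\<exists>V'. resolves E (shrink E y \<circ> A') V'"
proof -
  obtain A where A: "is_adjoint E A A'" and V: "set V \<subseteq> vecs E"
    and eq: "\<And>x x'. x \<in> vecs E \<Longrightarrow> x' \<in> vecs E \<Longrightarrow>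
      inprod E x x' = (\<Sum>v\<leftarrow>V. inprod E x v * inprod E v x') + inprod E (A' x) (A' x')"
    using A' by (auto simp: resolves_def)
  have "star (inprod E y y) = inprod E y y" by (simp add: inprod_star y)
  then obtain r where r: "r + r = inprod E y y + r * r" "star r = r"
    using square_root_below_one assms(3) by metis
  define y' where "y' = y - rmult E y r"
  have y': "y' \<in> vecs E" by (simp add: y'_def vecs_diff rmult_closed y)
  have Acl: "A x \<in> vecs E" "A' x \<in> vecs E" if "x \<in> vecs E" for x using A that by (auto simp: is_adjoint_def)
  have adj: "inprod E (A z) x = inprod E z (A' x)" "inprod E x (A z) = inprod E (A' x) z"
    if "x \<in> vecs E" "z \<in> vecs E" for x z
    using A is_adjoint_sym [OF A] that by (auto simp: is_adjoint_def)
  have "inprod E x x' = (\<Sum>v\<leftarrow>V @ [A y, A y']. inprod E x v * inprod E v x')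
      + inprod E ((shrink E y \<circ> A') x) ((shrink E y \<circ> A') x')" if "x \<in> vecs E" "x' \<in> vecs E" for x x'
  proof -
    have "(\<Sum>v\<leftarrow>V @ [A y, A y']. inprod E x v * inprod E v x')
      = (\<Sum>v\<leftarrow>V. inprod E x v * inprod E v x')
        + (inprod E (A' x) y * inprod E y (A' x') + inprod E (A' x) y' * inprod E y' (A' x'))"
      using adj(1) [OF that(2) y] adj(1) [OF that(2) y'] adj(2) [OF that(1) y] adj(2) [OF that(1) y'] by simp
    moreover note eq [OF that] inprod_shrink [OF y Acl(2) [OF that(1)] Acl(2) [OF that(2)] r]
    ultimately show ?thesis unfolding y'_def comp_def by (simp only: add.assoc)
  qed
  moreover have "is_adjoint E (A \<circ> shrink E y) (shrink E y \<circ> A')"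
    by (rule is_adjoint_comp [OF A shrink_adjoint [OF y]])
  moreover have "set (V @ [A y, A y']) \<subseteq> vecs E" using V Acl(1) y y' by simp
  ultimately have "resolves E (shrink E y \<circ> A') (V @ [A y, A y'])"
    unfolding resolves_def by blast
  then show ?thesis by blast
qed

lemma resolves_shrink_power:
  assumes "resolves E A' V" "y \<in> vecs E" "norm (inprod E y y) < 1"
  shows "\<exists>V'. resolves E ((shrink E y ^^ n) \<circ> A') V'"
proof (induction n)
  case 0 then show ?case using assms by auto
next
  case (Suc n)
  then obtain V' where "resolves E ((shrink E y ^^ n) \<circ> A') V'" by blast
  from resolves_shrink [OF this assms(2,3)] show ?case by (simp only: funpow.simps comp_assoc)
qed

lemma resolves_contraction:
  assumes A': "resolves E A' V" and x: "x \<in> vecs E"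
  shows "norm (inprod E (A' x) (A' x)) \<le> norm (inprod E x x)"
proof -
  have "A' x \<in> vecs E" using A' x by (auto simp: resolves_def is_adjoint_def)
  then obtain b where b: "inprod E (A' x) (A' x) = star b * b"
    using inprod_positive unfolding positive_elements_def by blast
  have V: "set V \<subseteq> vecs E" using A' by (simp add: resolves_def)
  have "inprod E x v * inprod E v x = star (inprod E v x) * inprod E v x" if "v \<in> set V" for v
    using V that x by (simp add: inprod_star subset_iff)
  then have "(\<Sum>v\<leftarrow>V. inprod E x v * inprod E v x) = sum_list (map (\<lambda>b. star b * b) (map (\<lambda>v. inprod E v x) V))"
    by (simp add: comp_def cong: map_cong)
  then have "inprod E x x = star b * b + sum_list (map (\<lambda>b. star b * b) (map (\<lambda>v. inprod E v x) V))"
    using A' x b by (simp add: resolves_def add.commute)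
  then have "(norm b)\<^sup>2 \<le> norm (inprod E x x)" by (rule norm_square_le_norm_sum)
  then show ?thesis by (simp add: b cstar_identity)
qed

lemma resolves_id: "resolves E (id_op E) []"
proof -
  have "is_adjoint E (id_op E) (id_op E)" by (simp add: is_adjoint_def id_op_def)
  then show ?thesis by (auto simp: resolves_def id_op_def)
qed

lemma shrink_power_closed: "y \<in> vecs E \<Longrightarrow> w \<in> vecs E \<Longrightarrow> (shrink E y ^^ n) w \<in> vecs E"
  by (induction n) (auto intro: shrink_closed)

lemma shrink_power_contraction:
  assumes "y \<in> vecs E" "norm (inprod E y y) < 1" and x: "x \<in> vecs E"
  shows "norm (inprod E ((shrink E y ^^ n) x) ((shrink E y ^^ n) x)) \<le> norm (inprod E x x)"
proof -
  obtain V' where "resolves E ((shrink E y ^^ n) \<circ> id_op E) V'"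
    using resolves_shrink_power [OF resolves_id assms(1,2)] by blast
  from resolves_contraction [OF this x] show ?thesis using x by (simp add: id_op_def)
qed

lemma shrink_scaleC: "y \<in> vecs E \<Longrightarrow> w \<in> vecs E \<Longrightarrow> shrink E y (c *\<^sub>C w) = c *\<^sub>C shrink E y w"
  by (simp add: shrink_def vecs_scaleC inprod_scaleC rmult_scaleC_right
      complex_vector.scale_right_diff_distrib)

lemma shrink_power_scaleC:
  "y \<in> vecs E \<Longrightarrow> w \<in> vecs E \<Longrightarrow> (shrink E y ^^ n) (c *\<^sub>C w) = c *\<^sub>C (shrink E y ^^ n) w"
  by (induction n) (simp_all add: shrink_scaleC shrink_power_closed)

text \<open>
  With \<open>a = \<langle>y, y\<rangle>\<close> the vector \<open>(1 - \<theta>\<^bsub>y,y\<^esub>)\<^sup>n y\<close> is formally \<open>y (1 - a)\<^sup>n\<close>, and its square is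
  \<open>(1 - a)\<^bsup>2n\<^esup> a\<close>.
\<close>

lemma shrink_power_self:
  assumes y: "y \<in> vecs E" and n1: "norm (inprod E y y) < 1"
  shows "norm (inprod E ((shrink E y ^^ n) y) ((shrink E y ^^ n) y)) \<le> 1 / (2 * real n + 1)"
proof -
  define a where "a = inprod E y y"
  define e where "e = 1 - embed a"
  obtain b where b: "a = star b * b"
    using inprod_positive [OF y] unfolding a_def positive_elements_def by blast
  have sa: "star (embed a) = embed a" by (simp add: b embed_mult embed_star star_mult star_star)
  have na: "norm (embed a) \<le> 1" using n1 by (simp add: a_def norm_embed)
  have pe: "pos e" using pos_of_real_diff [OF sa na] by (simp add: e_def)
  have "pos (1 - e)" using pos_star_mult_self [of "embed b"] by (simp add: e_def b embed_mult embed_star)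
  then have ne: "norm e \<le> 1" using norm_le_if_pos_between(2) [OF pe, of 1] by simp
  define w where "w k = (shrink E y ^^ k) y" for k
  have w: "w k \<in> vecs E" for k by (simp add: w_def shrink_power_closed y)
  have wS: "w (Suc k) = w k - rmult E y (inprod E y (w k))" for k
    using w [of k] by (simp add: w_def shrink_def)
  have ce: "embed a * e = e * embed a" by (simp add: e_def algebra_simps)
  then have cek: "embed a * e ^ k = e ^ k * embed a" for k by (simp add: power_commuting_commutes)
  have embed_diff: "embed (c - d) = embed c - embed d" for c d :: 'a
    using embed_add [of "c - d" d] by (simp add: algebra_simps)
  have g: "embed (inprod E y (w k)) = e ^ k * embed a" for k
  proof (induction k)
    case 0 then show ?case by (simp add: w_def a_def)
  next
    case (Suc k)
    have "inprod E y (w (Suc k)) = inprod E y (w k) - a * inprod E y (w k)"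
      by (simp add: wS inprod_diff inprod_rmult rmult_closed w y a_def)
    then have "embed (inprod E y (w (Suc k))) = e * (e ^ k * embed a)"
      by (simp add: embed_diff embed_mult Suc) (simp add: e_def algebra_simps)
    then show ?case by (simp add: mult.assoc)
  qed
  have "embed (inprod E (w k) (w k)) = e ^ (2 * k) * embed a" for k
  proof (induction k)
    case 0 then show ?case by (simp add: w_def a_def)
  next
    case (Suc k)
    define G where "G = inprod E y (w k)"
    have sG: "star (embed G) = embed G"
      using pe by (simp add: G_def g star_mult star_power sa pos_def cek)
    have "inprod E (w (Suc k)) (w (Suc k)) = inprod E (w k) (w k) - star G * G - star G * G + star G * a * G"
      using w [of k] y inprod_star [OF y w, of k]
      by (simp add: wS inprod_diff inprod_diff_left inprod_rmult inprod_rmult_left rmult_closed vecs_diff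
          a_def G_def algebra_simps)
    then have "embed (inprod E (w (Suc k)) (w (Suc k)))
        = e ^ (2 * k) * embed a - embed G * embed G - embed G * embed G + embed G * embed a * embed G"
      by (simp add: embed_diff embed_add embed_mult embed_star sG Suc)
    also have "embed G = e ^ k * embed a" by (simp add: G_def g)
    also have "e ^ (2 * k) * embed a - e ^ k * embed a * (e ^ k * embed a) - e ^ k * embed a * (e ^ k * embed a)
        + e ^ k * embed a * embed a * (e ^ k * embed a)
      = e ^ (2 * k) * (embed a - embed a * embed a - embed a * embed a + embed a * embed a * embed a)"
    proof -
      have sq: "e ^ k * embed a * (e ^ k * embed a) = e ^ (2 * k) * (embed a * embed a)"
        by (simp add: mult_2 power_add) (metis cek mult.assoc)
      have "e ^ k * embed a * embed a * (e ^ k * embed a) = e ^ k * embed a * (embed a * e ^ k) * embed a"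
        by (simp only: mult.assoc)
      also have "\<dots> = e ^ k * embed a * (e ^ k * embed a) * embed a" by (simp only: cek)
      finally have cu: "e ^ k * embed a * embed a * (e ^ k * embed a) = e ^ (2 * k) * (embed a * embed a * embed a)"
        unfolding sq by (simp only: mult.assoc)
      show ?thesis unfolding sq cu by (simp only: right_diff_distrib distrib_left)
    qed
    also have "embed a - embed a * embed a - embed a * embed a + embed a * embed a * embed a = e * e * embed a"
      by (simp add: e_def algebra_simps)
    finally show ?case
      by (metis mult.assoc mult_Suc_right add.commute power_add power2_eq_square)
  qed
  from this [of n] have "norm (inprod E (w n) (w n)) = norm (e ^ (2 * n) * (1 - e))"
    by (subst norm_embed [symmetric]) (simp add: e_def)
  also have "\<dots> \<le> 1 / (real (2 * n) + 1)" by (rule norm_power_mult_one_minus [OF pe ne])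
  finally show ?thesis by (simp add: w_def)
qed

text \<open>
  The vectors are treated one after another. For a new vector \<open>x\<close> a high power of \<open>1 - \<theta>\<^bsub>y,y\<^esub>\<close> with \<open>y\<close> proportional to
  \<open>A' x\<close> is multiplied to \<open>A'\<close>; being a contraction, it does not spoil what was achieved before.
\<close>

lemma resolves_small_on_finite:
  assumes "finite F" "F \<subseteq> vecs E" "\<epsilon> > 0"
  shows "\<exists>A' V. resolves E A' V \<and> (\<forall>x\<in>F. norm (inprod E (A' x) (A' x)) < \<epsilon>)"
  using assms(1,2)
proof (induction F rule: finite_induct)
  case empty then show ?case using resolves_id by blast
next
  case (insert x F)
  then obtain A' V where A': "resolves E A' V" and F: "\<forall>x\<in>F. norm (inprod E (A' x) (A' x)) < \<epsilon>" by auto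
  have cl: "A' z \<in> vecs E" if "z \<in> vecs E" for z using A' that by (auto simp: resolves_def is_adjoint_def)
  define w where "w = A' x"
  have w: "w \<in> vecs E" using insert cl by (simp add: w_def)
  define t where "t = mnorm E w + 1"
  have t: "t > 0" "mnorm E w < t" by (simp_all add: t_def add_nonneg_pos)
  define y where "y = complex_of_real (1/t) *\<^sub>C w"
  have y: "y \<in> vecs E" by (simp add: y_def vecs_scaleC w)
  have ny: "norm (inprod E y y) < 1" unfolding y_def by (rule mnorm_rescaled [OF w t(2)])
  have wy: "w = complex_of_real t *\<^sub>C y" using t by (simp add: y_def scaleC_scaleC scaleC_one)
  obtain n :: nat where n: "t\<^sup>2 / \<epsilon> < real n" using reals_Archimedean2 by blast
  let ?B = "(shrink E y ^^ n) \<circ> A'"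
  obtain V' where V': "resolves E ?B V'" using resolves_shrink_power [OF A' y ny] by blast
  moreover have "norm (inprod E (?B z) (?B z)) < \<epsilon>" if "z \<in> F" for z
  proof -
    have "z \<in> vecs E" using that insert by auto
    then have "norm (inprod E (?B z) (?B z)) \<le> norm (inprod E (A' z) (A' z))"
      using shrink_power_contraction [OF y ny cl] by simp
    then show ?thesis using F that by fastforce
  qed
  moreover have "norm (inprod E (?B x) (?B x)) < \<epsilon>"
  proof -
    have "?B x = complex_of_real t *\<^sub>C (shrink E y ^^ n) y"
      using arg_cong [OF wy, of "shrink E y ^^ n"] shrink_power_scaleC [OF y y] by (simp add: w_def)
    then have "mnorm E (?B x) = t * mnorm E ((shrink E y ^^ n) y)"
      using t by (simp add: mnorm_scaleC shrink_power_closed y)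
    then have "norm (inprod E (?B x) (?B x)) = t\<^sup>2 * norm (inprod E ((shrink E y ^^ n) y) ((shrink E y ^^ n) y))"
      by (simp only: power_mult_distrib flip: mnorm_square)
    also have "\<dots> \<le> t\<^sup>2 * (1 / (2 * real n + 1))"
      using shrink_power_self [OF y ny] by (intro mult_left_mono) auto
    also have "\<dots> < \<epsilon>"
    proof -
      have "t\<^sup>2 < real n * \<epsilon>" using n assms(3) by (simp add: field_simps)
      also have "\<dots> \<le> (2 * real n + 1) * \<epsilon>" using assms(3) by (intro mult_right_mono) auto
      finally show ?thesis by (simp add: field_simps)
    qed
    finally show ?thesis .
  qed
  ultimately show ?case by (metis insert_iff)
qed

text \<open>
  The sets \<open>H\<close> in the definition of the induced trace carry no multiplicities. Repetitions in a list are
  removed by unit scalars, which do not change \<open>\<theta>\<^bsub>v,v\<^esub>\<close>.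
\<close>

lemma distinct_up_to_phases:
  assumes "set V \<subseteq> vecs E"
  shows "\<exists>V'. distinct V' \<and> set V' \<subseteq> vecs E \<and> (\<forall>x\<in>vecs E. \<forall>x'\<in>vecs E.
    (\<Sum>v\<leftarrow>V'. inprod E x v * inprod E v x') = (\<Sum>v\<leftarrow>V. inprod E x v * inprod E v x'))"
  using assms
proof (induction V)
  case Nil
  show ?case by (intro exI [of _ "[]"]) simp
next
  case (Cons v V)
  then obtain V' where V': "distinct V'" "set V' \<subseteq> vecs E" "\<forall>x\<in>vecs E. \<forall>x'\<in>vecs E.
    (\<Sum>v\<leftarrow>V'. inprod E x v * inprod E v x') = (\<Sum>v\<leftarrow>V. inprod E x v * inprod E v x')" by auto
  have v: "v \<in> vecs E" using Cons.prems by simp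
  show ?case
  proof (cases "v = 0")
    case True then show ?thesis using V' by auto
  next
    case False
    \<comment> \<open>There are more such roots of unity than vectors in \<open>V'\<close>, so one of the multiples of \<open>v\<close> is new.\<close>
    let ?U = "{z::complex. z ^ Suc (length V') = 1}"
    have U: "card ?U = Suc (length V')" by (rule card_roots_unity_eq) simp
    have "inj_on (\<lambda>c. c *\<^sub>C v) ?U"
      using False by (auto simp: inj_on_def)
    then have "card ((\<lambda>c. c *\<^sub>C v) ` ?U) = Suc (length V')" using card_image U by metis
    then have "\<not> (\<lambda>c. c *\<^sub>C v) ` ?U \<subseteq> set V'"
      using card_mono [of "set V'" "(\<lambda>c. c *\<^sub>C v) ` ?U"] card_length [of V'] by auto
    then obtain c where c: "c ^ Suc (length V') = 1" "c *\<^sub>C v \<notin> set V'" by auto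
    have "cmod c ^ Suc (length V') = 1" using c(1) by (metis norm_power norm_one)
    then have "cmod c = 1" using power_eq_1_iff by fastforce
    then have cc: "c * cnj c = 1" by (simp flip: complex_norm_square)
    have "inprod E x (c *\<^sub>C v) * inprod E (c *\<^sub>C v) x' = inprod E x v * inprod E v x'"
      if "x \<in> vecs E" "x' \<in> vecs E" for x x'
      using that v cc by (simp add: inprod_scaleC inprod_scaleC_left mult_scaleC_left mult_scaleC_right
          scaleC_scaleC scaleC_one mult.commute)
    then show ?thesis
      using V' c(2) v by (intro exI [of _ "c *\<^sub>C v # V'"]) (auto simp: vecs_scaleC)
  qed
qed

end

definition admissible :: "('x::complex_vector, 'a::cstar_algebra, 'm) hilbert_module_scheme \<Rightarrow> 'x set \<Rightarrow> bool"
  where "admissible E H \<longleftrightarrow> finite H \<and> H \<subseteq> vecs E \<and> id_op E - (\<Sum>\<xi>\<in>H. rank_one E \<xi> \<xi>) \<in> positive_ops E"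

text \<open>For an adjointable \<open>R\<close> this says \<open>1 = \<Sum>\<^bsub>\<xi>\<in>H\<^esub> \<theta>\<^bsub>\<xi>,\<xi>\<^esub> + R\<^sup>* R\<close>.\<close>

definition remainder :: "('x::complex_vector, 'a::cstar_algebra, 'm) hilbert_module_scheme \<Rightarrow> 'x set \<Rightarrow> ('x \<Rightarrow> 'x) \<Rightarrow> bool"
  where "remainder E H R \<longleftrightarrow> (\<exists>R'. is_adjoint E R R') \<and> (\<forall>x\<in>vecs E. \<forall>x'\<in>vecs E.
    inprod E x x' = (\<Sum>\<xi>\<in>H. inprod E x \<xi> * inprod E \<xi> x') + inprod E (R x) (R x'))"

text \<open>For \<open>k = \<Sum>\<^bsub>\<xi>\<in>H\<^esub> \<theta>\<^bsub>\<xi>,\<xi>\<^esub> \<le> 1\<close> the last clause says \<open>\<parallel>\<langle>x, (1 - k) x\<rangle>\<parallel> < \<delta>\<close>.\<close>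

definition near_unit :: "('x::complex_vector, 'a::cstar_algebra, 'm) hilbert_module_scheme \<Rightarrow> 'x set \<Rightarrow> real \<Rightarrow> 'x set \<Rightarrow> bool"
  where "near_unit E F \<delta> H \<longleftrightarrow> admissible E H \<and>
    (\<exists>R. remainder E H R \<and> (\<forall>x\<in>F. norm (inprod E (R x) (R x)) < \<delta>))"

lemma near_unit_admissible: "near_unit E F \<delta> H \<Longrightarrow> admissible E H"
  by (simp add: near_unit_def)

lemma near_unit_mono: "near_unit E F \<delta> H \<Longrightarrow> F' \<subseteq> F \<Longrightarrow> \<delta> \<le> \<delta>' \<Longrightarrow> near_unit E F' \<delta>' H"
  unfolding near_unit_def by (meson less_le_trans subsetD)

lemma admissibleD: "admissible E H \<Longrightarrow> finite H \<and> H \<subseteq> vecs E"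
  by (simp add: admissible_def)

context hilbert_module
begin

lemma remainder_closed: "remainder E H R \<Longrightarrow> x \<in> vecs E \<Longrightarrow> R x \<in> vecs E"
  by (auto simp: remainder_def is_adjoint_def)

lemma remainder_eq: "remainder E H R \<Longrightarrow> x \<in> vecs E \<Longrightarrow> x' \<in> vecs E \<Longrightarrow>
    inprod E x x' = (\<Sum>\<xi>\<in>H. inprod E x \<xi> * inprod E \<xi> x') + inprod E (R x) (R x')"
  by (simp add: remainder_def)

lemma finite_rank_apply:
  assumes "finite H" "x \<in> vecs E"
  shows "(id_op E - (\<Sum>\<xi>\<in>H. rank_one E \<xi> \<xi>)) x = x - (\<Sum>\<xi>\<in>H. rmult E \<xi> (inprod E \<xi> x))"
proof -
  have "(\<Sum>\<xi>\<in>H. rank_one E \<xi> \<xi>) x = (\<Sum>\<xi>\<in>H. rmult E \<xi> (inprod E \<xi> x))"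
    using assms by (induction H rule: finite_induct) (simp_all add: rank_one_def)
  then show ?thesis using assms by (simp add: id_op_def)
qed

lemma inprod_finite_rank:
  assumes "finite H" "H \<subseteq> vecs E" "x \<in> vecs E" "x' \<in> vecs E"
  shows "(\<Sum>\<xi>\<in>H. rmult E \<xi> (inprod E \<xi> x')) \<in> vecs E"
    "inprod E x (\<Sum>\<xi>\<in>H. rmult E \<xi> (inprod E \<xi> x')) = (\<Sum>\<xi>\<in>H. inprod E x \<xi> * inprod E \<xi> x')"
proof -
  have "(\<Sum>\<xi>\<in>H. rmult E \<xi> (inprod E \<xi> x')) \<in> vecs E \<and>
    inprod E x (\<Sum>\<xi>\<in>H. rmult E \<xi> (inprod E \<xi> x')) = (\<Sum>\<xi>\<in>H. inprod E x \<xi> * inprod E \<xi> x')"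
    using assms(1,2)
    by (induction H rule: finite_induct)
      (simp_all add: assms vecs_zero vecs_add rmult_closed inprod_add inprod_rmult)
  then show "(\<Sum>\<xi>\<in>H. rmult E \<xi> (inprod E \<xi> x')) \<in> vecs E"
    "inprod E x (\<Sum>\<xi>\<in>H. rmult E \<xi> (inprod E \<xi> x')) = (\<Sum>\<xi>\<in>H. inprod E x \<xi> * inprod E \<xi> x')" by auto
qed

lemma admissible_imp_remainder:
  assumes "admissible E H" shows "\<exists>R. remainder E H R"
proof -
  have H: "finite H" "H \<subseteq> vecs E" using assms by (auto simp: admissible_def)
  obtain R R' where R: "is_adjoint E R R'" and eq: "id_op E - (\<Sum>\<xi>\<in>H. rank_one E \<xi> \<xi>) = R' \<circ> R"
    using assms by (auto simp: admissible_def positive_ops_def)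
  have "inprod E x x' = (\<Sum>\<xi>\<in>H. inprod E x \<xi> * inprod E \<xi> x') + inprod E (R x) (R x')"
    if x: "x \<in> vecs E" "x' \<in> vecs E" for x x'
  proof -
    have Rx: "R x \<in> vecs E" "R x' \<in> vecs E" using R x by (auto simp: is_adjoint_def)
    have "x' - (\<Sum>\<xi>\<in>H. rmult E \<xi> (inprod E \<xi> x')) = R' (R x')"
      using fun_cong [OF eq, of x'] finite_rank_apply [OF H(1) x(2)] by simp
    then have "inprod E x x' - (\<Sum>\<xi>\<in>H. inprod E x \<xi> * inprod E \<xi> x') = inprod E x (R' (R x'))"
      using inprod_diff [OF x inprod_finite_rank(1) [OF H x]] inprod_finite_rank(2) [OF H x] by simp
    also have "\<dots> = inprod E (R x) (R x')"
      using R x Rx by (simp add: is_adjoint_def)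
    finally show ?thesis by (simp add: algebra_simps)
  qed
  with R show ?thesis by (auto simp: remainder_def)
qed

text \<open>
  The operator \<open>A A'\<close> provided by \<open>resolves_small_on_finite\<close> is determined by its inner products, so the identity of
  sesquilinear forms is one of operators.
\<close>

lemma near_unit_exists:
  assumes F: "finite F" "F \<subseteq> vecs E" and "\<epsilon> > 0"
  shows "\<exists>H. near_unit E F \<epsilon> H"
proof -
  obtain A' V where A': "resolves E A' V" and small: "\<forall>x\<in>F. norm (inprod E (A' x) (A' x)) < \<epsilon>"
    using resolves_small_on_finite assms by blast
  obtain A where A: "is_adjoint E A A'" and V: "set V \<subseteq> vecs E" using A' by (auto simp: resolves_def)
  obtain V' where V': "distinct V'" "set V' \<subseteq> vecs E" "\<forall>x\<in>vecs E. \<forall>x'\<in>vecs E.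
    (\<Sum>v\<leftarrow>V'. inprod E x v * inprod E v x') = (\<Sum>v\<leftarrow>V. inprod E x v * inprod E v x')"
    using distinct_up_to_phases [OF V] by blast
  have form: "inprod E x x' = (\<Sum>\<xi>\<in>set V'. inprod E x \<xi> * inprod E \<xi> x') + inprod E (A' x) (A' x')"
    if "x \<in> vecs E" "x' \<in> vecs E" for x x'
    using A' that V' by (simp add: resolves_def sum_list_distinct_conv_sum_set)
  have cl: "A' x \<in> vecs E" "A x \<in> vecs E" if "x \<in> vecs E" for x using A that by (auto simp: is_adjoint_def)
  have "(id_op E - (\<Sum>\<xi>\<in>set V'. rank_one E \<xi> \<xi>)) x = (A \<circ> A') x" for x
  proof (cases "x \<in> vecs E")
    case True
    have "x - (\<Sum>\<xi>\<in>set V'. rmult E \<xi> (inprod E \<xi> x)) = A (A' x)"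
    proof (rule eq_if_inprod_eq)
      show "x - (\<Sum>\<xi>\<in>set V'. rmult E \<xi> (inprod E \<xi> x)) \<in> vecs E"
        using True V'(2) by (intro vecs_diff inprod_finite_rank) auto
      show "A (A' x) \<in> vecs E" using cl True by blast
      fix z assume z: "z \<in> vecs E"
      have "inprod E z (A (A' x)) = inprod E (A' z) (A' x)"
        using is_adjoint_sym [OF A] z True cl by (simp add: is_adjoint_def)
      moreover have "inprod E z (x - (\<Sum>\<xi>\<in>set V'. rmult E \<xi> (inprod E \<xi> x)))
          = inprod E z x - (\<Sum>\<xi>\<in>set V'. inprod E z \<xi> * inprod E \<xi> x)"
        using inprod_diff [OF z True inprod_finite_rank(1)] inprod_finite_rank(2) V'(2) z True by simp
      ultimately show "inprod E z (x - (\<Sum>\<xi>\<in>set V'. rmult E \<xi> (inprod E \<xi> x))) = inprod E z (A (A' x))"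
        using form [OF z True] by simp
    qed
    then show ?thesis using finite_rank_apply True by simp
  next
    case False
    have "(\<Sum>\<xi>\<in>set V'. rank_one E \<xi> \<xi>) x = 0"
      using False by (induction rule: finite_induct [OF finite_set [of V']]) (simp_all add: rank_one_def)
    moreover have "A' x = 0" using A False by (simp add: is_adjoint_def)
    ultimately show ?thesis using False is_adjoint_zero [OF A] by (simp add: id_op_def)
  qed
  then have "id_op E - (\<Sum>\<xi>\<in>set V'. rank_one E \<xi> \<xi>) = A \<circ> A'" by blast
  then have "admissible E (set V')"
    using V' is_adjoint_sym [OF A] by (auto simp: admissible_def positive_ops_def)
  moreover have "remainder E (set V') A'" using is_adjoint_sym [OF A] form by (auto simp: remainder_def)
  ultimately show ?thesis using small by (auto simp: near_unit_def)
qed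

end

section \<open>Induced traces\<close>

locale trace_state =
  fixes \<tau> :: "'a::cstar_algebra \<Rightarrow> complex"
  assumes tracial: "tracial_state \<tau>"
begin

definition tr :: "'a \<Rightarrow> real" where "tr a = Re (\<tau> a)"

lemma bounded_linear_tr: "bounded_linear tr"
  unfolding tr_def [abs_def]
  using tracial bounded_linear_compose [OF bounded_linear_Re] by (auto simp: tracial_state_def)

lemma tr_add: "tr (a + b) = tr a + tr b"
  by (rule linear_add [OF bounded_linear.linear [OF bounded_linear_tr]])

lemma tr_diff: "tr (a - b) = tr a - tr b"
  by (rule linear_diff [OF bounded_linear.linear [OF bounded_linear_tr]])

lemma tr_zero [simp]: "tr 0 = 0"
  by (rule linear_0 [OF bounded_linear.linear [OF bounded_linear_tr]])

lemma tr_scaleR: "tr (r *\<^sub>R a) = r * tr a"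
  using linear_scale [OF bounded_linear.linear [OF bounded_linear_tr]] by simp

lemma tr_sum: "tr (sum f H) = (\<Sum>x\<in>H. tr (f x))"
  by (rule linear_sum [OF bounded_linear.linear [OF bounded_linear_tr]])

lemma tr_commute: "tr (a * b) = tr (b * a)"
  unfolding tr_def using tracial by (metis tracial_state_def)

lemma tr_nonneg: "a \<in> positive_elements \<Longrightarrow> 0 \<le> tr a"
  using tracial by (auto simp: tr_def tracial_state_def complex_nonneg_Reals_iff)

lemma tr_le_norm: "tr a \<le> norm a"
proof -
  have "cmod (\<tau> a) \<le> onorm \<tau> * norm a" using tracial by (intro onorm) (simp add: tracial_state_def)
  then show ?thesis
    using tracial complex_Re_le_cmod [of "\<tau> a"] by (simp add: tr_def tracial_state_def)
qed

lemma tendsto_tr: "(f \<longlongrightarrow> a) F \<Longrightarrow> ((\<lambda>x. tr (f x)) \<longlongrightarrow> tr a) F"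
  by (rule bounded_linear.tendsto [OF bounded_linear_tr])

end

locale traced_correspondence = cstar_correspondence E + trace_state \<tau>
  for E :: "('x::complex_vector, 'a::cstar_algebra, 'm) correspondence_scheme" and \<tau> :: "'a \<Rightarrow> complex"
begin

lemma lmult_closed: "x \<in> vecs E \<Longrightarrow> lmult E a x \<in> vecs E"
  using lmult_adjoint [of a] by (simp add: is_adjoint_def)

lemma inprod_lmult: "x \<in> vecs E \<Longrightarrow> y \<in> vecs E \<Longrightarrow> inprod E (lmult E a x) y = inprod E x (lmult E (star a) y)"
  using lmult_adjoint [of a] by (simp add: is_adjoint_def)

lemma lmult_lmult: "lmult E a (lmult E b x) = lmult E (a * b) x"
  by (simp add: lmult_mult)

lemma inprod_lmult_square: "x \<in> vecs E \<Longrightarrow> inprod E x (lmult E (star b * b) x) = inprod E (lmult E b x) (lmult E b x)"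
  by (simp add: inprod_lmult lmult_closed lmult_lmult)

lemma tr_inprod_nonneg: "x \<in> vecs E \<Longrightarrow> 0 \<le> tr (inprod E x x)"
  by (rule tr_nonneg [OF inprod_positive])

text \<open>
  This is \<open>\<theta>\<^bsub>x,x\<^esub> \<le> \<parallel>x\<parallel>\<^sup>2\<close> under the trace. Dropping the last two squares in \<open>inprod_split\<close> is harmless
  as the trace is positive.
\<close>

lemma tr_inprod_mult_le:
  assumes x: "x \<in> vecs E" and z: "z \<in> vecs E" and "mnorm E x < t"
  shows "tr (inprod E z x * inprod E x z) \<le> t\<^sup>2 * tr (inprod E z z)"
proof -
  have t: "0 < t" using assms(3) mnorm_nonneg [of x] by linarith
  define y where "y = complex_of_real (1/t) *\<^sub>C x"
  have y: "y \<in> vecs E" by (simp add: y_def vecs_scaleC x)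
  obtain b c where *: "inprod E z z = star (inprod E y z) * inprod E y z + (star b * b + star c * c)"
    using inprod_split [OF y z] mnorm_rescaled [OF x assms(3)] unfolding y_def by metis
  have "tr (star (inprod E y z) * inprod E y z) \<le> tr (inprod E z z)"
    unfolding * tr_add by (simp add: tr_nonneg)
  moreover have "star (inprod E y z) * inprod E y z = (1/t\<^sup>2) *\<^sub>R (inprod E z x * inprod E x z)"
    using x z t by (simp add: y_def inprod_scaleC_left star_scaleC inprod_star mult_scaleC_left mult_scaleC_right
        scaleC_scaleC scaleR_eq_scaleC power2_eq_square)
  ultimately show ?thesis using t by (simp add: tr_scaleR field_simps)
qed

lemma admissible_tr_le:
  assumes "admissible E H" "z \<in> vecs E"
  shows "(\<Sum>h\<in>H. tr (inprod E z h * inprod E h z)) \<le> tr (inprod E z z)"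
proof -
  obtain R where R: "remainder E H R" using admissible_imp_remainder [OF assms(1)] by blast
  have "0 \<le> tr (inprod E (R z) (R z))"
    by (intro tr_inprod_nonneg remainder_closed [OF R] assms(2))
  moreover have "tr (inprod E z z) = (\<Sum>h\<in>H. tr (inprod E z h * inprod E h z)) + tr (inprod E (R z) (R z))"
    by (subst remainder_eq [OF R assms(2) assms(2)]) (simp add: tr_add tr_sum)
  ultimately show ?thesis by simp
qed

lemma induced_trace_eq:
  "induced_trace E \<tau> T = (SUP H\<in>{H. admissible E H}. ereal (\<Sum>h\<in>H. tr (inprod E h (T h))))"
  by (simp add: induced_trace_def admissible_def tr_def)

lemma admissible_le_induced_trace:
  "admissible E H \<Longrightarrow> ereal (\<Sum>h\<in>H. tr (inprod E h (T h))) \<le> induced_trace E \<tau> T"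
  unfolding induced_trace_eq by (rule SUP_upper) simp

text \<open>
  The left hand side is the trace of \<open>k = \<Sum>\<^bsub>v\<^esub> \<theta>\<^bsub>v,v\<^esub>\<close>, and the hypothesis is that \<open>k \<le> C \<phi>(c)\<close>, tested
  only against the trace. Expanding each \<open>v\<close> in an approximate unit \<open>\<Sum>\<^bsub>h\<^esub> \<theta>\<^bsub>h,h\<^esub>\<close> and
  exchanging the two sums by the trace property makes
  \<open>k\<close> act on the vectors \<open>h\<close>. Estimates from above thus reduce to inequalities under the
  trace, which is what makes the induced trace of a tensor product accessible.
\<close>

lemma weak_bound_le_induced_trace:
  assumes C: "0 \<le> C" and V: "set V \<subseteq> vecs E"
    and le: "\<And>z. z \<in> vecs E \<Longrightarrow>
      (\<Sum>v\<leftarrow>V. tr (inprod E z v * inprod E v z)) \<le> C * tr (inprod E z (lmult E c z))"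
  shows "ereal (\<Sum>v\<leftarrow>V. tr (inprod E v v)) \<le> ereal C * induced_trace E \<tau> (lmult E c)"
proof (rule ereal_le_epsilon2)
  fix e :: real assume e: "0 < e"
  define \<delta> where "\<delta> = e / (real (length V) + 1)"
  have d: "\<delta> > 0" "real (length V) * \<delta> \<le> e" using e by (auto simp: \<delta>_def field_simps)
  obtain H A' where H: "admissible E H" and A': "remainder E H A'"
    and small: "\<forall>v\<in>set V. norm (inprod E (A' v) (A' v)) < \<delta>"
    using near_unit_exists [OF finite_set V d(1)] by (auto simp: near_unit_def)
  have Hv: "finite H" "H \<subseteq> vecs E" using admissibleD [OF H] by auto
  have "(\<Sum>v\<leftarrow>V. tr (inprod E v v)) \<le> (\<Sum>v\<leftarrow>V. (\<Sum>h\<in>H. tr (inprod E h v * inprod E v h)) + \<delta>)"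
  proof (rule sum_list_mono)
    fix v assume v: "v \<in> set V"
    then have vv: "v \<in> vecs E" using V by blast
    have "tr (inprod E v v) = (\<Sum>h\<in>H. tr (inprod E v h * inprod E h v)) + tr (inprod E (A' v) (A' v))"
      by (subst remainder_eq [OF A' vv vv]) (simp add: tr_add tr_sum)
    also have "\<dots> \<le> (\<Sum>h\<in>H. tr (inprod E h v * inprod E v h)) + \<delta>"
      using small [rule_format, OF v] tr_le_norm [of "inprod E (A' v) (A' v)"]
      by (intro add_mono sum_mono) (simp_all add: tr_commute)
    finally show "tr (inprod E v v) \<le> (\<Sum>h\<in>H. tr (inprod E h v * inprod E v h)) + \<delta>" .
  qed
  also have "\<dots> = (\<Sum>h\<in>H. \<Sum>v\<leftarrow>V. tr (inprod E h v * inprod E v h)) + real (length V) * \<delta>"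
    by (induction V) (simp_all add: sum.distrib algebra_simps)
  also have "\<dots> \<le> (\<Sum>h\<in>H. C * tr (inprod E h (lmult E c h))) + e"
    using Hv le d by (intro add_mono sum_mono) auto
  also have "\<dots> = C * (\<Sum>h\<in>H. tr (inprod E h (lmult E c h))) + e" by (simp add: sum_distrib_left)
  finally have "ereal (\<Sum>v\<leftarrow>V. tr (inprod E v v)) \<le> ereal C * ereal (\<Sum>h\<in>H. tr (inprod E h (lmult E c h))) + ereal e"
    by simp
  also have "\<dots> \<le> ereal C * induced_trace E \<tau> (lmult E c) + ereal e"
    using C by (intro add_right_mono ereal_mult_left_mono admissible_le_induced_trace H) auto
  finally show "ereal (\<Sum>v\<leftarrow>V. tr (inprod E v v)) \<le> ereal C * induced_trace E \<tau> (lmult E c) + ereal e" .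
qed

lemma induced_trace_nonneg: "0 \<le> induced_trace E \<tau> (lmult E c)"
proof -
  have "is_adjoint E (id_op E) (id_op E)" by (simp add: is_adjoint_def id_op_def)
  moreover have "id_op E = id_op E \<circ> id_op E" by (auto simp: id_op_def)
  ultimately have "admissible E {}"
    unfolding admissible_def positive_ops_def by fastforce
  from admissible_le_induced_trace [OF this, of "lmult E c"] show ?thesis by (simp add: zero_ereal_def)
qed

text \<open>
  With \<open>1 - a\<^sup>* a = (1 - r)\<^sup>2\<close> the difference of the squares is \<open>\<langle>y - r y, y - r y\<rangle>\<close>.
\<close>

lemma lmult_contraction:
  assumes y: "y \<in> vecs E" and "norm a < 1"
  shows "mnorm E (lmult E a y) \<le> mnorm E y"
proof -
  have "norm (star a * a) < 1" using assms(2) by (simp add: cstar_identity power_less_one_iff)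
  then obtain r where r: "r + r = star a * a + r * r" "star r = r"
    using square_root_below_one [of "star a * a"] by (metis star_mult star_star)
  have ry: "lmult E r y \<in> vecs E" "lmult E a y \<in> vecs E" using y lmult_closed by auto
  then obtain b where b: "inprod E (lmult E a y) (lmult E a y) = star b * b"
    using inprod_positive unfolding positive_elements_def by blast
  have "y - lmult E r y \<in> vecs E" using y ry vecs_diff by blast
  then obtain c where c: "inprod E (y - lmult E r y) (y - lmult E r y) = star c * c"
    using inprod_positive unfolding positive_elements_def by blast
  have "inprod E (lmult E a y) (lmult E a y) = inprod E y (lmult E (star a * a) y)"
    by (simp add: inprod_lmult_square y)
  also have "\<dots> + inprod E y (lmult E (r * r) y) = inprod E y (lmult E (r + r) y)"
    using y by (simp add: r(1) lmult_add inprod_add lmult_closed)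
  also have "\<dots> = inprod E y (lmult E r y) + inprod E y (lmult E r y)"
    using y by (simp add: lmult_add inprod_add lmult_closed)
  finally have "inprod E y y = star b * b + (\<Sum>b\<leftarrow>[c]. star b * b)"
    using y ry inprod_lmult [OF y y, of r] inprod_lmult_square [OF y, of r]
    by (simp add: inprod_diff inprod_diff_left vecs_diff r(2) algebra_simps flip: b c)
  then have "(norm b)\<^sup>2 \<le> norm (inprod E y y)" by (rule norm_square_le_norm_sum)
  then show ?thesis by (simp add: mnorm_def b cstar_identity real_le_rsqrt)
qed

lemma lmult_bounded:
  assumes y: "y \<in> vecs E" and t: "norm a < t"
  shows "mnorm E (lmult E a y) \<le> t * mnorm E y"
proof -
  have t0: "t > 0" using t norm_ge_zero [of a] by linarith
  define a' where "a' = complex_of_real (1/t) *\<^sub>C a"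
  have "norm a' < 1" unfolding a'_def using t t0 by (simp add: norm_scaleC norm_divide)
  then have "mnorm E (lmult E a' y) \<le> mnorm E y" by (rule lmult_contraction [OF y])
  moreover have "mnorm E (lmult E a' y) = mnorm E (lmult E a y) / t"
    using t0 y by (simp only: a'_def lmult_scaleC scaleC_fun_def mnorm_scaleC lmult_closed) (simp add: norm_divide)
  ultimately show ?thesis using t0 by (simp add: field_simps)
qed

lemma lmult_sum_list_vec:
  assumes "\<And>y. y \<in> set ys \<Longrightarrow> f y \<in> vecs E"
  shows "lmult E a (sum_list (map f ys)) = (\<Sum>y\<leftarrow>ys. lmult E a (f y))"
proof (rule eq_if_inprod_eq)
  show "lmult E a (sum_list (map f ys)) \<in> vecs E" "(\<Sum>y\<leftarrow>ys. lmult E a (f y)) \<in> vecs E"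
    using assms by (auto intro!: lmult_closed vecs_sum_list)
  fix z assume z: "z \<in> vecs E"
  have flip: "inprod E z (lmult E a y) = inprod E (lmult E (star a) z) y" if "y \<in> vecs E" for y
    using z that by (simp add: inprod_lmult star_star)
  have "inprod E z (lmult E a (sum_list (map f ys))) = (\<Sum>y\<leftarrow>ys. inprod E (lmult E (star a) z) (f y))"
    using assms z by (simp add: flip vecs_sum_list inprod_sum_list lmult_closed)
  also have "\<dots> = (\<Sum>y\<leftarrow>ys. inprod E z (lmult E a (f y)))"
    using assms by (simp add: flip cong: map_cong)
  also have "\<dots> = inprod E z (\<Sum>y\<leftarrow>ys. lmult E a (f y))"
    using assms z by (subst inprod_sum_list) (auto intro: lmult_closed)
  finally show "inprod E z (lmult E a (sum_list (map f ys))) = inprod E z (\<Sum>y\<leftarrow>ys. lmult E a (f y))" .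
qed

lemma lmult_diff_vec:
  assumes "x \<in> vecs E" "y \<in> vecs E"
  shows "lmult E a (x - y) = lmult E a x - lmult E a y"
proof -
  have "lmult E a (sum_list (map id [x - y, y])) = (\<Sum>z\<leftarrow>[x - y, y]. lmult E a (id z))"
    using assms by (intro lmult_sum_list_vec) (auto intro: vecs_diff)
  then show ?thesis by (simp add: algebra_simps)
qed

lemma lmult_sum_coeff:
  "finite H \<Longrightarrow> lmult E (sum f H) = (\<Sum>h\<in>H. lmult E (f h))"
proof (induction H rule: finite_induct)
  case empty
  have "lmult E (0 + 0) = lmult E 0 + lmult E 0" by (rule lmult_add)
  then show ?case by simp
qed (simp add: lmult_add)

lemma mnorm_sum_list:
  "(\<And>y. y \<in> set ys \<Longrightarrow> f y \<in> vecs E) \<Longrightarrow> mnorm E (sum_list (map f ys)) \<le> (\<Sum>y\<leftarrow>ys. mnorm E (f y))"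
proof (induction ys)
  case Nil show ?case using vecs_zero by (simp add: mnorm_def)
next
  case (Cons y ys)
  then show ?case
    using mnorm_triangle [of "f y" "sum_list (map f ys)"] vecs_sum_list [of ys f] by simp
qed

end

section \<open>Products of vectors in a product system\<close>

text \<open>
  Elements of the interior tensor product are encoded by their inner products with formal sums, so inner products
  with elementary tensors are values of the encoding.
\<close>

lemma formal_sums_Cons [simp]:
  "(\<xi>, \<zeta>) # u \<in> formal_sums E F \<longleftrightarrow> \<xi> \<in> vecs E \<and> \<zeta> \<in> vecs F \<and> u \<in> formal_sums E F"
  by (auto simp: formal_sums_def)

lemma formal_sums_Nil [simp]: "[] \<in> formal_sums E F"
  by (simp add: formal_sums_def)

lemma formal_sums_mem: "u \<in> formal_sums E F \<Longrightarrow> (\<xi>, \<zeta>) \<in> set u \<Longrightarrow> \<xi> \<in> vecs E \<and> \<zeta> \<in> vecs F"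
  by (auto simp: formal_sums_def lists_eq_set)

lemma formal_inprod_Cons:
  "formal_inprod E F ((\<xi>, \<zeta>) # u) v = formal_inprod E F [(\<xi>, \<zeta>)] v + formal_inprod E F u v"
  by (simp add: formal_inprod_def)

lemma star_sum_list: "star (sum_list (map f xs)) = (\<Sum>x\<leftarrow>xs. star (f x))"
  by (induction xs) (simp_all add: star_add)

lemma sum_list_swap:
  "(\<Sum>x\<leftarrow>xs. \<Sum>y\<leftarrow>ys. f x y) = (\<Sum>y\<leftarrow>ys. \<Sum>x\<leftarrow>xs. f x y :: 'a::comm_monoid_add)"
  by (induction xs) (simp_all add: sum_list_addf)

locale tensor_factors = L: hilbert_module E + R: traced_correspondence F \<tau>
  for E :: "('x::complex_vector, 'a::cstar_algebra, 'm) hilbert_module_scheme"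
    and F :: "('y::complex_vector, 'a, 'k) correspondence_scheme" and \<tau> :: "'a \<Rightarrow> complex"
begin

lemma formal_inprod_star:
  assumes "u \<in> formal_sums E F" "v \<in> formal_sums E F"
  shows "star (formal_inprod E F u v) = formal_inprod E F v u"
proof -
  have *: "star (inprod F \<zeta> (lmult F (inprod E \<xi> \<xi>') \<zeta>')) = inprod F \<zeta>' (lmult F (inprod E \<xi>' \<xi>) \<zeta>)"
    if "(\<xi>, \<zeta>) \<in> set u" "(\<xi>', \<zeta>') \<in> set v" for \<xi> \<zeta> \<xi>' \<zeta>'
    using formal_sums_mem [OF assms(1) that(1)] formal_sums_mem [OF assms(2) that(2)]
    by (simp add: R.inprod_star R.lmult_closed R.inprod_lmult L.inprod_star)
  have "star (formal_inprod E F u v)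
      = (\<Sum>x\<leftarrow>u. \<Sum>y\<leftarrow>v. star (case x of (\<xi>, \<zeta>) \<Rightarrow> case y of (\<xi>', \<zeta>') \<Rightarrow> inprod F \<zeta> (lmult F (inprod E \<xi> \<xi>') \<zeta>')))"
    by (simp add: formal_inprod_def star_sum_list case_prod_unfold)
  also have "\<dots> = (\<Sum>x\<leftarrow>u. \<Sum>y\<leftarrow>v. (case y of (\<xi>', \<zeta>') \<Rightarrow> case x of (\<xi>, \<zeta>) \<Rightarrow> inprod F \<zeta>' (lmult F (inprod E \<xi>' \<xi>) \<zeta>)))"
    by (intro arg_cong [where f = sum_list] map_cong refl) (auto simp: *)
  also have "\<dots> = formal_inprod E F v u"
    by (subst sum_list_swap) (simp add: formal_inprod_def case_prod_unfold)
  finally show ?thesis .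
qed

lemma represents_elem_tensor:
  assumes "\<xi> \<in> vecs E" "\<zeta> \<in> vecs F"
  shows "represents E F (\<lambda>n. [(\<xi>, \<zeta>)]) (elem_tensor E F \<xi> \<zeta>)"
  using assms by (auto simp: represents_def formal_Cauchy_def elem_tensor_def)

lemma elem_tensor_closed:
  "\<xi> \<in> vecs E \<Longrightarrow> \<zeta> \<in> vecs F \<Longrightarrow> elem_tensor E F \<xi> \<zeta> \<in> vecs (tensor_module E F)"
  using represents_elem_tensor by (auto simp: tensor_module_def)

text \<open>
  For an elementary tensor in the second place the limit in the definition of the inner product does not depend on
  the sequence that represents \<open>f\<close>: up to the involution it is the value of \<open>f\<close> at a fixed formal sum.
\<close>

lemma inprod_elem_tensor:
  assumes f: "f \<in> vecs (tensor_module E F)" and xz: "\<xi> \<in> vecs E" "\<zeta> \<in> vecs F"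
  shows "inprod (tensor_module E F) f (elem_tensor E F \<xi> \<zeta>) = star (f [(\<xi>, \<zeta>)])"
proof -
  have lim: "(\<lambda>n. elem_tensor E F \<xi> \<zeta> (u n)) \<longlonglongrightarrow> star (f [(\<xi>, \<zeta>)])" if u: "represents E F u f" for u
  proof -
    have un: "u n \<in> formal_sums E F" for n using u by (simp add: represents_def formal_Cauchy_def)
    have "(\<lambda>n. formal_inprod E F [(\<xi>, \<zeta>)] (u n)) \<longlonglongrightarrow> f [(\<xi>, \<zeta>)]"
      using u xz by (simp add: represents_def)
    from tendsto_star [OF this] show ?thesis
      using un xz by (simp add: formal_inprod_star elem_tensor_def)
  qed
  obtain u where u: "represents E F u f" using f by (auto simp: tensor_module_def)
  have "(THE c. \<forall>u. represents E F u f \<longrightarrow> (\<lambda>n. elem_tensor E F \<xi> \<zeta> (u n)) \<longlonglongrightarrow> c) = star (f [(\<xi>, \<zeta>)])"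
    using lim u LIMSEQ_unique by (intro the_equality) blast+
  then show ?thesis by (simp add: tensor_module_def)
qed

end

locale traced_product_system = product_system P X mul j + trace_state \<tau>
  for P :: "('p, 'k) monoid_scheme" (structure)
    and X :: "'p \<Rightarrow> ('x::complex_vector, 'a::cstar_algebra) correspondence"
    and mul :: "'p \<Rightarrow> 'p \<Rightarrow> 'x \<Rightarrow> 'x \<Rightarrow> 'x"
    and j :: "'a \<Rightarrow> 'x" and \<tau> :: "'a \<Rightarrow> complex"
begin

lemma traced: "p \<in> carrier P \<Longrightarrow> traced_correspondence (X p) \<tau>"
  by (intro traced_correspondence.intro correspondence trace_state_axioms)

lemma lmult_mul:
  assumes pq: "p \<in> carrier P" "q \<in> carrier P" and x: "\<xi> \<in> vecs (X p)" "\<zeta> \<in> vecs (X q)"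
  shows "lmult (X (p \<otimes> q)) b (mul p q \<xi> \<zeta>) = mul p q (lmult (X p) b \<xi>) \<zeta>"
proof -
  have jb: "j b \<in> vecs (X \<one>)"
    using unit_iso by (auto simp: hilbert_module_iso_def self_correspondence_def bij_betw_def)
  have "lmult (X (p \<otimes> q)) b (mul p q \<xi> \<zeta>) = mul \<one> (p \<otimes> q) (j b) (mul p q \<xi> \<zeta>)"
    using pq x by (simp add: mul_unit_left mul_closed)
  also have "\<dots> = mul (\<one> \<otimes> p) q (mul \<one> p (j b) \<xi>) \<zeta>"
    using mul_assoc [OF one_closed pq jb x] by simp
  also have "\<dots> = mul p q (lmult (X p) b \<xi>) \<zeta>"
    using pq x by (simp add: mul_unit_left)
  finally show ?thesis .
qed

end

locale product_pair = traced_product_system P X mul j \<tau>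
  for P :: "('p, 'k) monoid_scheme" (structure)
    and X :: "'p \<Rightarrow> ('x::complex_vector, 'a::cstar_algebra) correspondence"
    and mul :: "'p \<Rightarrow> 'p \<Rightarrow> 'x \<Rightarrow> 'x \<Rightarrow> 'x"
    and j :: "'a \<Rightarrow> 'x" and \<tau> :: "'a \<Rightarrow> complex" +
  fixes p q :: 'p
  assumes p: "p \<in> carrier P" "p \<noteq> \<one>" and q: "q \<in> carrier P"
begin

sublocale Xp: traced_correspondence "X p" \<tau> using p traced by blast
sublocale Xq: traced_correspondence "X q" \<tau> using q traced by blast
sublocale Xpq: traced_correspondence "X (p \<otimes> q)" \<tau> using p q traced by blast
sublocale T: tensor_factors "X p" "X q" \<tau> by unfold_locales

definition mul_sum :: "('x \<times> 'x) list \<Rightarrow> 'x"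
  where "mul_sum u = (\<Sum>(x, y)\<leftarrow>u. mul p q x y)"

text \<open>The contraction \<open>x \<otimes> y \<mapsto> \<langle>\<zeta>, x\<rangle> y\<close>, which is adjoint to \<open>z \<mapsto> \<zeta> \<otimes> z\<close>.\<close>

definition contract :: "'x \<Rightarrow> ('x \<times> 'x) list \<Rightarrow> 'x"
  where "contract \<zeta> u = (\<Sum>(x, y)\<leftarrow>u. lmult (X q) (inprod (X p) \<zeta> x) y)"

abbreviation fsums :: "('x \<times> 'x) list set" where "fsums \<equiv> formal_sums (X p) (X q)"

lemma inprod_mul_unitary:
  assumes U: "multiplication_unitary P X mul p q U" and f: "f \<in> vecs (tensor_module (X p) (X q))"
    and x: "\<xi> \<in> vecs (X p)" "\<zeta> \<in> vecs (X q)"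
  shows "inprod (X (p \<otimes> q)) (mul p q \<xi> \<zeta>) (U f) = f [(\<xi>, \<zeta>)]"
proof -
  have iso: "U g \<in> vecs (X (p \<otimes> q))" if "g \<in> vecs (tensor_module (X p) (X q))" for g
    using U that by (auto simp: multiplication_unitary_def hilbert_module_iso_def bij_betw_def)
  have "inprod (X (p \<otimes> q)) (U f) (mul p q \<xi> \<zeta>)
      = inprod (tensor_module (X p) (X q)) f (elem_tensor (X p) (X q) \<xi> \<zeta>)"
    using U f x T.elem_tensor_closed [OF x]
    unfolding multiplication_unitary_def hilbert_module_iso_def by metis
  also have "\<dots> = star (f [(\<xi>, \<zeta>)])" by (rule T.inprod_elem_tensor [OF f x])
  finally have "star (inprod (X (p \<otimes> q)) (U f) (mul p q \<xi> \<zeta>)) = f [(\<xi>, \<zeta>)]" by (simp add: star_star)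
  then show ?thesis using iso [OF f] mul_closed p q x by (simp add: Xpq.inprod_star)
qed

lemma inprod_mul:
  assumes x: "\<xi> \<in> vecs (X p)" "\<zeta> \<in> vecs (X q)" "\<xi>' \<in> vecs (X p)" "\<zeta>' \<in> vecs (X q)"
  shows "inprod (X (p \<otimes> q)) (mul p q \<xi> \<zeta>) (mul p q \<xi>' \<zeta>') = inprod (X q) \<zeta> (lmult (X q) (inprod (X p) \<xi> \<xi>') \<zeta>')"
proof -
  obtain U where U: "multiplication_unitary P X mul p q U" using mul_unitary p q by blast
  have "mul p q \<xi>' \<zeta>' = U (elem_tensor (X p) (X q) \<xi>' \<zeta>')"
    using U x by (simp add: multiplication_unitary_def)
  then have "inprod (X (p \<otimes> q)) (mul p q \<xi> \<zeta>) (mul p q \<xi>' \<zeta>') = elem_tensor (X p) (X q) \<xi>' \<zeta>' [(\<xi>, \<zeta>)]"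
    by (simp only: inprod_mul_unitary [OF U T.elem_tensor_closed [OF x(3,4)] x(1,2)])
  then show ?thesis using x by (simp add: elem_tensor_def formal_inprod_def)
qed

lemma mul_pair_closed: "u \<in> fsums \<Longrightarrow> y \<in> set u \<Longrightarrow> (case y of (x, y) \<Rightarrow> mul p q x y) \<in> vecs (X (p \<otimes> q))"
  using formal_sums_mem [of u "X p" "X q" "fst y" "snd y"] mul_closed p q by (simp add: case_prod_unfold)

lemma mul_sum_closed: "u \<in> fsums \<Longrightarrow> mul_sum u \<in> vecs (X (p \<otimes> q))"
  unfolding mul_sum_def by (rule Xpq.vecs_sum_list) (rule mul_pair_closed)

lemma contract_closed: "\<zeta> \<in> vecs (X p) \<Longrightarrow> u \<in> fsums \<Longrightarrow> contract \<zeta> u \<in> vecs (X q)"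
  unfolding contract_def using formal_sums_mem [of u "X p" "X q"]
  by (intro Xq.vecs_sum_list) (auto intro: Xq.lmult_closed)

lemma inprod_mul_contract:
  assumes "\<zeta> \<in> vecs (X p)" "z \<in> vecs (X q)" "u \<in> fsums"
  shows "inprod (X (p \<otimes> q)) (mul p q \<zeta> z) (mul_sum u) = inprod (X q) z (contract \<zeta> u)"
proof -
  have "inprod (X (p \<otimes> q)) (mul p q \<zeta> z) (mul_sum u)
      = (\<Sum>y\<leftarrow>u. inprod (X (p \<otimes> q)) (mul p q \<zeta> z) (case y of (x, y) \<Rightarrow> mul p q x y))"
    unfolding mul_sum_def using assms mul_closed p q by (intro Xpq.inprod_sum_list mul_pair_closed) auto
  also have "\<dots> = (\<Sum>y\<leftarrow>u. inprod (X q) z (case y of (x, y) \<Rightarrow> lmult (X q) (inprod (X p) \<zeta> x) y))"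
    using formal_sums_mem [OF assms(3)] assms by (intro arg_cong [where f = sum_list] map_cong) (auto simp: inprod_mul)
  also have "\<dots> = inprod (X q) z (contract \<zeta> u)"
    unfolding contract_def using formal_sums_mem [OF assms(3)] assms
    by (intro Xq.inprod_sum_list [symmetric]) (auto intro: Xq.lmult_closed)
  finally show ?thesis .
qed

lemma inprod_mul_sum:
  assumes "u \<in> fsums" "v \<in> fsums"
  shows "inprod (X (p \<otimes> q)) (mul_sum u) (mul_sum v) = formal_inprod (X p) (X q) u v"
proof -
  have "inprod (X (p \<otimes> q)) (mul_sum u) (mul_sum v)
      = (\<Sum>y\<leftarrow>u. inprod (X (p \<otimes> q)) (case y of (x, y) \<Rightarrow> mul p q x y) (mul_sum v))"
    unfolding mul_sum_def [of u] using assms by (intro Xpq.inprod_sum_list_left mul_pair_closed mul_sum_closed) auto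
  also have "\<dots> = (\<Sum>(\<xi>, \<zeta>)\<leftarrow>u. inprod (X q) \<zeta> (contract \<xi> v))"
    using formal_sums_mem [OF assms(1)] assms
    by (intro arg_cong [where f = sum_list] map_cong) (auto simp: inprod_mul_contract)
  also have "\<dots> = formal_inprod (X p) (X q) u v"
    unfolding formal_inprod_def
  proof (intro arg_cong [where f = sum_list] map_cong refl)
    fix y assume y: "y \<in> set u"
    obtain \<xi> \<zeta> where [simp]: "y = (\<xi>, \<zeta>)" by fastforce
    have "inprod (X q) \<zeta> (contract \<xi> v)
        = (\<Sum>y\<leftarrow>v. inprod (X q) \<zeta> (case y of (x, y) \<Rightarrow> lmult (X q) (inprod (X p) \<xi> x) y))"
      unfolding contract_def using formal_sums_mem [OF assms(1)] formal_sums_mem [OF assms(2)] y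
      by (intro Xq.inprod_sum_list) (auto intro: Xq.lmult_closed)
    then show "(case y of (\<xi>, \<zeta>) \<Rightarrow> inprod (X q) \<zeta> (contract \<xi> v)) =
      (case y of (\<xi>, \<zeta>) \<Rightarrow> \<Sum>(\<xi>', \<zeta>')\<leftarrow>v. inprod (X q) \<zeta> (lmult (X q) (inprod (X p) \<xi> \<xi>') \<zeta>'))"
      by (simp add: case_prod_unfold)
  qed
  finally show ?thesis .
qed

lemma lmult_mul_sum:
  assumes "u \<in> fsums"
  shows "map (\<lambda>(x, y). (lmult (X p) b x, y)) u \<in> fsums"
    "lmult (X (p \<otimes> q)) b (mul_sum u) = mul_sum (map (\<lambda>(x, y). (lmult (X p) b x, y)) u)"
    "\<xi> \<in> vecs (X p) \<Longrightarrow> contract \<xi> (map (\<lambda>(x, y). (lmult (X p) b x, y)) u) = contract (lmult (X p) (star b) \<xi>) u"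
proof -
  show "map (\<lambda>(x, y). (lmult (X p) b x, y)) u \<in> fsums"
    using assms by (auto simp: formal_sums_def lists_eq_set Xp.lmult_closed)
  have "lmult (X (p \<otimes> q)) b (mul_sum u) = (\<Sum>y\<leftarrow>u. lmult (X (p \<otimes> q)) b (case y of (x, y) \<Rightarrow> mul p q x y))"
    unfolding mul_sum_def by (rule Xpq.lmult_sum_list_vec) (rule mul_pair_closed [OF assms])
  also have "\<dots> = mul_sum (map (\<lambda>(x, y). (lmult (X p) b x, y)) u)"
    unfolding mul_sum_def map_map using formal_sums_mem [OF assms] p q
    by (intro arg_cong [where f = sum_list] map_cong) (auto simp: lmult_mul)
  finally show "lmult (X (p \<otimes> q)) b (mul_sum u) = mul_sum (map (\<lambda>(x, y). (lmult (X p) b x, y)) u)" .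
  assume "\<xi> \<in> vecs (X p)"
  then show "contract \<xi> (map (\<lambda>(x, y). (lmult (X p) b x, y)) u) = contract (lmult (X p) (star b) \<xi>) u"
    unfolding contract_def map_map using formal_sums_mem [OF assms]
    by (intro arg_cong [where f = sum_list] map_cong) (auto simp: Xp.inprod_lmult star_star)
qed

text \<open>
  A vector \<open>U f\<close> is first compared with the limit \<open>Y\<close> of the products of the formal sums that
  represent \<open>f\<close>. The Cauchy condition of the encoding is exactly that of the sequence of these products, and
  both \<open>U f\<close> and \<open>Y\<close> have the same inner products with all products \<open>\<xi> \<zeta>\<close>. As \<open>Y\<close> is itself a value of
  \<open>U\<close>, this suffices.
\<close>

lemma mul_sum_dense:
  assumes h: "h \<in> vecs (X (p \<otimes> q))"
  obtains u where "\<And>n. u n \<in> fsums" "(\<lambda>n. mnorm (X (p \<otimes> q)) (mul_sum (u n) - h)) \<longlonglongrightarrow> 0"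
proof -
  obtain U where U: "multiplication_unitary P X mul p q U" using mul_unitary p q by blast
  then have bij: "bij_betw U (vecs (tensor_module (X p) (X q))) (vecs (X (p \<otimes> q)))"
    by (simp add: multiplication_unitary_def hilbert_module_iso_def)
  obtain f where f: "f \<in> vecs (tensor_module (X p) (X q))" "h = U f"
    using bij h by (auto simp: bij_betw_def)
  then obtain u where u: "represents (X p) (X q) u f" by (auto simp: tensor_module_def)
  have un: "u n \<in> fsums" for n using u by (simp add: represents_def formal_Cauchy_def)
  have "\<exists>N. \<forall>m\<ge>N. \<forall>n\<ge>N. mnorm (X (p \<otimes> q)) (mul_sum (u m) - mul_sum (u n)) < \<epsilon>" if "\<epsilon> > 0" for \<epsilon>
  proof -
    have "inprod (X (p \<otimes> q)) (mul_sum (u m) - mul_sum (u n)) (mul_sum (u m) - mul_sum (u n))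
      = formal_inprod (X p) (X q) (u m) (u m) - formal_inprod (X p) (X q) (u m) (u n)
        - formal_inprod (X p) (X q) (u n) (u m) + formal_inprod (X p) (X q) (u n) (u n)" for m n
      using un [of m] un [of n]
      by (simp add: Xpq.inprod_diff Xpq.inprod_diff_left Xpq.vecs_diff mul_sum_closed inprod_mul_sum)
    then show ?thesis using u that unfolding represents_def formal_Cauchy_def mnorm_def by simp
  qed
  then obtain Y where Y: "Y \<in> vecs (X (p \<otimes> q))" "(\<lambda>n. mnorm (X (p \<otimes> q)) (mul_sum (u n) - Y)) \<longlonglongrightarrow> 0"
    using Xpq.complete [of "\<lambda>n. mul_sum (u n)"] mul_sum_closed un by blast
  obtain g where g: "g \<in> vecs (tensor_module (X p) (X q))" "Y = U g"
    using bij Y(1) by (auto simp: bij_betw_def)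
  have single: "f [(\<xi>, \<zeta>)] = g [(\<xi>, \<zeta>)]" if x: "\<xi> \<in> vecs (X p)" "\<zeta> \<in> vecs (X q)" for \<xi> \<zeta>
  proof -
    have "mul_sum [(\<xi>, \<zeta>)] = mul p q \<xi> \<zeta>" by (simp add: mul_sum_def)
    then have "inprod (X (p \<otimes> q)) (mul p q \<xi> \<zeta>) (mul_sum (u n)) = formal_inprod (X p) (X q) [(\<xi>, \<zeta>)] (u n)" for n
      using inprod_mul_sum [of "[(\<xi>, \<zeta>)]" "u n"] un x by simp
    moreover have "(\<lambda>n. inprod (X (p \<otimes> q)) (mul p q \<xi> \<zeta>) (mul_sum (u n))) \<longlonglongrightarrow> inprod (X (p \<otimes> q)) (mul p q \<xi> \<zeta>) Y"
      using Y x p q un by (intro Xpq.tendsto_inprod mul_closed mul_sum_closed) auto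
    moreover have "(\<lambda>n. formal_inprod (X p) (X q) [(\<xi>, \<zeta>)] (u n)) \<longlonglongrightarrow> f [(\<xi>, \<zeta>)]"
      using u x by (simp add: represents_def)
    ultimately show ?thesis
      using inprod_mul_unitary [OF U g(1) x] LIMSEQ_unique by (simp add: g(2))
  qed
  have additive: "k v = (\<Sum>y\<leftarrow>v. k [y])"
    if k: "represents (X p) (X q) w k" and v: "v \<in> fsums" for k w v
  proof (rule LIMSEQ_unique)
    show "(\<lambda>n. formal_inprod (X p) (X q) v (w n)) \<longlonglongrightarrow> k v" using k v by (simp add: represents_def)
    show "(\<lambda>n. formal_inprod (X p) (X q) v (w n)) \<longlonglongrightarrow> (\<Sum>y\<leftarrow>v. k [y])"
      using v
    proof (induction v)
      case Nil then show ?case by (simp add: formal_inprod_def)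
    next
      case (Cons y v)
      obtain \<xi> \<zeta> where [simp]: "y = (\<xi>, \<zeta>)" by fastforce
      have "(\<lambda>n. formal_inprod (X p) (X q) [(\<xi>, \<zeta>)] (w n)) \<longlonglongrightarrow> k [(\<xi>, \<zeta>)]"
        using k Cons.prems by (simp add: represents_def)
      then show ?case
        using Cons by (simp add: formal_inprod_Cons [of _ _ \<xi> \<zeta> v]) (rule tendsto_add, auto)
    qed
  qed
  obtain w where w: "represents (X p) (X q) w g" using g by (auto simp: tensor_module_def)
  have "f v = g v" for v
  proof (cases "v \<in> fsums")
    case True
    have "(\<Sum>y\<leftarrow>v. f [y]) = (\<Sum>y\<leftarrow>v. g [y])"
      using formal_sums_mem [OF True] single by (intro arg_cong [where f = sum_list] map_cong) auto
    then show ?thesis using additive [OF u True] additive [OF w True] by simp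
  next
    case False then show ?thesis using u w by (simp add: represents_def)
  qed
  then have "f = g" by blast
  then show thesis using that un Y(2) f(2) g(2) by blast
qed

text \<open>
  If \<open>k = \<Sum>\<^bsub>\<xi>\<in>H\<^esub> \<theta>\<^bsub>\<xi>,\<xi>\<^esub>\<close>, then \<open>k \<otimes> 1 = \<Sum>\<^bsub>\<xi>\<in>H\<^esub> T\<^bsub>\<xi>\<^esub> T\<^bsub>\<xi>\<^esub>\<^sup>*\<close> for the operators \<open>T\<^bsub>\<xi>\<^esub> z = \<xi> \<otimes> z\<close>, and
  \<open>1 - k = A'\<^sup>* A'\<close> becomes \<open>(A' \<otimes> 1)\<^sup>* (A' \<otimes> 1)\<close>.
\<close>

lemma formal_inprod_split:
  assumes H: "finite H" "H \<subseteq> vecs (X p)" and A': "remainder (X p) H A'" and u: "u \<in> fsums"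
  shows "map (\<lambda>(x, y). (A' x, y)) u \<in> fsums"
    "inprod (X (p \<otimes> q)) (mul_sum u) (mul_sum u) =
      (\<Sum>\<xi>\<in>H. inprod (X q) (contract \<xi> u) (contract \<xi> u))
      + inprod (X (p \<otimes> q)) (mul_sum (map (\<lambda>(x, y). (A' x, y)) u)) (mul_sum (map (\<lambda>(x, y). (A' x, y)) u))"
proof -
  have A'cl: "A' x \<in> vecs (X p)" if "x \<in> vecs (X p)" for x by (rule Xp.remainder_closed [OF A' that])
  let ?u' = "map (\<lambda>(x, y). (A' x, y)) u"
  show u': "?u' \<in> fsums" using u A'cl by (auto simp: formal_sums_def lists_eq_set)
  define B where "B a b \<xi> = inprod (X q) (lmult (X q) (inprod (X p) \<xi> (fst a)) (snd a)) (lmult (X q) (inprod (X p) \<xi> (fst b)) (snd b))" for a b \<xi>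
  have pair: "inprod (X q) (snd a) (lmult (X q) (inprod (X p) (fst a) (fst b)) (snd b))
      = (\<Sum>\<xi>\<in>H. B a b \<xi>) + inprod (X q) (snd a) (lmult (X q) (inprod (X p) (A' (fst a)) (A' (fst b))) (snd b))"
    if "a \<in> set u" "b \<in> set u" for a b
  proof -
    have ab: "fst a \<in> vecs (X p)" "snd a \<in> vecs (X q)" "fst b \<in> vecs (X p)" "snd b \<in> vecs (X q)"
      using formal_sums_mem [OF u] that by (metis prod.collapse)+
    have sumH: "lmult (X q) (\<Sum>\<xi>\<in>H. f \<xi>) z = (\<Sum>\<xi>\<in>H. lmult (X q) (f \<xi>) z)" for f z
      using H(1) by (induction H rule: finite_induct) (simp_all add: Xq.lmult_add Xq.lmult_sum_coeff [of "{}" "\<lambda>_. 0", simplified])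
    have inH: "inprod (X q) z (\<Sum>\<xi>\<in>H. f \<xi>) = (\<Sum>\<xi>\<in>H. inprod (X q) z (f \<xi>)) \<and> (\<Sum>\<xi>\<in>H. f \<xi>) \<in> vecs (X q)"
      if "z \<in> vecs (X q)" "\<And>\<xi>. f \<xi> \<in> vecs (X q)" for z f
      using H(1) that by (induction H rule: finite_induct) (simp_all add: Xq.inprod_add Xq.vecs_add Xq.vecs_zero)
    have "inprod (X q) (snd a) (lmult (X q) (inprod (X p) (fst a) \<xi> * inprod (X p) \<xi> (fst b)) (snd b)) = B a b \<xi>"
      if "\<xi> \<in> H" for \<xi>
      using ab H that by (simp add: B_def Xq.inprod_lmult Xp.inprod_star subset_iff Xq.lmult_closed Xq.lmult_lmult)
    then have "(\<Sum>\<xi>\<in>H. inprod (X q) (snd a) (lmult (X q) (inprod (X p) (fst a) \<xi> * inprod (X p) \<xi> (fst b)) (snd b))) = (\<Sum>\<xi>\<in>H. B a b \<xi>)"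
      by (rule sum.cong [OF refl])
    then show ?thesis
      using Xp.remainder_eq [OF A' ab(1,3)] ab
      by (simp add: Xq.lmult_add Xq.inprod_add Xq.lmult_closed sumH inH)
  qed
  have "formal_inprod (X p) (X q) u u = (\<Sum>a\<leftarrow>u. \<Sum>b\<leftarrow>u. (\<Sum>\<xi>\<in>H. B a b \<xi>)
      + inprod (X q) (snd a) (lmult (X q) (inprod (X p) (A' (fst a)) (A' (fst b))) (snd b)))"
    unfolding formal_inprod_def case_prod_unfold
    by (intro arg_cong [where f = sum_list] map_cong refl) (rule pair)
  also have "\<dots> = (\<Sum>a\<leftarrow>u. \<Sum>b\<leftarrow>u. \<Sum>\<xi>\<in>H. B a b \<xi>) + formal_inprod (X p) (X q) ?u' ?u'"
    unfolding formal_inprod_def case_prod_unfold by (simp add: sum_list_addf comp_def)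
  also have "(\<Sum>a\<leftarrow>u. \<Sum>b\<leftarrow>u. \<Sum>\<xi>\<in>H. B a b \<xi>) = (\<Sum>\<xi>\<in>H. \<Sum>a\<leftarrow>u. \<Sum>b\<leftarrow>u. B a b \<xi>)"
  proof -
    have sw: "(\<Sum>a\<leftarrow>v. \<Sum>\<xi>\<in>H. f a \<xi>) = (\<Sum>\<xi>\<in>H. \<Sum>a\<leftarrow>v. f a \<xi>)" for f :: "'x \<times> 'x \<Rightarrow> 'x \<Rightarrow> 'a" and v
      by (induction v) (simp_all add: sum.distrib)
    show ?thesis by (simp add: sw)
  qed
  also have "\<dots> = (\<Sum>\<xi>\<in>H. inprod (X q) (contract \<xi> u) (contract \<xi> u))"
  proof (rule sum.cong [OF refl])
    fix \<xi> assume "\<xi> \<in> H"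
    then have xi: "\<xi> \<in> vecs (X p)" using H by blast
    have cl: "(case a of (x, y) \<Rightarrow> lmult (X q) (inprod (X p) \<xi> x) y) \<in> vecs (X q)" if "a \<in> set u" for a
      using formal_sums_mem [OF u] that by (cases a) (auto intro: Xq.lmult_closed)
    have "inprod (X q) (contract \<xi> u) (contract \<xi> u)
        = (\<Sum>a\<leftarrow>u. inprod (X q) (case a of (x, y) \<Rightarrow> lmult (X q) (inprod (X p) \<xi> x) y) (contract \<xi> u))"
      by (subst (1) contract_def) (intro Xq.inprod_sum_list_left cl contract_closed xi u)
    also have "\<dots> = (\<Sum>a\<leftarrow>u. \<Sum>b\<leftarrow>u. B a b \<xi>)"
    proof (intro arg_cong [where f = sum_list] map_cong refl)
      fix a assume "a \<in> set u"
      then show "inprod (X q) (case a of (x, y) \<Rightarrow> lmult (X q) (inprod (X p) \<xi> x) y) (contract \<xi> u) = (\<Sum>b\<leftarrow>u. B a b \<xi>)"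
        unfolding contract_def using cl
        by (subst Xq.inprod_sum_list) (auto simp: B_def case_prod_unfold)
    qed
    finally show "(\<Sum>a\<leftarrow>u. \<Sum>b\<leftarrow>u. B a b \<xi>) = inprod (X q) (contract \<xi> u) (contract \<xi> u)" by simp
  qed
  finally show "inprod (X (p \<otimes> q)) (mul_sum u) (mul_sum u) =
      (\<Sum>\<xi>\<in>H. inprod (X q) (contract \<xi> u) (contract \<xi> u)) + inprod (X (p \<otimes> q)) (mul_sum ?u') (mul_sum ?u')"
    by (simp add: inprod_mul_sum u u')
qed

lemma tr_mul_sum_small:
  assumes u: "u \<in> fsums" and cl: "\<And>x. x \<in> vecs (X p) \<Longrightarrow> A' x \<in> vecs (X p)"
    and small: "\<And>x y. (x, y) \<in> set u \<Longrightarrow> norm (inprod (X p) (A' x) (A' x)) < \<delta>"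
  shows "tr (inprod (X (p \<otimes> q)) (mul_sum (map (\<lambda>(x, y). (A' x, y)) u)) (mul_sum (map (\<lambda>(x, y). (A' x, y)) u)))
    \<le> \<delta> * (\<Sum>(x, y)\<leftarrow>u. mnorm (X q) y)\<^sup>2"
proof -
  let ?u' = "map (\<lambda>(x, y). (A' x, y)) u"
  let ?M = "\<Sum>(x, y)\<leftarrow>u. mnorm (X q) y"
  have u': "?u' \<in> fsums" using u cl by (auto simp: formal_sums_def lists_eq_set)
  have one: "mnorm (X (p \<otimes> q)) (mul p q (A' x) y) \<le> sqrt \<delta> * mnorm (X q) y" if xy: "(x, y) \<in> set u" for x y
  proof -
    have x: "A' x \<in> vecs (X p)" "y \<in> vecs (X q)" using formal_sums_mem [OF u xy] cl by auto
    have "(mnorm (X (p \<otimes> q)) (mul p q (A' x) y))\<^sup>2 = norm (inprod (X q) y (lmult (X q) (inprod (X p) (A' x) (A' x)) y))"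
      using x by (simp add: Xpq.mnorm_square inprod_mul)
    also have "\<dots> \<le> mnorm (X q) y * mnorm (X q) (lmult (X q) (inprod (X p) (A' x) (A' x)) y)"
      using x by (intro Xq.cauchy_schwarz Xq.lmult_closed)
    also have "\<dots> \<le> mnorm (X q) y * (\<delta> * mnorm (X q) y)"
      using x small [OF xy] by (intro mult_left_mono Xq.lmult_bounded) auto
    also have "\<dots> = \<delta> * (mnorm (X q) y)\<^sup>2" by (simp add: power2_eq_square)
    finally have "mnorm (X (p \<otimes> q)) (mul p q (A' x) y) \<le> sqrt (\<delta> * (mnorm (X q) y)\<^sup>2)"
      by (rule real_le_rsqrt)
    then show ?thesis by (simp add: real_sqrt_mult)
  qed
  have "mnorm (X (p \<otimes> q)) (mul_sum ?u') \<le> (\<Sum>y\<leftarrow>?u'. mnorm (X (p \<otimes> q)) (case y of (x, y) \<Rightarrow> mul p q x y))"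
    unfolding mul_sum_def by (rule Xpq.mnorm_sum_list) (rule mul_pair_closed [OF u'])
  also have "\<dots> \<le> (\<Sum>y\<leftarrow>u. sqrt \<delta> * (case y of (x, y) \<Rightarrow> mnorm (X q) y))"
    unfolding map_map by (rule sum_list_mono) (auto simp: one)
  also have "\<dots> = sqrt \<delta> * ?M" by (simp add: sum_list_const_mult)
  finally have n: "mnorm (X (p \<otimes> q)) (mul_sum ?u') \<le> sqrt \<delta> * ?M" .
  show ?thesis
  proof (cases "u = []")
    case True then show ?thesis using Xpq.vecs_zero by (simp add: mul_sum_def)
  next
    case False
    then obtain x y where "(x, y) \<in> set u" by (metis list.set_intros(1) neq_Nil_conv surj_pair)
    then have d: "\<delta> > 0" using small norm_ge_zero le_less_trans by blast
    have "tr (inprod (X (p \<otimes> q)) (mul_sum ?u') (mul_sum ?u')) \<le> (mnorm (X (p \<otimes> q)) (mul_sum ?u'))\<^sup>2"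
      by (simp add: Xpq.mnorm_square tr_le_norm)
    also have "\<dots> \<le> (sqrt \<delta> * ?M)\<^sup>2" by (intro power_mono n) simp
    also have "\<dots> = \<delta> * ?M\<^sup>2" using d by (simp add: power_mult_distrib)
    finally show ?thesis .
  qed
qed

end

section \<open>Induced traces of tensor products\<close>

text \<open>
  From \<open>(\<alpha> + \<gamma>)\<^sup>* (\<alpha> + \<gamma>) \<le> (1 + t) \<alpha>\<^sup>* \<alpha> + (1 + 1/t) \<gamma>\<^sup>* \<gamma>\<close> for \<open>\<alpha> = \<langle>h, z\<rangle>\<close> and \<open>\<gamma> = \<langle>d - h, z\<rangle>\<close>.
\<close>

lemma (in traced_correspondence) tr_inprod_mult_perturbed:
  assumes x: "z \<in> vecs E" "d \<in> vecs E" "h \<in> vecs E" and m: "mnorm E (d - h) < \<delta>" and t: "t > 0"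
  shows "tr (inprod E z d * inprod E d z)
    \<le> (1 + t) * tr (inprod E z h * inprod E h z) + (1 + 1/t) * (\<delta>\<^sup>2 * tr (inprod E z z))"
proof -
  define a where "a = inprod E h z"
  define e where "e = inprod E (d - h) z"
  have dh: "d - h \<in> vecs E" using x vecs_diff by blast
  have d: "inprod E d z = a + e" using x by (simp add: a_def e_def inprod_diff_left)
  have st: "inprod E z d = star (a + e)" "inprod E z h = star a" "inprod E z (d - h) = star e"
    using x dh unfolding d [symmetric] by (simp_all add: inprod_star a_def e_def)
  have "0 \<le> tr (star (sqrt t *\<^sub>R a - (1 / sqrt t) *\<^sub>R e) * (sqrt t *\<^sub>R a - (1 / sqrt t) *\<^sub>R e))"
    by (simp add: tr_nonneg)
  also have "\<dots> = t * tr (star a * a) - tr (star a * e) - tr (star e * a) + (1/t) * tr (star e * e)"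
    using t by (simp add: star_diff star_scaleR algebra_simps tr_diff tr_add tr_scaleR)
  finally have "tr (star (a + e) * (a + e)) \<le> (1 + t) * tr (star a * a) + (1 + 1/t) * tr (star e * e)"
    by (simp add: star_add algebra_simps tr_add)
  moreover have "tr (star e * e) \<le> \<delta>\<^sup>2 * tr (inprod E z z)"
    using tr_inprod_mult_le [OF dh x(1) m] by (simp add: st e_def)
  then have "(1 + 1/t) * tr (star e * e) \<le> (1 + 1/t) * (\<delta>\<^sup>2 * tr (inprod E z z))"
    using t by (intro mult_left_mono) auto
  ultimately show ?thesis unfolding d st by (simp add: a_def)
qed

lemma (in traced_correspondence) tendsto_lmult:
  assumes "x \<in> vecs E" "\<And>n. u n \<in> vecs E" "(\<lambda>n. mnorm E (u n - x)) \<longlonglongrightarrow> 0"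
  shows "(\<lambda>n. mnorm E (lmult E a (u n) - lmult E a x)) \<longlonglongrightarrow> 0"
proof (rule Lim_null_comparison)
  show "\<forall>\<^sub>F n in sequentially. norm (mnorm E (lmult E a (u n) - lmult E a x)) \<le> (norm a + 1) * mnorm E (u n - x)"
  proof (intro always_eventually allI)
    fix n
    have "mnorm E (lmult E a (u n - x)) \<le> (norm a + 1) * mnorm E (u n - x)"
      using assms by (intro lmult_bounded vecs_diff) auto
    then show "norm (mnorm E (lmult E a (u n) - lmult E a x)) \<le> (norm a + 1) * mnorm E (u n - x)"
      using assms by (simp add: lmult_diff_vec)
  qed
  show "(\<lambda>n. (norm a + 1) * mnorm E (u n - x)) \<longlonglongrightarrow> 0" by (rule tendsto_mult_right_zero [OF assms(3)])
qed

context traced_product_system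
begin

abbreviation Tr :: "'p \<Rightarrow> 'a \<Rightarrow> ereal"
  where "Tr r a \<equiv> induced_trace (X r) \<tau> (lmult (X r) a)"

end

context product_pair
begin

abbreviation sq :: "'a \<Rightarrow> 'x \<Rightarrow> 'a"
  where "sq b \<xi> \<equiv> inprod (X p) (lmult (X p) (star b) \<xi>) (lmult (X p) (star b) \<xi>)"

text \<open>
  The vectors of an admissible set \<open>H'\<close> are replaced by nearby sums of products, on which an
  approximate unit \<open>\<Sum>\<^bsub>\<xi>\<^esub> \<theta>\<^bsub>\<xi>,\<xi>\<^esub>\<close> of the first factor acts almost as the identity. What remains are the contractions
  with \<open>b\<^sup>* \<xi>\<close>, whose rank-one operators sum up to at most \<open>\<phi>(\<langle>b\<^sup>* \<xi>, b\<^sup>* \<xi>\<rangle>)\<close>.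
\<close>

lemma tensor_trace_le:
  assumes H': "admissible (X (p \<otimes> q)) H'" and eps: "\<epsilon> > 0"
  obtains F \<delta> where "finite F" "F \<subseteq> vecs (X p)" "\<delta> > 0"
    "\<forall>H. near_unit (X p) F \<delta> H \<longrightarrow> ereal (\<Sum>h\<in>H'. tr (inprod (X (p \<otimes> q)) h (lmult (X (p \<otimes> q)) (star b * b) h)))
        \<le> ereal \<epsilon> + ereal (1 + \<epsilon>) * (\<Sum>\<xi>\<in>H. Tr q (sq b \<xi>))"
proof -
  let ?E = "X (p \<otimes> q)"
  have Hv: "finite H'" "H' \<subseteq> vecs ?E" using H' by (auto simp: admissible_def)
  have "\<forall>h\<in>H'. \<exists>u. (\<forall>n. u n \<in> fsums) \<and> (\<lambda>n. mnorm ?E (mul_sum (u n) - h)) \<longlonglongrightarrow> 0"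
    using Hv mul_sum_dense by (metis subsetD)
  then obtain U where U: "\<forall>h\<in>H'. (\<forall>n. U h n \<in> fsums) \<and> (\<lambda>n. mnorm ?E (mul_sum (U h n) - h)) \<longlonglongrightarrow> 0"
    by (auto dest!: bchoice)
  \<comment> \<open>One half of \<open>\<epsilon>\<close> goes into the factor \<open>1 + t\<close> of \<open>tr_inprod_mult_perturbed\<close>, the other one into its last term, summed over \<open>H'\<close>.\<close>
  define t where "t = \<epsilon> / 2"
  define \<delta>0 where "\<delta>0 = sqrt (t / ((1 + 1/t) * (real (card H') + 1)))"
  have t: "t > 0" using eps by (simp add: t_def)
  then have d0: "\<delta>0 > 0" by (simp add: \<delta>0_def add_pos_pos)
  have "real (card H') * ((1 + 1/t) * \<delta>0\<^sup>2) \<le> (real (card H') + 1) * ((1 + 1/t) * \<delta>0\<^sup>2)"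
    using t by (intro mult_right_mono) auto
  also have "\<dots> = t"
  proof -
    define K where "K = (1 + 1/t) * (real (card H') + 1)"
    have "K > 0" using t by (simp add: K_def add_pos_pos)
    moreover have "\<delta>0\<^sup>2 = t / K" using t by (simp add: \<delta>0_def K_def)
    ultimately have "K * \<delta>0\<^sup>2 = t" by simp
    then show ?thesis by (simp only: K_def mult.commute mult.left_commute)
  qed
  finally have d0le: "real (card H') * ((1 + 1/t) * \<delta>0\<^sup>2) \<le> t" .
  have bconv: "(\<lambda>n. \<Sum>h\<in>H'. tr (inprod ?E (lmult ?E b (mul_sum (U h n))) (lmult ?E b (mul_sum (U h n)))))
      \<longlonglongrightarrow> (\<Sum>h\<in>H'. tr (inprod ?E (lmult ?E b h) (lmult ?E b h)))"
    using U Hv(2) mul_sum_closed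
    by (intro tendsto_sum tendsto_tr Xpq.tendsto_inprod(3) [where y = 0] Xpq.tendsto_lmult
        Xpq.lmult_closed Xpq.vecs_zero) auto
  then have "\<forall>\<^sub>F n in sequentially. (\<Sum>h\<in>H'. tr (inprod ?E (lmult ?E b h) (lmult ?E b h))) - t
      < (\<Sum>h\<in>H'. tr (inprod ?E (lmult ?E b (mul_sum (U h n))) (lmult ?E b (mul_sum (U h n)))))"
    using t by (intro order_tendstoD) auto
  moreover have "\<forall>\<^sub>F n in sequentially. \<forall>h\<in>H'. mnorm ?E (mul_sum (U h n) - h) < \<delta>0"
    using U d0 by (intro eventually_ball_finite Hv(1)) (auto intro: order_tendstoD)
  ultimately have "\<forall>\<^sub>F n in sequentially. (\<Sum>h\<in>H'. tr (inprod ?E (lmult ?E b h) (lmult ?E b h))) - t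
      < (\<Sum>h\<in>H'. tr (inprod ?E (lmult ?E b (mul_sum (U h n))) (lmult ?E b (mul_sum (U h n)))))
      \<and> (\<forall>h\<in>H'. mnorm ?E (mul_sum (U h n) - h) < \<delta>0)"
    by (rule eventually_conj)
  then obtain N where N: "(\<Sum>h\<in>H'. tr (inprod ?E (lmult ?E b h) (lmult ?E b h))) - t
      < (\<Sum>h\<in>H'. tr (inprod ?E (lmult ?E b (mul_sum (U h N))) (lmult ?E b (mul_sum (U h N)))))"
      "\<forall>h\<in>H'. mnorm ?E (mul_sum (U h N) - h) < \<delta>0"
    using eventually_happens' [OF sequentially_bot] by blast
  define v where "v h = U h N" for h
  have v: "v h \<in> fsums" if "h \<in> H'" for h using U that by (simp add: v_def)
  define bv where "bv h = map (\<lambda>(x, y). (lmult (X p) b x, y)) (v h)" for h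
  have bv: "bv h \<in> fsums" "lmult ?E b (mul_sum (v h)) = mul_sum (bv h)" if "h \<in> H'" for h
    using lmult_mul_sum [OF v [OF that]] by (simp_all add: bv_def)
  define F where "F = (\<Union>h\<in>H'. fst ` set (bv h))"
  define M where "M h = (\<Sum>(x, y)\<leftarrow>bv h. mnorm (X q) y)" for h
  define \<delta> where "\<delta> = t / (1 + (\<Sum>h\<in>H'. (M h)\<^sup>2))"
  have M: "(\<Sum>h\<in>H'. (M h)\<^sup>2) \<ge> 0" by (intro sum_nonneg) auto
  have d: "\<delta> > 0" "\<delta> * (\<Sum>h\<in>H'. (M h)\<^sup>2) \<le> t"
    using t M by (auto simp: \<delta>_def field_simps add_pos_nonneg)
  have F1: "finite F" using Hv by (simp add: F_def)
  have F2: "F \<subseteq> vecs (X p)"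
    unfolding F_def using formal_sums_mem [OF bv(1)] by force
  have F3: "\<forall>H. near_unit (X p) F \<delta> H \<longrightarrow> ereal (\<Sum>h\<in>H'. tr (inprod ?E h (lmult ?E (star b * b) h)))
        \<le> ereal \<epsilon> + ereal (1 + \<epsilon>) * (\<Sum>\<xi>\<in>H. Tr q (sq b \<xi>))"
  proof (intro allI impI)
    fix H assume "near_unit (X p) F \<delta> H"
    then obtain A' where H: "admissible (X p) H" and A': "remainder (X p) H A'"
      and small: "\<forall>x\<in>F. norm (inprod (X p) (A' x) (A' x)) < \<delta>" by (auto simp: near_unit_def)
    have HH: "finite H" "H \<subseteq> vecs (X p)" using H by (auto simp: admissible_def)
    define \<eta> where "\<eta> \<xi> h = contract (lmult (X p) (star b) \<xi>) (v h)" for \<xi> h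
    have eta: "contract \<xi> (bv h) = \<eta> \<xi> h" "\<eta> \<xi> h \<in> vecs (X q)" if "\<xi> \<in> H" "h \<in> H'" for \<xi> h
      using lmult_mul_sum(3) [OF v [OF that(2)], of \<xi> b] HH that contract_closed [OF Xp.lmult_closed v]
      by (auto simp: \<eta>_def bv_def)
    have one: "tr (inprod ?E (mul_sum (bv h)) (mul_sum (bv h)))
        \<le> (\<Sum>\<xi>\<in>H. tr (inprod (X q) (\<eta> \<xi> h) (\<eta> \<xi> h))) + \<delta> * (M h)\<^sup>2" if h: "h \<in> H'" for h
    proof -
      have "norm (inprod (X p) (A' x) (A' x)) < \<delta>" if "(x, y) \<in> set (bv h)" for x y
        using small h that by (force simp: F_def)
      then have "tr (inprod ?E (mul_sum (map (\<lambda>(x, y). (A' x, y)) (bv h))) (mul_sum (map (\<lambda>(x, y). (A' x, y)) (bv h))))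
          \<le> \<delta> * (M h)\<^sup>2"
        unfolding M_def using Xp.remainder_closed [OF A'] by (intro tr_mul_sum_small bv h) auto
      then show ?thesis
        using formal_inprod_split(2) [OF HH A' bv(1) [OF h]] h by (simp add: tr_add tr_sum eta)
    qed
    have "(\<Sum>h\<in>H'. tr (inprod ?E h (lmult ?E (star b * b) h))) = (\<Sum>h\<in>H'. tr (inprod ?E (lmult ?E b h) (lmult ?E b h)))"
      using Hv by (intro sum.cong) (auto simp: Xpq.inprod_lmult_square)
    also have "\<dots> \<le> t + (\<Sum>h\<in>H'. tr (inprod ?E (mul_sum (bv h)) (mul_sum (bv h))))"
      using N(1) by (simp add: bv(2) flip: v_def)
    also have "\<dots> \<le> t + (\<Sum>h\<in>H'. (\<Sum>\<xi>\<in>H. tr (inprod (X q) (\<eta> \<xi> h) (\<eta> \<xi> h))) + \<delta> * (M h)\<^sup>2)"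
      by (intro add_left_mono sum_mono one)
    also have "\<dots> = t + \<delta> * (\<Sum>h\<in>H'. (M h)\<^sup>2) + (\<Sum>\<xi>\<in>H. \<Sum>h\<in>H'. tr (inprod (X q) (\<eta> \<xi> h) (\<eta> \<xi> h)))"
      by (simp add: sum.distrib sum_distrib_left sum.swap [of _ H])
    also have "\<dots> \<le> \<epsilon> + (\<Sum>\<xi>\<in>H. \<Sum>h\<in>H'. tr (inprod (X q) (\<eta> \<xi> h) (\<eta> \<xi> h)))"
      using d by (simp add: t_def)
    finally have le: "(\<Sum>h\<in>H'. tr (inprod ?E h (lmult ?E (star b * b) h)))
        \<le> \<epsilon> + (\<Sum>\<xi>\<in>H. \<Sum>h\<in>H'. tr (inprod (X q) (\<eta> \<xi> h) (\<eta> \<xi> h)))" .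
    have tq: "ereal (\<Sum>h\<in>H'. tr (inprod (X q) (\<eta> \<xi> h) (\<eta> \<xi> h))) \<le> ereal (1 + \<epsilon>) * Tr q (sq b \<xi>)" if xi: "\<xi> \<in> H" for \<xi>
    proof -
      define \<zeta> where "\<zeta> = lmult (X p) (star b) \<xi>"
      have z: "\<zeta> \<in> vecs (X p)" using xi HH by (auto simp: \<zeta>_def Xp.lmult_closed)
      obtain V where V: "set V = H'" "distinct V" using finite_distinct_list Hv by blast
      have "ereal (\<Sum>w\<leftarrow>map (\<eta> \<xi>) V. tr (inprod (X q) w w)) \<le> ereal (1 + \<epsilon>) * Tr q (sq b \<xi>)"
      proof (rule Xq.weak_bound_le_induced_trace)
        show "0 \<le> 1 + \<epsilon>" using eps by simp
        show "set (map (\<eta> \<xi>) V) \<subseteq> vecs (X q)" using V eta xi by auto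
        fix z assume zz: "z \<in> vecs (X q)"
        define Z where "Z = mul p q \<zeta> z"
        have Z: "Z \<in> vecs ?E" using mul_closed p q z zz by (simp add: Z_def)
        have ZZ: "0 \<le> tr (inprod ?E Z Z)" using Xpq.tr_inprod_nonneg Z by blast
        have ie: "inprod (X q) z (\<eta> \<xi> h) = inprod ?E Z (mul_sum (v h))"
          "inprod (X q) (\<eta> \<xi> h) z = inprod ?E (mul_sum (v h)) Z" if h: "h \<in> H'" for h
        proof -
          show 1: "inprod (X q) z (\<eta> \<xi> h) = inprod ?E Z (mul_sum (v h))"
            using inprod_mul_contract [OF z zz v [OF h]] by (simp add: Z_def \<eta>_def \<zeta>_def)
          then have "star (inprod (X q) z (\<eta> \<xi> h)) = star (inprod ?E Z (mul_sum (v h)))" by simp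
          then show "inprod (X q) (\<eta> \<xi> h) z = inprod ?E (mul_sum (v h)) Z"
            using eta(2) [OF xi h] zz Z mul_sum_closed [OF v [OF h]] by (simp add: Xq.inprod_star Xpq.inprod_star)
        qed
        have "(\<Sum>w\<leftarrow>map (\<eta> \<xi>) V. tr (inprod (X q) z w * inprod (X q) w z))
            = (\<Sum>h\<in>H'. tr (inprod ?E Z (mul_sum (v h)) * inprod ?E (mul_sum (v h)) Z))"
          using V by (simp add: comp_def sum_list_distinct_conv_sum_set ie cong: sum.cong)
        also have "\<dots> \<le> (\<Sum>h\<in>H'. (1 + t) * tr (inprod ?E Z h * inprod ?E h Z) + (1 + 1/t) * (\<delta>0\<^sup>2 * tr (inprod ?E Z Z)))"
          using N(2) Hv t Z mul_sum_closed v
          by (intro sum_mono Xpq.tr_inprod_mult_perturbed) (auto simp: v_def)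
        also have "\<dots> = (1 + t) * (\<Sum>h\<in>H'. tr (inprod ?E Z h * inprod ?E h Z))
            + real (card H') * ((1 + 1/t) * \<delta>0\<^sup>2) * tr (inprod ?E Z Z)"
          by (simp add: sum.distrib sum_distrib_left)
        also have "\<dots> \<le> (1 + t) * tr (inprod ?E Z Z) + t * tr (inprod ?E Z Z)"
          using d0le t ZZ Xpq.admissible_tr_le [OF H' Z] by (intro add_mono mult_left_mono mult_right_mono) auto
        also have "\<dots> = (1 + \<epsilon>) * tr (inprod ?E Z Z)" by (simp add: t_def algebra_simps)
        also have "inprod ?E Z Z = inprod (X q) z (lmult (X q) (sq b \<xi>) z)"
          using inprod_mul [OF z zz z zz] by (simp add: Z_def \<zeta>_def)
        finally show "(\<Sum>w\<leftarrow>map (\<eta> \<xi>) V. tr (inprod (X q) z w * inprod (X q) w z))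
            \<le> (1 + \<epsilon>) * tr (inprod (X q) z (lmult (X q) (sq b \<xi>) z))" .
      qed
      then show ?thesis using V by (simp add: comp_def sum_list_distinct_conv_sum_set)
    qed
    have "ereal (\<Sum>\<xi>\<in>H. \<Sum>h\<in>H'. tr (inprod (X q) (\<eta> \<xi> h) (\<eta> \<xi> h)))
        = (\<Sum>\<xi>\<in>H. ereal (\<Sum>h\<in>H'. tr (inprod (X q) (\<eta> \<xi> h) (\<eta> \<xi> h))))" by simp
    also have "\<dots> \<le> (\<Sum>\<xi>\<in>H. ereal (1 + \<epsilon>) * Tr q (sq b \<xi>))" by (rule sum_mono [OF tq])
    also have "\<dots> = ereal (1 + \<epsilon>) * (\<Sum>\<xi>\<in>H. Tr q (sq b \<xi>))"
      using eps by (intro sum_ereal_right_distrib [symmetric] Xq.induced_trace_nonneg)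
    finally have "ereal \<epsilon> + ereal (\<Sum>\<xi>\<in>H. \<Sum>h\<in>H'. tr (inprod (X q) (\<eta> \<xi> h) (\<eta> \<xi> h)))
      \<le> ereal \<epsilon> + ereal (1 + \<epsilon>) * (\<Sum>\<xi>\<in>H. Tr q (sq b \<xi>))" by (rule add_left_mono)
    moreover have "ereal (\<Sum>h\<in>H'. tr (inprod ?E h (lmult ?E (star b * b) h)))
        \<le> ereal \<epsilon> + ereal (\<Sum>\<xi>\<in>H. \<Sum>h\<in>H'. tr (inprod (X q) (\<eta> \<xi> h) (\<eta> \<xi> h)))"
      using le by simp
    ultimately show "ereal (\<Sum>h\<in>H'. tr (inprod ?E h (lmult ?E (star b * b) h)))
        \<le> ereal \<epsilon> + ereal (1 + \<epsilon>) * (\<Sum>\<xi>\<in>H. Tr q (sq b \<xi>))" by (rule order_trans [rotated])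
  qed
  show thesis by (rule that [OF F1 F2 d(1) F3])
qed

text \<open>
  The products of admissible vectors are admissible as far as the trace can see:
  \<open>\<Sum>\<^bsub>\<xi>\<^esub> T\<^bsub>\<xi>\<^esub> k\<^bsub>\<xi>\<^esub> T\<^bsub>\<xi>\<^esub>\<^sup>* \<le> \<Sum>\<^bsub>\<xi>\<^esub> T\<^bsub>\<xi>\<^esub> T\<^bsub>\<xi>\<^esub>\<^sup>* \<le> 1\<close> if \<open>T\<^bsub>\<xi>\<^esub> z = \<xi> z\<close> and \<open>k\<^bsub>\<xi>\<^esub> \<le> 1\<close> is the sum of the \<open>\<theta>\<^bsub>g,g\<^esub>\<close> for \<open>g \<in> G \<xi>\<close>.
\<close>

lemma tr_products_le:
  assumes H: "admissible (X p) H" and G: "\<And>\<xi>. \<xi> \<in> H \<Longrightarrow> admissible (X q) (G \<xi>)" and w: "w \<in> vecs (X (p \<otimes> q))"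
  shows "(\<Sum>\<xi>\<in>H. \<Sum>g\<in>G \<xi>. tr (inprod (X (p \<otimes> q)) w (mul p q \<xi> g) * inprod (X (p \<otimes> q)) (mul p q \<xi> g) w))
    \<le> tr (inprod (X (p \<otimes> q)) w w)"
proof -
  let ?E = "X (p \<otimes> q)"
  have HH: "finite H" "H \<subseteq> vecs (X p)" using H by (auto simp: admissible_def)
  have GG: "finite (G \<xi>)" "G \<xi> \<subseteq> vecs (X q)" if "\<xi> \<in> H" for \<xi> using G [OF that] by (auto simp: admissible_def)
  obtain A where A: "remainder (X p) H A" using Xp.admissible_imp_remainder [OF H] by blast
  have mg: "mul p q \<xi> g \<in> vecs ?E" if "\<xi> \<in> H" "g \<in> G \<xi>" for \<xi> g
    using that HH GG mul_closed p q by (metis subsetD)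
  have sums: "(\<Sum>\<xi>\<in>H. \<Sum>g\<in>G \<xi>. tr (inprod ?E (mul_sum u) (mul p q \<xi> g) * inprod ?E (mul p q \<xi> g) (mul_sum u)))
      \<le> tr (inprod ?E (mul_sum u) (mul_sum u))" if u: "u \<in> fsums" for u
  proof -
    have "(\<Sum>g\<in>G \<xi>. tr (inprod ?E (mul_sum u) (mul p q \<xi> g) * inprod ?E (mul p q \<xi> g) (mul_sum u)))
        \<le> tr (inprod (X q) (contract \<xi> u) (contract \<xi> u))" if xi: "\<xi> \<in> H" for \<xi>
    proof -
      have c: "contract \<xi> u \<in> vecs (X q)" using contract_closed xi HH u by blast
      have "inprod ?E (mul_sum u) (mul p q \<xi> g) = inprod (X q) (contract \<xi> u) g \<and>
          inprod ?E (mul p q \<xi> g) (mul_sum u) = inprod (X q) g (contract \<xi> u)" if g: "g \<in> G \<xi>" for g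
      proof -
        have gv: "g \<in> vecs (X q)" "\<xi> \<in> vecs (X p)" using g GG xi HH by blast+
        have 1: "inprod ?E (mul p q \<xi> g) (mul_sum u) = inprod (X q) g (contract \<xi> u)"
          by (rule inprod_mul_contract [OF gv(2,1) u])
        then have "star (inprod ?E (mul p q \<xi> g) (mul_sum u)) = star (inprod (X q) g (contract \<xi> u))" by simp
        then have "inprod ?E (mul_sum u) (mul p q \<xi> g) = inprod (X q) (contract \<xi> u) g"
          using mg [OF xi g] mul_sum_closed [OF u] gv c by (simp add: Xq.inprod_star Xpq.inprod_star)
        with 1 show ?thesis by simp
      qed
      then have "(\<Sum>g\<in>G \<xi>. tr (inprod ?E (mul_sum u) (mul p q \<xi> g) * inprod ?E (mul p q \<xi> g) (mul_sum u)))
        = (\<Sum>g\<in>G \<xi>. tr (inprod (X q) (contract \<xi> u) g * inprod (X q) g (contract \<xi> u)))" by simp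
      also have "\<dots> \<le> tr (inprod (X q) (contract \<xi> u) (contract \<xi> u))"
        by (rule Xq.admissible_tr_le [OF G [OF xi] c])
      finally show ?thesis .
    qed
    then have "(\<Sum>\<xi>\<in>H. \<Sum>g\<in>G \<xi>. tr (inprod ?E (mul_sum u) (mul p q \<xi> g) * inprod ?E (mul p q \<xi> g) (mul_sum u)))
        \<le> (\<Sum>\<xi>\<in>H. tr (inprod (X q) (contract \<xi> u) (contract \<xi> u)))" by (rule sum_mono)
    also have "\<dots> \<le> tr (inprod ?E (mul_sum u) (mul_sum u))"
      using formal_inprod_split [OF HH A u]
        Xpq.tr_inprod_nonneg [OF mul_sum_closed [OF formal_inprod_split(1) [OF HH A u]]]
      by (simp add: tr_add tr_sum)
    finally show ?thesis .
  qed
  obtain u where u: "\<And>n. u n \<in> fsums" "(\<lambda>n. mnorm ?E (mul_sum (u n) - w)) \<longlonglongrightarrow> 0"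
    using mul_sum_dense [OF w] by blast
  show ?thesis
  proof (rule LIMSEQ_le)
    show "(\<lambda>n. tr (inprod ?E (mul_sum (u n)) (mul_sum (u n)))) \<longlonglongrightarrow> tr (inprod ?E w w)"
      by (intro tendsto_tr Xpq.tendsto_inprod(3) [OF w w] mul_sum_closed u)
    show "(\<lambda>n. \<Sum>\<xi>\<in>H. \<Sum>g\<in>G \<xi>. tr (inprod ?E (mul_sum (u n)) (mul p q \<xi> g) * inprod ?E (mul p q \<xi> g) (mul_sum (u n))))
      \<longlonglongrightarrow> (\<Sum>\<xi>\<in>H. \<Sum>g\<in>G \<xi>. tr (inprod ?E w (mul p q \<xi> g) * inprod ?E (mul p q \<xi> g) w))"
      by (intro tendsto_sum tendsto_tr tendsto_mult Xpq.tendsto_inprod(1,2) mul_sum_closed u w mg)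
    show "\<exists>N. \<forall>n\<ge>N. (\<Sum>\<xi>\<in>H. \<Sum>g\<in>G \<xi>. tr (inprod ?E (mul_sum (u n)) (mul p q \<xi> g) * inprod ?E (mul p q \<xi> g) (mul_sum (u n))))
      \<le> tr (inprod ?E (mul_sum (u n)) (mul_sum (u n)))"
      using sums u(1) by blast
  qed
qed

text \<open>
  Nearly optimal admissible sets for the traces on the left, multiplied by the \<open>\<xi>\<close>, form a family that is bounded as
  in \<open>tr_products_le\<close>. The factor \<open>b\<^sup>*\<close> is moved to the other side by \<open>weak_bound_le_induced_trace\<close>.
\<close>

lemma tensor_trace_ge:
  assumes H: "admissible (X p) H" and fin: "\<And>\<xi>. \<xi> \<in> H \<Longrightarrow> Tr q (sq b \<xi>) < \<infinity>"
  shows "(\<Sum>\<xi>\<in>H. Tr q (sq b \<xi>)) \<le> Tr (p \<otimes> q) (star b * b)"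
proof (rule ereal_le_epsilon2)
  fix e :: real assume e: "0 < e"
  let ?E = "X (p \<otimes> q)"
  have HH: "finite H" "H \<subseteq> vecs (X p)" using H by (auto simp: admissible_def)
  define \<delta> where "\<delta> = e / (real (card H) + 1)"
  have d: "\<delta> > 0" "real (card H) * \<delta> \<le> e" using e by (auto simp: \<delta>_def field_simps)
  have "\<exists>G. admissible (X q) G \<and> Tr q (sq b \<xi>) \<le> ereal (\<Sum>g\<in>G. tr (inprod (X q) g (lmult (X q) (sq b \<xi>) g))) + ereal \<delta>"
    if xi: "\<xi> \<in> H" for \<xi>
  proof -
    obtain r where r: "Tr q (sq b \<xi>) = ereal r"
      using fin [OF xi] Xq.induced_trace_nonneg [of "sq b \<xi>"] by (cases "Tr q (sq b \<xi>)") auto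
    have "ereal (r - \<delta>) < Tr q (sq b \<xi>)" using d(1) by (simp add: r)
    then obtain G where G: "admissible (X q) G"
      "ereal (r - \<delta>) < ereal (\<Sum>g\<in>G. tr (inprod (X q) g (lmult (X q) (sq b \<xi>) g)))"
      unfolding Xq.induced_trace_eq less_SUP_iff by blast
    then show ?thesis unfolding r by (intro exI [of _ G]) simp
  qed
  then have "\<forall>\<xi>\<in>H. \<exists>G. admissible (X q) G \<and> Tr q (sq b \<xi>) \<le> ereal (\<Sum>g\<in>G. tr (inprod (X q) g (lmult (X q) (sq b \<xi>) g))) + ereal \<delta>"
    by blast
  from bchoice [OF this] obtain G where G0: "\<forall>\<xi>\<in>H. admissible (X q) (G \<xi>) \<and>
      Tr q (sq b \<xi>) \<le> ereal (\<Sum>g\<in>G \<xi>. tr (inprod (X q) g (lmult (X q) (sq b \<xi>) g))) + ereal \<delta>" ..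
  have G: "admissible (X q) (G \<xi>)"
    "Tr q (sq b \<xi>) \<le> ereal (\<Sum>g\<in>G \<xi>. tr (inprod (X q) g (lmult (X q) (sq b \<xi>) g))) + ereal \<delta>" if "\<xi> \<in> H" for \<xi>
    using G0 that by blast+
  have GG: "finite (G \<xi>)" "G \<xi> \<subseteq> vecs (X q)" if "\<xi> \<in> H" for \<xi> using G(1) [OF that] by (auto simp: admissible_def)
  have mg: "mul p q \<xi> g \<in> vecs ?E" if "\<xi> \<in> H" "g \<in> G \<xi>" for \<xi> g
    using that HH GG mul_closed p q by (metis subsetD)
  obtain V where V: "set V = Sigma H G" "distinct V"
    using finite_distinct_list [of "Sigma H G"] HH GG by auto
  define f where "f = (\<lambda>(\<xi>, g). lmult ?E (star b) (mul p q \<xi> g))"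
  have fcl: "f y \<in> vecs ?E" if "y \<in> Sigma H G" for y using that mg Xpq.lmult_closed by (auto simp: f_def)
  have "ereal (\<Sum>v\<leftarrow>map f V. tr (inprod ?E v v)) \<le> ereal 1 * Tr (p \<otimes> q) (star b * b)"
  proof (rule Xpq.weak_bound_le_induced_trace)
    show "set (map f V) \<subseteq> vecs ?E" using V fcl by auto
    fix z assume z: "z \<in> vecs ?E"
    have bz: "lmult ?E b z \<in> vecs ?E" using z Xpq.lmult_closed by blast
    have fz: "inprod ?E z (f (\<xi>, g)) * inprod ?E (f (\<xi>, g)) z
      = inprod ?E (lmult ?E b z) (mul p q \<xi> g) * inprod ?E (mul p q \<xi> g) (lmult ?E b z)" if "\<xi> \<in> H" "g \<in> G \<xi>" for \<xi> g
      using mg [OF that] z by (simp add: f_def Xpq.inprod_lmult star_star)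
    have "(\<Sum>v\<leftarrow>map f V. tr (inprod ?E z v * inprod ?E v z)) = (\<Sum>y\<in>Sigma H G. tr (inprod ?E z (f y) * inprod ?E (f y) z))"
      using V by (simp add: comp_def sum_list_distinct_conv_sum_set)
    also have "\<dots> = (\<Sum>\<xi>\<in>H. \<Sum>g\<in>G \<xi>. tr (inprod ?E z (f (\<xi>, g)) * inprod ?E (f (\<xi>, g)) z))"
      using HH GG by (subst sum.Sigma) (auto simp: case_prod_unfold)
    also have "\<dots> = (\<Sum>\<xi>\<in>H. \<Sum>g\<in>G \<xi>. tr (inprod ?E (lmult ?E b z) (mul p q \<xi> g) * inprod ?E (mul p q \<xi> g) (lmult ?E b z)))"
      by (intro sum.cong refl) (simp add: fz)
    also have "\<dots> \<le> tr (inprod ?E (lmult ?E b z) (lmult ?E b z))"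
      by (rule tr_products_le [OF H G(1) bz])
    also have "\<dots> = 1 * tr (inprod ?E z (lmult ?E (star b * b) z))"
      using Xpq.inprod_lmult_square [OF z, of b] by simp
    finally show "(\<Sum>v\<leftarrow>map f V. tr (inprod ?E z v * inprod ?E v z)) \<le> 1 * tr (inprod ?E z (lmult ?E (star b * b) z))" .
  qed simp
  moreover have "(\<Sum>v\<leftarrow>map f V. tr (inprod ?E v v)) = (\<Sum>\<xi>\<in>H. \<Sum>g\<in>G \<xi>. tr (inprod (X q) g (lmult (X q) (sq b \<xi>) g)))"
  proof -
    have "inprod ?E (f (\<xi>, g)) (f (\<xi>, g)) = inprod (X q) g (lmult (X q) (sq b \<xi>) g)" if "\<xi> \<in> H" "g \<in> G \<xi>" for \<xi> g
    proof -
      have "\<xi> \<in> vecs (X p)" "g \<in> vecs (X q)" using that HH GG by blast+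
      then show ?thesis using p q by (simp add: f_def lmult_mul inprod_mul Xp.lmult_closed)
    qed
    then have "(\<Sum>\<xi>\<in>H. \<Sum>g\<in>G \<xi>. tr (inprod (X q) g (lmult (X q) (sq b \<xi>) g)))
        = (\<Sum>\<xi>\<in>H. \<Sum>g\<in>G \<xi>. tr (inprod ?E (f (\<xi>, g)) (f (\<xi>, g))))" by (intro sum.cong refl) simp
    also have "\<dots> = (\<Sum>y\<in>Sigma H G. tr (inprod ?E (f y) (f y)))"
      using HH GG by (subst sum.Sigma) (auto simp: case_prod_unfold)
    finally show ?thesis using V by (simp add: comp_def sum_list_distinct_conv_sum_set)
  qed
  ultimately have ge: "ereal (\<Sum>\<xi>\<in>H. \<Sum>g\<in>G \<xi>. tr (inprod (X q) g (lmult (X q) (sq b \<xi>) g))) \<le> Tr (p \<otimes> q) (star b * b)"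
    by (simp add: one_ereal_def [symmetric])
  have "(\<Sum>\<xi>\<in>H. Tr q (sq b \<xi>)) \<le> (\<Sum>\<xi>\<in>H. ereal (\<Sum>g\<in>G \<xi>. tr (inprod (X q) g (lmult (X q) (sq b \<xi>) g))) + ereal \<delta>)"
    by (rule sum_mono) (rule G(2))
  also have "\<dots> = ereal (\<Sum>\<xi>\<in>H. \<Sum>g\<in>G \<xi>. tr (inprod (X q) g (lmult (X q) (sq b \<xi>) g))) + ereal (real (card H) * \<delta>)"
    by (simp add: sum.distrib)
  also have "\<dots> \<le> Tr (p \<otimes> q) (star b * b) + ereal e"
    using d by (intro add_mono ge) simp
  finally show "(\<Sum>\<xi>\<in>H. Tr q (sq b \<xi>)) \<le> Tr (p \<otimes> q) (star b * b) + ereal e" .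
qed

end

context traced_product_system
begin

lemma Tr_nonneg: "r \<in> carrier P \<Longrightarrow> 0 \<le> Tr r a"
  using traced_correspondence.induced_trace_nonneg [OF traced] by blast

lemma pair: "p \<in> carrier P \<Longrightarrow> p \<noteq> \<one> \<Longrightarrow> q \<in> carrier P \<Longrightarrow> product_pair P X mul j \<tau> p q"
  by (simp add: product_pair_def product_pair_axioms_def traced_product_system_axioms)

text \<open>
  For \<open>h = j g\<close> the summand is \<open>\<tau>(g\<^sup>* b\<^sup>* b g) = \<tau>(b g g\<^sup>* b\<^sup>*)\<close>, so that the sum over an admissible set measures how much of
  \<open>j b\<^sup>*\<close> is captured by the corresponding finite-rank operator.
\<close>

lemma Tr_one: "Tr \<one> (star b * b) = ereal (tr (star b * b))"
proof -
  interpret X1: traced_correspondence "X \<one>" \<tau> by (rule traced) simp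
  have j: "j a \<in> vecs (X \<one>)" "inprod (X \<one>) (j a) (j a') = star a * a'" for a a'
    using unit_iso by (auto simp: hilbert_module_iso_def self_correspondence_def bij_betw_def)
  have surj: "\<exists>a. h = j a" if "h \<in> vecs (X \<one>)" for h
    using unit_iso that by (auto simp: hilbert_module_iso_def self_correspondence_def bij_betw_def)
  have summand: "tr (inprod (X \<one>) h (lmult (X \<one>) (star b * b) h))
      = tr (inprod (X \<one>) (j (star b)) h * inprod (X \<one>) h (j (star b)))" if h: "h \<in> vecs (X \<one>)" for h
  proof -
    obtain g where "h = j g" using surj [OF h] by blast
    then show ?thesis
      using tr_commute [of "star g * star b" "b * g"] by (simp add: unit_lmult j star_star mult.assoc)
  qed
  have bb: "tr (inprod (X \<one>) (j (star b)) (j (star b))) = tr (star b * b)"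
    by (simp add: j star_star tr_commute)
  show ?thesis
  proof (rule antisym)
    show "Tr \<one> (star b * b) \<le> ereal (tr (star b * b))"
      unfolding X1.induced_trace_eq
    proof (rule SUP_least)
      fix H assume "H \<in> {H. admissible (X \<one>) H}"
      then have H: "admissible (X \<one>) H" "H \<subseteq> vecs (X \<one>)" by (auto simp: admissible_def)
      then have "(\<Sum>h\<in>H. tr (inprod (X \<one>) h (lmult (X \<one>) (star b * b) h)))
        = (\<Sum>h\<in>H. tr (inprod (X \<one>) (j (star b)) h * inprod (X \<one>) h (j (star b))))"
        by (intro sum.cong refl summand) auto
      then show "ereal (\<Sum>h\<in>H. tr (inprod (X \<one>) h (lmult (X \<one>) (star b * b) h))) \<le> ereal (tr (star b * b))"
        using X1.admissible_tr_le [OF H(1) j(1) [of "star b"]] by (simp add: bb)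
    qed
    show "ereal (tr (star b * b)) \<le> Tr \<one> (star b * b)"
    proof (rule ereal_le_epsilon2)
      fix e :: real assume e: "0 < e"
      have F: "finite {j (star b)}" "{j (star b)} \<subseteq> vecs (X \<one>)" using j by auto
      obtain H A' where H: "admissible (X \<one>) H" and A': "remainder (X \<one>) H A'"
        and small: "\<forall>x\<in>{j (star b)}. norm (inprod (X \<one>) (A' x) (A' x)) < e"
        using X1.near_unit_exists [OF F e] by (auto simp: near_unit_def)
      have Hv: "H \<subseteq> vecs (X \<one>)" using H by (simp add: admissible_def)
      define y where "y = A' (j (star b))"
      have "inprod (X \<one>) (j (star b)) (j (star b))
          = (\<Sum>\<xi>\<in>H. inprod (X \<one>) (j (star b)) \<xi> * inprod (X \<one>) \<xi> (j (star b))) + inprod (X \<one>) y y"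
        unfolding y_def by (rule X1.remainder_eq [OF A' j(1) j(1)])
      then have "tr (star b * b)
          = (\<Sum>\<xi>\<in>H. tr (inprod (X \<one>) (j (star b)) \<xi> * inprod (X \<one>) \<xi> (j (star b)))) + tr (inprod (X \<one>) y y)"
        by (metis bb tr_add tr_sum)
      also have "\<dots> \<le> (\<Sum>\<xi>\<in>H. tr (inprod (X \<one>) \<xi> (lmult (X \<one>) (star b * b) \<xi>))) + e"
        using small tr_le_norm [of "inprod (X \<one>) y y"] Hv
        by (intro add_mono sum_mono) (auto simp: summand y_def)
      finally have "ereal (tr (star b * b)) \<le> ereal (\<Sum>\<xi>\<in>H. tr (inprod (X \<one>) \<xi> (lmult (X \<one>) (star b * b) \<xi>))) + ereal e"
        by simp
      also have "\<dots> \<le> Tr \<one> (star b * b) + ereal e"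
        by (intro add_right_mono X1.admissible_le_induced_trace H)
      finally show "ereal (tr (star b * b)) \<le> Tr \<one> (star b * b) + ereal e" .
    qed
  qed
qed

text \<open>
  By \<open>tensor_trace_le\<close> the trace for \<open>p q\<close> is approximated by sums of traces for \<open>q\<close> at the elements
  \<open>\<langle>b\<^sup>* \<xi>, b\<^sup>* \<xi>\<rangle> = \<langle>\<xi>, b b\<^sup>* \<xi>\<rangle>\<close>, and the sum of \<open>\<tau>\<close> over these is at most the trace for \<open>p\<close> at \<open>b b\<^sup>*\<close>.
\<close>

lemma tensor_trace_bounded:
  assumes p: "p \<in> carrier P" "p \<noteq> \<one>" and q: "q \<in> carrier P"
    and C: "0 \<le> C" "\<And>b. Tr q (star b * b) \<le> ereal (C * tr (star b * b))"
    and D: "0 \<le> D" "\<And>b. Tr p (star b * b) \<le> ereal (D * tr (star b * b))"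
  shows "Tr (p \<otimes> q) (star b * b) \<le> ereal (C * D * tr (star b * b))"
proof -
  interpret product_pair P X mul j \<tau> p q by (rule pair [OF p q])
  let ?E = "X (p \<otimes> q)"
  define T where "T = C * D * tr (star b * b)"
  have T: "0 \<le> T" using C D tr_nonneg by (simp add: T_def)
  have sq_le: "(\<Sum>\<xi>\<in>H. Tr q (sq b \<xi>)) \<le> ereal T" if H: "admissible (X p) H" for H
  proof -
    have HH: "finite H" "H \<subseteq> vecs (X p)" using H by (auto simp: admissible_def)
    have "Tr q (sq b \<xi>) \<le> ereal (C * tr (inprod (X p) \<xi> (lmult (X p) (b * star b) \<xi>)))" if "\<xi> \<in> H" for \<xi>
    proof -
      have xi: "\<xi> \<in> vecs (X p)" using that HH by blast
      then obtain c where c: "sq b \<xi> = star c * c"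
        using Xp.inprod_positive [OF Xp.lmult_closed] unfolding positive_elements_def by blast
      have "sq b \<xi> = inprod (X p) \<xi> (lmult (X p) (b * star b) \<xi>)"
        using Xp.inprod_lmult_square [OF xi, of "star b"] by (simp add: star_star)
      then show ?thesis using C(2) [of c] c by simp
    qed
    then have "(\<Sum>\<xi>\<in>H. Tr q (sq b \<xi>)) \<le> (\<Sum>\<xi>\<in>H. ereal (C * tr (inprod (X p) \<xi> (lmult (X p) (b * star b) \<xi>))))"
      by (rule sum_mono)
    also have "\<dots> = ereal C * ereal (\<Sum>\<xi>\<in>H. tr (inprod (X p) \<xi> (lmult (X p) (b * star b) \<xi>)))"
      by (simp add: sum_distrib_left)
    also have "\<dots> \<le> ereal C * Tr p (b * star b)"
      using C by (intro ereal_mult_left_mono Xp.admissible_le_induced_trace H) auto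
    also have "\<dots> \<le> ereal C * ereal (D * tr (b * star b))"
      using D(2) [of "star b"] C by (intro ereal_mult_left_mono) (auto simp: star_star)
    also have "\<dots> = ereal T" by (simp add: T_def tr_commute mult.assoc)
    finally show ?thesis .
  qed
  show ?thesis
    unfolding Xpq.induced_trace_eq T_def [symmetric]
  proof (rule SUP_least)
    fix H' assume "H' \<in> {H. admissible ?E H}"
    then have H': "admissible ?E H'" by simp
    show "ereal (\<Sum>h\<in>H'. tr (inprod ?E h (lmult ?E (star b * b) h))) \<le> ereal T"
    proof (rule ereal_le_epsilon2)
      fix e :: real assume e: "0 < e"
      define \<epsilon> where "\<epsilon> = e / (1 + T)"
      have eps: "\<epsilon> > 0" using e T by (simp add: \<epsilon>_def add_pos_nonneg)
      obtain F \<delta> where F: "finite F" "F \<subseteq> vecs (X p)" "\<delta> > 0"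
        and main: "\<forall>H. near_unit (X p) F \<delta> H \<longrightarrow> ereal (\<Sum>h\<in>H'. tr (inprod ?E h (lmult ?E (star b * b) h)))
            \<le> ereal \<epsilon> + ereal (1 + \<epsilon>) * (\<Sum>\<xi>\<in>H. Tr q (sq b \<xi>))"
        by (rule tensor_trace_le [OF H' eps, of b])
      obtain H where H: "near_unit (X p) F \<delta> H" using Xp.near_unit_exists [OF F] by blast
      have "ereal (\<Sum>h\<in>H'. tr (inprod ?E h (lmult ?E (star b * b) h)))
            \<le> ereal \<epsilon> + ereal (1 + \<epsilon>) * (\<Sum>\<xi>\<in>H. Tr q (sq b \<xi>))"
        by (rule main [rule_format, OF H])
      also have "\<dots> \<le> ereal \<epsilon> + ereal (1 + \<epsilon>) * ereal T"
        using eps by (intro add_left_mono ereal_mult_left_mono sq_le near_unit_admissible [OF H]) auto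
      also have "\<dots> = ereal (T + \<epsilon> * (1 + T))" by (simp add: algebra_simps)
      also have "\<epsilon> * (1 + T) = e" using T by (simp add: \<epsilon>_def)
      finally show "ereal (\<Sum>h\<in>H'. tr (inprod ?E h (lmult ?E (star b * b) h))) \<le> ereal T + ereal e" by simp
    qed
  qed
qed

text \<open>
  The point is that one set \<open>H\<close> serves finitely many \<open>q\<close>: a linear relation between the traces for the indices
  \<open>q\<close> is thereby transported to the indices \<open>p q\<close>, although the induced trace is not linear by definition.
\<close>

lemma tensor_traces_simultaneously:
  assumes p: "p \<in> carrier P" "p \<noteq> \<one>" and Q: "finite Q" "Q \<subseteq> carrier P" and e: "e > 0"
    and fin: "\<And>r a. r \<in> carrier P \<Longrightarrow> a \<in> positive_elements \<Longrightarrow> Tr r a < \<infinity>"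
  obtains H where "finite H" "H \<subseteq> vecs (X p)"
    "\<forall>q\<in>Q. \<bar>real_of_ereal (Tr (p \<otimes> q) (star b * b))
      - (\<Sum>\<xi>\<in>H. real_of_ereal (Tr q (inprod (X p) (lmult (X p) (star b) \<xi>) (lmult (X p) (star b) \<xi>))))\<bar> \<le> e"
proof -
  interpret Xp: traced_correspondence "X p" \<tau> by (rule traced [OF p(1)])
  define sq where "sq \<xi> = inprod (X p) (lmult (X p) (star b) \<xi>) (lmult (X p) (star b) \<xi>)" for \<xi>
  define R where "R q = real_of_ereal (Tr (p \<otimes> q) (star b * b))" for q
  have sqpos: "sq \<xi> \<in> positive_elements" if "\<xi> \<in> vecs (X p)" for \<xi>
    unfolding sq_def using that by (intro Xp.inprod_positive Xp.lmult_closed)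
  have Treal: "Tr r a = ereal (real_of_ereal (Tr r a))" if "r \<in> carrier P" "a \<in> positive_elements" for r a
    using fin [OF that] Tr_nonneg [OF that(1), of a] by (simp add: ereal_real)
  have R0: "0 \<le> R q" if "q \<in> Q" for q
    using Tr_nonneg [of "p \<otimes> q"] p Q that by (auto simp: R_def intro!: real_of_ereal_pos)
  have "\<exists>F \<delta>. finite F \<and> F \<subseteq> vecs (X p) \<and> \<delta> > 0 \<and> (\<forall>H. near_unit (X p) F \<delta> H \<longrightarrow> \<bar>R q - (\<Sum>\<xi>\<in>H. real_of_ereal (Tr q (sq \<xi>)))\<bar> \<le> e)" if qQ: "q \<in> Q" for q
  proof -
    have q: "q \<in> carrier P" using qQ Q by blast
    interpret product_pair P X mul j \<tau> p q by (rule pair [OF p q])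
    let ?E = "X (p \<otimes> q)"
    define \<epsilon> where "\<epsilon> = e / (2 + R q)"
    have eps: "\<epsilon> > 0" using e R0 [OF qQ] by (simp add: \<epsilon>_def add_pos_nonneg)
    have ER: "Tr (p \<otimes> q) (star b * b) = ereal (R q)"
      unfolding R_def by (rule Treal) (use p q in auto)
    have "ereal (R q - \<epsilon>) < Tr (p \<otimes> q) (star b * b)" using eps by (simp add: ER)
    then obtain H' where H': "admissible ?E H'"
      "ereal (R q - \<epsilon>) < ereal (\<Sum>h\<in>H'. tr (inprod ?E h (lmult ?E (star b * b) h)))"
      unfolding Xpq.induced_trace_eq less_SUP_iff by blast
    obtain F \<delta> where F: "finite F" "F \<subseteq> vecs (X p)" "\<delta> > 0"
        and main: "\<forall>H. near_unit (X p) F \<delta> H \<longrightarrow> ereal (\<Sum>h\<in>H'. tr (inprod ?E h (lmult ?E (star b * b) h)))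
            \<le> ereal \<epsilon> + ereal (1 + \<epsilon>) * (\<Sum>\<xi>\<in>H. Tr q (sq \<xi>))"
      unfolding sq_def by (rule tensor_trace_le [OF H'(1) eps, of b])
    have "\<forall>H. near_unit (X p) F \<delta> H \<longrightarrow> \<bar>R q - (\<Sum>\<xi>\<in>H. real_of_ereal (Tr q (sq \<xi>)))\<bar> \<le> e"
    proof (intro allI impI)
      fix H assume near: "near_unit (X p) F \<delta> H"
      then have H: "admissible (X p) H" by (rule near_unit_admissible)
      have HH: "H \<subseteq> vecs (X p)" using H by (auto simp: admissible_def)
      define S where "S = (\<Sum>\<xi>\<in>H. real_of_ereal (Tr q (sq \<xi>)))"
      have ES: "(\<Sum>\<xi>\<in>H. Tr q (sq \<xi>)) = ereal S"
      proof -
        have "(\<Sum>\<xi>\<in>H. Tr q (sq \<xi>)) = (\<Sum>\<xi>\<in>H. ereal (real_of_ereal (Tr q (sq \<xi>))))"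
          by (intro sum.cong refl Treal q sqpos) (use HH in auto)
        then show ?thesis by (simp add: S_def)
      qed
      have "ereal S \<le> ereal (R q)"
        unfolding ES [symmetric] ER [symmetric] sq_def
        using fin [OF q sqpos] HH by (intro tensor_trace_ge H) (auto simp: sq_def)
      then have le: "S \<le> R q" by simp
      have "ereal (R q - \<epsilon>) \<le> ereal (\<Sum>h\<in>H'. tr (inprod ?E h (lmult ?E (star b * b) h)))"
        using H'(2) by simp
      also have "\<dots> \<le> ereal \<epsilon> + ereal (1 + \<epsilon>) * (\<Sum>\<xi>\<in>H. Tr q (sq \<xi>))"
        by (rule main [rule_format, OF near])
      finally have "R q - \<epsilon> \<le> \<epsilon> + (1 + \<epsilon>) * S" by (simp add: ES)
      moreover have "\<epsilon> * S \<le> \<epsilon> * R q" using le eps by (intro mult_left_mono) auto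
      ultimately have "R q - S \<le> \<epsilon> * (2 + R q)" by (simp add: algebra_simps)
      also have "\<epsilon> * (2 + R q) = e" using R0 [OF qQ] by (simp add: \<epsilon>_def)
      finally show "\<bar>R q - (\<Sum>\<xi>\<in>H. real_of_ereal (Tr q (sq \<xi>)))\<bar> \<le> e" using le by (simp add: S_def [symmetric])
    qed
    then show ?thesis by (intro exI [of _ F] exI [of _ \<delta>] conjI F)
  qed
  then have "\<forall>q\<in>Q. \<exists>F \<delta>. finite (F) \<and> F \<subseteq> vecs (X p) \<and> \<delta> > 0 \<and> (\<forall>H. near_unit (X p) F \<delta> H \<longrightarrow> \<bar>R q - (\<Sum>\<xi>\<in>H. real_of_ereal (Tr q (sq \<xi>)))\<bar> \<le> e)"
    by blast
  from bchoice [OF this] obtain F where "\<forall>q\<in>Q. \<exists>\<delta>. finite (F q) \<and> F q \<subseteq> vecs (X p) \<and> \<delta> > 0 \<and> (\<forall>H. near_unit (X p) (F q) \<delta> H \<longrightarrow> \<bar>R q - (\<Sum>\<xi>\<in>H. real_of_ereal (Tr q (sq \<xi>)))\<bar> \<le> e)" ..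
  from bchoice [OF this] obtain \<delta> where *: "\<forall>q\<in>Q. finite (F q) \<and> F q \<subseteq> vecs (X p) \<and> \<delta> q > 0 \<and> (\<forall>H. near_unit (X p) (F q) (\<delta> q) H \<longrightarrow> \<bar>R q - (\<Sum>\<xi>\<in>H. real_of_ereal (Tr q (sq \<xi>)))\<bar> \<le> e)" ..
  have F: "finite (F q) \<and> F q \<subseteq> vecs (X p) \<and> \<delta> q > 0" if "q \<in> Q" for q using * that by blast
  define \<delta>' where "\<delta>' = Min (insert 1 (\<delta> ` Q))"
  have d: "\<delta>' > 0" "\<And>q. q \<in> Q \<Longrightarrow> \<delta>' \<le> \<delta> q" using F Q by (auto simp: \<delta>'_def)
  have UF: "finite (\<Union>q\<in>Q. F q)" "(\<Union>q\<in>Q. F q) \<subseteq> vecs (X p)" using F Q by auto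
  obtain H where H: "near_unit (X p) (\<Union>q\<in>Q. F q) \<delta>' H" using Xp.near_unit_exists [OF UF d(1)] by blast
  have "\<bar>R q - (\<Sum>\<xi>\<in>H. real_of_ereal (Tr q (sq \<xi>)))\<bar> \<le> e" if "q \<in> Q" for q
  proof -
    have "near_unit (X p) (F q) (\<delta> q) H" using near_unit_mono [OF H _ d(2) [OF that]] that by blast
    then show ?thesis using * that by blast
  qed
  then show thesis using that [of H] admissibleD [OF near_unit_admissible [OF H]] by (simp add: R_def sq_def)
qed

end

section \<open>Alternating sums over intersections\<close>

text \<open>
  \<open>altsum f I [A\<^sub>1, \<dots>, A\<^sub>n]\<close> is the sum of \<open>(-1)\<^bsup>|K|\<^esup> f (I \<inter> \<Inter>\<^bsub>k\<in>K\<^esub> A\<^sub>k)\<close> over all sets \<open>K\<close> of positions. Working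
  with the ideals instead of their generators makes joins associative for free, and the empty
  ideal plays the role of \<open>\<infinity>\<close>.
\<close>

primrec altsum :: "('b set \<Rightarrow> real) \<Rightarrow> 'b set \<Rightarrow> 'b set list \<Rightarrow> real" where
  "altsum f I [] = f I"
| "altsum f I (A # As) = altsum f I As - altsum f (I \<inter> A) As"

lemma altsum_move: "altsum f I (As @ B # Bs) = altsum f I (B # As @ Bs)"
  by (induction As arbitrary: I) (simp_all add: Int_ac)

lemma altsum_absorb: "A \<in> set As \<Longrightarrow> I \<subseteq> A \<Longrightarrow> altsum f I As = 0"
proof (induction As arbitrary: I)
  case (Cons B Bs)
  show ?case
  proof (cases "B = A")
    case True
    then have "I \<inter> B = I" using Cons.prems by blast
    then show ?thesis by simp
  next
    case False
    then have "altsum f I Bs = 0" "altsum f (I \<inter> B) Bs = 0" using Cons by (auto intro!: Cons.IH)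
    then show ?thesis by simp
  qed
qed simp

lemma altsum_empty: "f {} = 0 \<Longrightarrow> altsum f {} As = 0"
  by (induction As) simp_all

text \<open>
  A term that omits a repeated set cancels against the one that includes it; a term with an empty
  intersection vanishes.
\<close>

lemma altsum_reduce:
  assumes "f {} = 0"
  shows "altsum f I As = altsum f I (remdups (filter (\<lambda>A. A \<noteq> {}) As))"
proof (induction As arbitrary: I)
  case (Cons A As)
  show ?case
  proof (cases "A \<noteq> {} \<and> A \<notin> set As")
    case True
    then have "A \<notin> set (filter (\<lambda>A. A \<noteq> {}) As)" by simp
    then show ?thesis using True Cons by simp
  next
    case False
    have "altsum f (I \<inter> A) As = 0"
      using False altsum_absorb [of A As "I \<inter> A"] altsum_empty [of f As, OF assms] by auto
    then show ?thesis using False Cons by simp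
  qed
qed simp

lemma altsum_eq_sum:
  assumes "distinct us"
  shows "altsum f I (map h us) = (\<Sum>K\<in>Pow (set us). (- 1) ^ card K * f (I \<inter> (\<Inter>k\<in>K. h k)))"
  using assms
proof (induction us arbitrary: I)
  case (Cons u us)
  have u: "u \<notin> set us" using Cons.prems by simp
  have "(\<Sum>K\<in>Pow (set (u # us)). (- 1) ^ card K * f (I \<inter> (\<Inter>k\<in>K. h k)))
     = (\<Sum>K\<in>Pow (set us). (- 1) ^ card K * f (I \<inter> (\<Inter>k\<in>K. h k)))
       + (\<Sum>K\<in>insert u ` Pow (set us). (- 1) ^ card K * f (I \<inter> (\<Inter>k\<in>K. h k)))"
    using u by (subst sum.union_disjoint [symmetric]) (auto simp: Pow_insert)
  also have "(\<Sum>K\<in>insert u ` Pow (set us). (- 1) ^ card K * f (I \<inter> (\<Inter>k\<in>K. h k)))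
      = (\<Sum>K\<in>Pow (set us). (- 1) ^ card (insert u K) * f (I \<inter> (\<Inter>k\<in>insert u K. h k)))"
    using u by (subst sum.reindex) (auto simp: inj_on_def intro: insert_ident)
  also have "\<dots> = (\<Sum>K\<in>Pow (set us). - ((- 1) ^ card K * f ((I \<inter> h u) \<inter> (\<Inter>k\<in>K. h k))))"
  proof (rule sum.cong [OF refl])
    fix K assume "K \<in> Pow (set us)"
    then have "u \<notin> K" "finite K" using u finite_subset by auto
    then show "(- 1) ^ card (insert u K) * f (I \<inter> (\<Inter>k\<in>insert u K. h k)) = - ((- 1) ^ card K * f ((I \<inter> h u) \<inter> (\<Inter>k\<in>K. h k)))"
      by (simp add: Int_assoc)
  qed
  finally show ?case using Cons by (simp add: sum_negf)
qed simp

lemma altsum_scale: "altsum (\<lambda>I. c * f I) I As = c * altsum f I As"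
  by (induction As arbitrary: I) (simp_all add: right_diff_distrib)

lemma altsum_sum: "altsum (\<lambda>I. \<Sum>x\<in>H. f x I) I As = (\<Sum>x\<in>H. altsum (f x) I As)"
  by (induction As arbitrary: I) (simp_all add: sum_subtractf)

primrec meets :: "'b set \<Rightarrow> 'b set list \<Rightarrow> 'b set set" where
  "meets I [] = {I}"
| "meets I (A # As) = meets I As \<union> meets (I \<inter> A) As"

lemma finite_meets: "finite (meets I As)"
  by (induction As arbitrary: I) simp_all

lemma altsum_close:
  assumes "\<And>J. J \<in> meets I As \<Longrightarrow> \<bar>f J - g J\<bar> \<le> e"
  shows "\<bar>altsum f I As - altsum g I As\<bar> \<le> 2 ^ length As * e"
  using assms
proof (induction As arbitrary: I)
  case (Cons A As)
  have "\<bar>altsum f I As - altsum g I As\<bar> \<le> 2 ^ length As * e"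
    "\<bar>altsum f (I \<inter> A) As - altsum g (I \<inter> A) As\<bar> \<le> 2 ^ length As * e"
    using Cons by auto
  then show ?case by simp
qed simp

section \<open>Graded monoids with joins\<close>

text \<open>
  The properties of a right-angled Artin monoid on which the argument depends. The decisive one is the bound
  \<open>len y \<le> len x\<close>: passing from \<open>x\<close> to \<open>g\<^sup>-\<^sup>1 (g \<or> x)\<close> does not increase the length.
\<close>

locale graded_join_monoid = monoid P
  for P :: "('p, 'k) monoid_scheme" (structure) +
  fixes G :: "'p set" and len :: "'p \<Rightarrow> nat"
  assumes len_mult: "x \<in> carrier P \<Longrightarrow> y \<in> carrier P \<Longrightarrow> len (x \<otimes> y) = len x + len y"
    and len_zero: "x \<in> carrier P \<Longrightarrow> len x = 0 \<Longrightarrow> x = \<one>"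
    and generators: "G = {x \<in> carrier P. len x = 1}"
    and first_generator: "x \<in> carrier P \<Longrightarrow> x \<noteq> \<one> \<Longrightarrow> \<exists>g\<in>G. \<exists>y\<in>carrier P. x = g \<otimes> y"
    and generator_cancel: "g \<in> G \<Longrightarrow> x \<in> carrier P \<Longrightarrow> y \<in> carrier P \<Longrightarrow> g \<otimes> x = g \<otimes> y \<Longrightarrow> x = y"
    and generator_join: "g \<in> G \<Longrightarrow> x \<in> carrier P \<Longrightarrow>
      (g <# carrier P) \<inter> (x <# carrier P) = {} \<or>
      (\<exists>y\<in>carrier P. (g <# carrier P) \<inter> (x <# carrier P) = (g \<otimes> y) <# carrier P \<and> len y \<le> len x)"
begin

abbreviation ideal :: "'p \<Rightarrow> 'p set" where "ideal x \<equiv> x <# carrier P"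

definition principal :: "'p set \<Rightarrow> bool"
  where "principal I \<longleftrightarrow> I = {} \<or> (\<exists>r\<in>carrier P. I = ideal r)"

definition generator_of :: "'p set \<Rightarrow> 'p"
  where "generator_of I = (THE r. r \<in> carrier P \<and> I = ideal r)"

lemma coset_iff: "z \<in> x <# A \<longleftrightarrow> (\<exists>h\<in>A. z = x \<otimes> h)"
  by (auto simp: l_coset_def)

lemma G_carrier: "g \<in> G \<Longrightarrow> g \<in> carrier P"
  by (simp add: generators)

lemma len_one [simp]: "len \<one> = 0"
  using len_mult [of \<one> \<one>] by simp

lemma G_not_one: "g \<in> G \<Longrightarrow> g \<noteq> \<one>"
  by (auto simp: generators)

lemma mult_eq_one_iff: "x \<in> carrier P \<Longrightarrow> y \<in> carrier P \<Longrightarrow> x \<otimes> y = \<one> \<Longrightarrow> x = \<one> \<and> y = \<one>"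
proof -
  assume xy: "x \<in> carrier P" "y \<in> carrier P" "x \<otimes> y = \<one>"
  then have "len x + len y = 0" using len_mult [of x y] by (simp only: len_one)
  then have "len x = 0" "len y = 0" by simp_all
  then show ?thesis using len_zero xy(1,2) by blast
qed

lemma left_cancel:
  assumes "p \<in> carrier P" "x \<in> carrier P" "y \<in> carrier P" "p \<otimes> x = p \<otimes> y"
  shows "x = y"
  using assms
proof (induction "len p" arbitrary: p x y)
  case 0
  then have "p = \<one>" using len_zero by simp
  then show ?case using 0 by simp
next
  case (Suc n)
  then have "p \<noteq> \<one>" by auto
  then obtain g r where g: "g \<in> G" and r: "r \<in> carrier P" and p: "p = g \<otimes> r"
    using first_generator Suc.prems by blast
  have gc: "g \<in> carrier P" "len g = 1" using g by (simp_all add: generators)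
  have "g \<otimes> (r \<otimes> x) = g \<otimes> (r \<otimes> y)" using Suc.prems gc r p by (simp add: m_assoc)
  then have "r \<otimes> x = r \<otimes> y" using generator_cancel [OF g] r Suc.prems by blast
  moreover have "n = len r" using Suc.hyps(2) gc r p by (simp add: len_mult)
  ultimately show ?case using Suc.hyps(1) [OF _ r] Suc.prems by blast
qed

lemma ideal_subset: "x \<in> carrier P \<Longrightarrow> ideal x \<subseteq> carrier P"
  by (auto simp: coset_iff)

lemma ideal_self: "x \<in> carrier P \<Longrightarrow> x \<in> ideal x"
  by (auto simp: coset_iff intro: bexI [of _ \<one>])

lemma ideal_one: "ideal \<one> = carrier P"
  by (auto simp: coset_iff)

lemma coset_mem: "h \<in> A \<Longrightarrow> x \<otimes> h \<in> x <# A"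
  by (auto simp: coset_iff)

lemma ideal_mult:
  assumes "p \<in> carrier P" "x \<in> carrier P"
  shows "p <# ideal x = ideal (p \<otimes> x)"
proof (intro equalityI subsetI)
  fix z assume "z \<in> p <# ideal x"
  then obtain h where "h \<in> carrier P" "z = p \<otimes> (x \<otimes> h)" by (auto simp: coset_iff)
  then show "z \<in> ideal (p \<otimes> x)" using assms coset_mem [of h "carrier P" "p \<otimes> x"] by (simp add: m_assoc)
next
  fix z assume "z \<in> ideal (p \<otimes> x)"
  then obtain h where "h \<in> carrier P" "z = p \<otimes> x \<otimes> h" by (auto simp: coset_iff)
  then show "z \<in> p <# ideal x" using assms coset_mem [OF coset_mem, of h "carrier P" p x] by (simp add: m_assoc)
qed

lemma ideal_mult_subset: "x \<in> carrier P \<Longrightarrow> y \<in> carrier P \<Longrightarrow> ideal (x \<otimes> y) \<subseteq> ideal x"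
proof
  fix z assume xy: "x \<in> carrier P" "y \<in> carrier P" and "z \<in> ideal (x \<otimes> y)"
  then obtain h where "h \<in> carrier P" "z = x \<otimes> y \<otimes> h" by (auto simp: coset_iff)
  then show "z \<in> ideal x" using xy coset_mem [of "y \<otimes> h" "carrier P" x] by (simp add: m_assoc)
qed

lemma coset_Int:
  assumes p: "p \<in> carrier P" and A: "A \<subseteq> carrier P" and B: "B \<subseteq> carrier P"
  shows "p <# (A \<inter> B) = (p <# A) \<inter> (p <# B)"
proof (intro equalityI subsetI)
  fix z assume "z \<in> (p <# A) \<inter> (p <# B)"
  then obtain a b where ab: "a \<in> A" "b \<in> B" "z = p \<otimes> a" "z = p \<otimes> b" by (auto simp: coset_iff)
  then have "a = b" using left_cancel [OF p, of a b] A B by auto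
  then show "z \<in> p <# (A \<inter> B)" using ab coset_mem by auto
qed (auto simp: coset_iff)

lemma ideal_inject:
  assumes x: "x \<in> carrier P" and y: "y \<in> carrier P" and eq: "ideal x = ideal y"
  shows "x = y"
proof -
  have "x \<in> ideal y" "y \<in> ideal x" using ideal_self [OF x] ideal_self [OF y] eq by simp_all
  then obtain h k where h: "h \<in> carrier P" "x = y \<otimes> h" and k: "k \<in> carrier P" "y = x \<otimes> k"
    unfolding coset_iff by blast
  have "len x = len y + len h" "len y = len x + len k" using h k x y len_mult by metis+
  then have "h = \<one>" using len_zero h by simp
  then show ?thesis using h y by simp
qed

lemma generator_of_ideal: "r \<in> carrier P \<Longrightarrow> generator_of (ideal r) = r"
  unfolding generator_of_def by (rule the_equality) (auto dest: ideal_inject)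

text \<open>
  For \<open>x = g r\<close> and \<open>g \<or> y = g z\<close> the intersection of \<open>xP\<close> and \<open>yP\<close> is \<open>g (rP \<inter> zP)\<close>, which is an
  induction on the length of \<open>x\<close>.
\<close>

lemma ideal_Int:
  assumes "x \<in> carrier P" "y \<in> carrier P"
  shows "principal (ideal x \<inter> ideal y)"
  using assms
proof (induction "len x" arbitrary: x y)
  case 0
  then have "x = \<one>" using len_zero by simp
  then have "ideal x \<inter> ideal y = ideal y" using ideal_subset 0 by (auto simp: ideal_one)
  then show ?case using 0 by (auto simp: principal_def)
next
  case (Suc n)
  then have "x \<noteq> \<one>" by auto
  then obtain g r where g: "g \<in> G" and r: "r \<in> carrier P" and x: "x = g \<otimes> r"
    using first_generator Suc.prems by blast
  have gc: "g \<in> carrier P" "len g = 1" using g by (simp_all add: generators)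
  have "ideal x \<subseteq> ideal g" using ideal_mult_subset gc r x by blast
  then have *: "ideal x \<inter> ideal y = ideal x \<inter> (ideal g \<inter> ideal y)" by blast
  from generator_join [OF g Suc.prems(2)] show ?case
  proof
    assume "ideal g \<inter> ideal y = {}" then show ?thesis using * by (simp add: principal_def)
  next
    assume "\<exists>z\<in>carrier P. ideal g \<inter> ideal y = ideal (g \<otimes> z) \<and> len z \<le> len y"
    then obtain z where z: "z \<in> carrier P" "ideal g \<inter> ideal y = ideal (g \<otimes> z)" by blast
    have "ideal x \<inter> ideal y = (g <# ideal r) \<inter> (g <# ideal z)"
      using * z gc r x by (simp add: ideal_mult)
    also have "\<dots> = g <# (ideal r \<inter> ideal z)"
      using gc r z by (simp add: coset_Int ideal_subset)
    finally have eq: "ideal x \<inter> ideal y = g <# (ideal r \<inter> ideal z)" .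
    have "n = len r" using Suc.hyps(2) gc r x by (simp add: len_mult)
    then have "principal (ideal r \<inter> ideal z)" using Suc.hyps(1) r z by blast
    then show ?thesis
      unfolding eq principal_def using gc by (auto simp: ideal_mult) (auto simp: coset_iff)
  qed
qed

lemma principal_ideal: "x \<in> carrier P \<Longrightarrow> principal (ideal x)"
  by (auto simp: principal_def)

lemma principal_Int: "principal I \<Longrightarrow> principal J \<Longrightarrow> principal (I \<inter> J)"
  using ideal_Int by (auto simp: principal_def)

lemma principal_subset: "principal I \<Longrightarrow> I \<subseteq> carrier P"
  using ideal_subset by (auto simp: principal_def)

lemma principal_INT:
  assumes "finite K" "K \<noteq> {}" "K \<subseteq> carrier P"
  shows "principal (\<Inter>k\<in>K. ideal k)"
  using assms
proof (induction K rule: finite_ne_induct)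
  case (singleton x) then show ?case by (simp add: principal_ideal)
next
  case (insert x F) then show ?case by (simp add: principal_ideal principal_Int)
qed

lemma principal_meets:
  "principal I \<Longrightarrow> (\<And>A. A \<in> set As \<Longrightarrow> principal A) \<Longrightarrow> J \<in> meets I As \<Longrightarrow> principal J"
proof (induction As arbitrary: I)
  case (Cons A As)
  then have "principal (I \<inter> A)" using principal_Int by simp
  then show ?case using Cons by auto
qed simp

lemma join_eq:
  "join P K = (if (\<Inter>k\<in>K. ideal k) = {} then None else Some (generator_of (\<Inter>k\<in>K. ideal k)))"
  by (simp add: join_def generator_of_def Let_def)

lemma left_quotient_mult: "p \<in> carrier P \<Longrightarrow> x \<in> carrier P \<Longrightarrow> left_quotient P p (p \<otimes> x) = x"
  unfolding left_quotient_def by (rule the_equality) (auto dest: left_cancel)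

section \<open>The tree of a list\<close>

primrec ideal_opt :: "'p option \<Rightarrow> 'p set" where
  "ideal_opt None = {}"
| "ideal_opt (Some r) = ideal r"

primrec len_opt :: "'p option \<Rightarrow> nat" where
  "len_opt None = 0"
| "len_opt (Some r) = len r"

definition quotient_opt :: "'p \<Rightarrow> 'p option \<Rightarrow> 'p option"
  where "quotient_opt p x = (case x of None \<Rightarrow> None | Some r \<Rightarrow> map_option (left_quotient P p) (join P {p, r}))"

abbreviation entries :: "'p option set" where "entries \<equiv> insert None (Some ` carrier P)"

definition weight :: "'p option list \<Rightarrow> nat" where "weight xs = sum_list (map len_opt xs)"

lemma right_child_eq: "right_child P p xs = map (quotient_opt p) xs"
  by (simp add: right_child_def quotient_opt_def)

lemma principal_ideal_opt: "x \<in> entries \<Longrightarrow> principal (ideal_opt x)"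
  by (auto simp: principal_def)

lemma quotient_opt:
  assumes g: "g \<in> G" and x: "x \<in> entries"
  shows "quotient_opt g x \<in> entries" "g <# ideal_opt (quotient_opt g x) = ideal g \<inter> ideal_opt x"
    "len_opt (quotient_opt g x) \<le> len_opt x"
proof -
  have gc: "g \<in> carrier P" using g by (rule G_carrier)
  have "quotient_opt g x \<in> entries \<and> g <# ideal_opt (quotient_opt g x) = ideal g \<inter> ideal_opt x
    \<and> len_opt (quotient_opt g x) \<le> len_opt x"
  proof (cases x)
    case None then show ?thesis by (simp add: quotient_opt_def l_coset_def)
  next
    case (Some r)
    then have r: "r \<in> carrier P" using x by auto
    have j: "join P {g, r} = (if ideal g \<inter> ideal r = {} then None else Some (generator_of (ideal g \<inter> ideal r)))"
      using join_eq [of "{g, r}"] ideal_Int [OF gc r] by simp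
    from generator_join [OF g r] show ?thesis
    proof
      assume "ideal g \<inter> ideal r = {}" then show ?thesis using j Some by (simp add: quotient_opt_def l_coset_def)
    next
      assume "\<exists>y\<in>carrier P. ideal g \<inter> ideal r = ideal (g \<otimes> y) \<and> len y \<le> len r"
      then obtain y where y: "y \<in> carrier P" "ideal g \<inter> ideal r = ideal (g \<otimes> y)" "len y \<le> len r" by blast
      have "ideal (g \<otimes> y) \<noteq> {}" using ideal_self gc y(1) by blast
      then have "quotient_opt g x = Some y"
        using j y gc Some by (simp add: quotient_opt_def generator_of_ideal left_quotient_mult)
      then show ?thesis using y gc Some by (simp add: ideal_mult)
    qed
  qed
  then show "quotient_opt g x \<in> entries" "g <# ideal_opt (quotient_opt g x) = ideal g \<inter> ideal_opt x"
    "len_opt (quotient_opt g x) \<le> len_opt x" by auto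
qed

lemma quotient_opt_mult:
  assumes g: "g \<in> G" and q: "q \<in> carrier P"
  shows "quotient_opt g (Some (g \<otimes> q)) = Some q"
proof -
  have gc: "g \<in> carrier P" using g by (rule G_carrier)
  have "ideal g \<inter> ideal (g \<otimes> q) = ideal (g \<otimes> q)" using ideal_mult_subset gc q by blast
  moreover have "ideal (g \<otimes> q) \<noteq> {}" using ideal_self gc q by blast
  ultimately show ?thesis
    using join_eq [of "{g, g \<otimes> q}"] ideal_Int [OF gc, of "g \<otimes> q"] gc q
    by (simp add: quotient_opt_def generator_of_ideal left_quotient_mult)
qed

lemma split_index_works:
  assumes xs: "set xs \<subseteq> entries" and "\<not> is_leaf P G xs"
  shows "split_index P xs < length xs"
    "\<exists>g\<in>G. \<exists>q\<in>carrier P - {\<one>}. xs ! split_index P xs = Some (g \<otimes> q)"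
proof -
  define Q where "Q i \<longleftrightarrow> i < length xs \<and>
    (\<exists>p\<in>carrier P - {\<one>}. \<exists>q\<in>carrier P - {\<one>}. xs ! i = Some (p \<otimes> q))" for i
  obtain x where x: "x \<in> set xs" "x \<notin> insert None (Some ` G)" "Some \<one> \<notin> set xs"
    using assms(2) unfolding is_leaf_def by blast
  then obtain r where r: "x = Some r" "r \<in> carrier P" "r \<notin> G" "r \<noteq> \<one>" using xs by auto
  obtain g y where g: "g \<in> G" "y \<in> carrier P" "r = g \<otimes> y" using first_generator r by blast
  then have "y \<noteq> \<one>" "g \<in> carrier P" "g \<noteq> \<one>" using r G_carrier G_not_one by auto
  moreover obtain i where "i < length xs" "xs ! i = x" using x(1) by (auto simp: in_set_conv_nth)
  ultimately have "Q i" unfolding Q_def using g r by blast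
  then have Q: "Q (split_index P xs)"
    unfolding split_index_def Q_def [symmetric] by (rule LeastI)
  then show "split_index P xs < length xs" by (simp add: Q_def)
  obtain p q where pq: "p \<in> carrier P" "p \<noteq> \<one>" "q \<in> carrier P" "q \<noteq> \<one>" "xs ! split_index P xs = Some (p \<otimes> q)"
    using Q by (auto simp: Q_def)
  obtain g y where g: "g \<in> G" "y \<in> carrier P" "p = g \<otimes> y" using first_generator pq by blast
  have "p \<otimes> q = g \<otimes> (y \<otimes> q)" using g pq G_carrier by (simp add: m_assoc)
  moreover have "y \<otimes> q \<noteq> \<one>" using mult_eq_one_iff g pq by blast
  ultimately show "\<exists>g\<in>G. \<exists>q\<in>carrier P - {\<one>}. xs ! split_index P xs = Some (g \<otimes> q)"
    using g pq by (metis Diff_iff m_closed singletonD)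
qed

lemma weight_children:
  assumes xs: "set xs \<subseteq> entries" and i: "split_index P xs < length xs"
    and g: "g \<in> G" and q: "q \<in> carrier P" "q \<noteq> \<one>" and eq: "xs ! split_index P xs = Some (g \<otimes> q)"
  shows "set (left_child P g xs) \<subseteq> entries" "set (right_child P g xs) \<subseteq> entries"
    "weight (left_child P g xs) < weight xs" "weight (right_child P g xs) < weight xs"
proof -
  let ?i = "split_index P xs"
  have gc: "g \<in> carrier P" "len g = 1" using g by (simp_all add: generators)
  have lq: "len q > 0" using len_zero q by blast
  show "set (left_child P g xs) \<subseteq> entries"
    using set_update_subset_insert [of xs ?i "Some g"] xs gc by (auto simp: left_child_def)
  show "set (right_child P g xs) \<subseteq> entries"
    unfolding right_child_eq set_map by (rule image_subsetI) (rule quotient_opt(1) [OF g subsetD [OF xs]])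
  define ys zs where "ys = take (split_index P xs) xs" and "zs = drop (Suc (split_index P xs)) xs"
  then have d: "xs = ys @ Some (g \<otimes> q) # zs" "length ys = split_index P xs"
    using id_take_nth_drop [OF i] eq i by simp_all
  have "weight (left_child P g xs) = sum_list (map len_opt ys) + (1 + sum_list (map len_opt zs))"
    using gc by (simp add: left_child_def weight_def list_update_append d(2) [symmetric]) (simp add: d(1) list_update_append)
  then show "weight (left_child P g xs) < weight xs" using lq gc q by (simp add: weight_def d(1) len_mult)
  have le: "sum_list (map len_opt (map (quotient_opt g) us)) \<le> sum_list (map len_opt us)" if "set us \<subseteq> entries" for us
    unfolding map_map by (rule sum_list_mono) (use quotient_opt(3) [OF g] that in auto)
  have "weight (right_child P g xs) = sum_list (map len_opt (map (quotient_opt g) ys)) + (len q + sum_list (map len_opt (map (quotient_opt g) zs)))"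
    unfolding right_child_eq weight_def d(1) using quotient_opt_mult [OF g q(1)] by simp
  then show "weight (right_child P g xs) < weight xs"
    using le [of ys] le [of zs] xs gc q by (simp add: weight_def d(1) len_mult)
qed

lemma choice_splits:
  assumes "splitting_choice P G ch" "set xs \<subseteq> entries" "\<not> is_leaf P G xs"
  obtains q where "ch \<omega> xs \<in> G" "q \<in> carrier P" "q \<noteq> \<one>" "xs ! split_index P xs = Some (ch \<omega> xs \<otimes> q)"
  using assms unfolding splitting_choice_def by blast

text \<open>
  The sum of the lengths of the entries, with \<open>\<infinity>\<close> counted as zero, decreases from each node to both of its
  children: the split entry becomes shorter, and no other entry becomes longer.
\<close>

lemma node_bound:
  assumes ch: "splitting_choice P G ch" and init: "set init \<subseteq> entries"
    and node: "(\<omega>, xs) \<in> tree_nodes P G ch init"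
  shows "set xs \<subseteq> entries \<and> set \<omega> \<subseteq> {1, 2} \<and> length \<omega> + weight xs \<le> weight init"
  using node
proof (induction rule: tree_nodes.induct)
  case root then show ?case using assms(2) by simp
next
  case (left \<omega> xs)
  then obtain q where "ch \<omega> xs \<in> G" "q \<in> carrier P" "q \<noteq> \<one>" "xs ! split_index P xs = Some (ch \<omega> xs \<otimes> q)"
    using choice_splits [OF ch] by metis
  then show ?case using left weight_children [of xs "ch \<omega> xs" q] split_index_works(1) [of xs] by auto
next
  case (right \<omega> xs)
  then obtain q where "ch \<omega> xs \<in> G" "q \<in> carrier P" "q \<noteq> \<one>" "xs ! split_index P xs = Some (ch \<omega> xs \<otimes> q)"
    using choice_splits [OF ch] by metis
  then show ?case using right weight_children [of xs "ch \<omega> xs" q] split_index_works(1) [of xs] by auto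
qed

lemma node_label_unique:
  assumes "(\<omega>, xs) \<in> tree_nodes P G ch init" "(\<omega>, ys) \<in> tree_nodes P G ch init"
  shows "xs = ys"
  using assms
proof (induction arbitrary: ys rule: tree_nodes.induct)
  case root
  from root.prems show ?case by (cases rule: tree_nodes.cases) auto
next
  case (left \<omega> xs)
  from left.prems show ?case by (cases rule: tree_nodes.cases) (use left.IH in auto)
next
  case (right \<omega> xs)
  from right.prems show ?case by (cases rule: tree_nodes.cases) (use right.IH in auto)
qed

theorem finite_tree:
  assumes ch: "splitting_choice P G ch" and init: "set init \<subseteq> entries"
  shows "finite (tree_nodes P G ch init)"
proof (rule finite_imageD)
  show "inj_on fst (tree_nodes P G ch init)"
    using node_label_unique by (fastforce intro!: inj_onI)
  have "fst ` tree_nodes P G ch init \<subseteq> {\<omega>. set \<omega> \<subseteq> {1, 2} \<and> length \<omega> \<le> weight init}"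
    using node_bound [OF ch init] by fastforce
  then show "finite (fst ` tree_nodes P G ch init)"
    by (rule finite_subset) (rule finite_lists_length_le, simp)
qed

text \<open>Multiplication by \<open>g\<close> maps the ideal of \<open>g\<^sup>-\<^sup>1 (g \<or> x)\<close> onto that of \<open>g \<or> x\<close>, and it preserves intersections.\<close>

lemma altsum_shift:
  assumes g: "g \<in> G" and xs: "set xs \<subseteq> entries" and I: "I \<subseteq> carrier P"
  shows "altsum f (g <# I) (map ideal_opt xs) = altsum (\<lambda>I. f (g <# I)) I (map ideal_opt (map (quotient_opt g) xs))"
  using xs I
proof (induction xs arbitrary: I)
  case (Cons x xs)
  have x: "x \<in> entries" using Cons.prems by simp
  have gc: "g \<in> carrier P" using g by (rule G_carrier)
  have sub: "ideal_opt (quotient_opt g x) \<subseteq> carrier P"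
    using principal_subset principal_ideal_opt quotient_opt(1) [OF g x] by blast
  have "g <# I \<subseteq> ideal g" using Cons.prems(2) unfolding l_coset_def by blast
  then have "(g <# I) \<inter> ideal_opt x = (g <# I) \<inter> (ideal g \<inter> ideal_opt x)" by blast
  also have "\<dots> = g <# (I \<inter> ideal_opt (quotient_opt g x))"
    using coset_Int [OF gc _ sub] Cons.prems quotient_opt(2) [OF g x] by simp
  finally show ?case using Cons by (simp add: le_infI1)
qed simp

text \<open>
  The identity behind the tree: replacing the entry \<open>g q\<close> by \<open>g\<close> changes exactly those terms that contain it, and
  the difference consists of joins of \<open>g\<close> with the other entries, that is, of \<open>g\<close> times
  the joins of the list \<open>\<lambda>\<^sub>2\<close>.
\<close>

lemma altsum_split:
  assumes xs: "set xs \<subseteq> entries" and i: "split_index P xs < length xs"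
    and g: "g \<in> G" and q: "q \<in> carrier P" and eq: "xs ! split_index P xs = Some (g \<otimes> q)"
  shows "altsum f (carrier P) (map ideal_opt xs) = altsum f (carrier P) (map ideal_opt (left_child P g xs))
    + altsum (\<lambda>I. f (g <# I)) (carrier P) (map ideal_opt (right_child P g xs))"
proof -
  have gc: "g \<in> carrier P" using g by (rule G_carrier)
  define ys zs where "ys = take (split_index P xs) xs" and "zs = drop (Suc (split_index P xs)) xs"
  then have d: "xs = ys @ Some (g \<otimes> q) # zs" "length ys = split_index P xs"
    using id_take_nth_drop [OF i] eq i by simp_all
  have left: "left_child P g xs = ys @ Some g # zs"
    by (simp add: left_child_def d(2) [symmetric]) (simp add: d(1) list_update_append)
  let ?B = "map ideal_opt (ys @ zs)" and ?C = "map ideal_opt (map (quotient_opt g) (ys @ zs))"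
  have B: "set (ys @ zs) \<subseteq> entries" using xs d(1) by auto
  have P: "carrier P \<inter> ideal r = ideal r" if "r \<in> carrier P" for r using ideal_subset [OF that] by blast
  have "altsum f (carrier P) (map ideal_opt xs) = altsum f (carrier P) ?B - altsum f (g <# ideal q) ?B"
    using P gc q by (simp add: d(1) altsum_move ideal_mult)
  also have "\<dots> = altsum f (carrier P) ?B - altsum (\<lambda>I. f (g <# I)) (ideal q) ?C"
    using altsum_shift [OF g B ideal_subset [OF q]] by simp
  finally have 1: "altsum f (carrier P) (map ideal_opt xs) = altsum f (carrier P) ?B - altsum (\<lambda>I. f (g <# I)) (ideal q) ?C" .
  have "altsum f (carrier P) (map ideal_opt (left_child P g xs)) = altsum f (carrier P) ?B - altsum f (ideal g) ?B"
    using P gc by (simp add: left altsum_move)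
  also have "\<dots> = altsum f (carrier P) ?B - altsum (\<lambda>I. f (g <# I)) (carrier P) ?C"
    using altsum_shift [OF g B subset_refl] by simp
  finally have 2: "altsum f (carrier P) (map ideal_opt (left_child P g xs))
    = altsum f (carrier P) ?B - altsum (\<lambda>I. f (g <# I)) (carrier P) ?C" .
  have "altsum (\<lambda>I. f (g <# I)) (carrier P) (map ideal_opt (right_child P g xs))
    = altsum (\<lambda>I. f (g <# I)) (carrier P) ?C - altsum (\<lambda>I. f (g <# I)) (ideal q) ?C"
    using P [OF q] quotient_opt_mult [OF g q] unfolding right_child_eq d(1) by (simp add: altsum_move)
  then show ?thesis using 1 2 by simp
qed

end

section \<open>Right-angled Artin monoids\<close>

text \<open>
  \<open>remove_initial m s w\<close> removes the first occurrence of \<open>s\<close> in \<open>w\<close> if all letters before it commute with \<open>s\<close>. It decides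
  whether \<open>s\<close> divides the class of \<open>w\<close>, and it computes the quotient.
\<close>

primrec remove_initial :: "('s \<Rightarrow> 's \<Rightarrow> enat) \<Rightarrow> 's \<Rightarrow> 's list \<Rightarrow> 's list option" where
  "remove_initial m s [] = None"
| "remove_initial m s (t # w) = (if t = s then Some w else if m s t = 2 then map_option ((#) t) (remove_initial m s w) else None)"

locale right_angled =
  fixes S :: "'s set" and m :: "'s \<Rightarrow> 's \<Rightarrow> enat"
  assumes matrix: "right_angled_matrix S m"
begin

declare in_lists_conv_set [simp del] in_listsD [rule del] in_listsI [rule del]

abbreviation R :: "('s list \<times> 's list) set" where "R \<equiv> artin_rel S m"
abbreviation cls :: "'s list \<Rightarrow> 's list set" where "cls w \<equiv> R `` {w}"

lemma m_sym: "s \<in> S \<Longrightarrow> t \<in> S \<Longrightarrow> m s t = m t s"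
  using matrix by (auto simp: right_angled_matrix_def)

lemma m_two_neq: "s \<in> S \<Longrightarrow> m s t = 2 \<Longrightarrow> s \<noteq> t"
  using matrix by (auto simp: right_angled_matrix_def)

lemma rel_lists: "(u, v) \<in> R \<Longrightarrow> u \<in> lists S \<and> v \<in> lists S"
  by (simp add: artin_rel_def)

lemma rel_step: "(u, v) \<in> artin_step S m \<Longrightarrow> (u, v) \<in> R"
proof -
  assume uv: "(u, v) \<in> artin_step S m"
  then have "u \<in> lists S" "v \<in> lists S" by (auto simp: artin_step_def)
  then show ?thesis using uv by (auto simp: artin_rel_def)
qed

lemma artin_stepI:
  "u \<in> lists S \<Longrightarrow> v \<in> lists S \<Longrightarrow> s \<in> S \<Longrightarrow> t \<in> S \<Longrightarrow> m s t = 2 \<Longrightarrow>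
    (u @ [s, t] @ v, u @ [t, s] @ v) \<in> artin_step S m"
  unfolding artin_step_def by blast

lemma rel_refl: "u \<in> lists S \<Longrightarrow> (u, u) \<in> R"
  by (simp add: artin_rel_def)

lemma rel_sym: "(u, v) \<in> R \<Longrightarrow> (v, u) \<in> R"
proof -
  have "sym ((artin_step S m \<union> (artin_step S m)\<inverse>)\<^sup>*)" by (intro sym_rtrancl) (auto simp: sym_def)
  then show "(u, v) \<in> R \<Longrightarrow> (v, u) \<in> R" by (auto simp: artin_rel_def dest: symD)
qed

lemma rel_trans: "(u, v) \<in> R \<Longrightarrow> (v, w) \<in> R \<Longrightarrow> (u, w) \<in> R"
  by (auto simp: artin_rel_def intro: rtrancl_trans)

lemma rel_induct [consumes 1, case_names refl trans sym step]:
  assumes "(u, v) \<in> R"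
    and r: "\<And>u. u \<in> lists S \<Longrightarrow> Q u u" and t: "\<And>u v w. Q u v \<Longrightarrow> Q v w \<Longrightarrow> Q u w"
    and s: "\<And>u v. Q u v \<Longrightarrow> Q v u" and st: "\<And>u v. (u, v) \<in> artin_step S m \<Longrightarrow> Q u v"
  shows "Q u v"
proof -
  have "u \<in> lists S" using assms(1) by (simp add: artin_rel_def)
  have "(u, v) \<in> (artin_step S m \<union> (artin_step S m)\<inverse>)\<^sup>*" using assms(1) by (simp add: artin_rel_def)
  then show ?thesis
  proof (induction rule: rtrancl_induct)
    case base show ?case using r \<open>u \<in> lists S\<close> by blast
  next
    case (step v w) then show ?case using t s st by blast
  qed
qed

lemma rel_append_left: "(u, v) \<in> R \<Longrightarrow> w \<in> lists S \<Longrightarrow> (w @ u, w @ v) \<in> R"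
proof (induction rule: rel_induct)
  case (step u v)
  then obtain a b s t where "u = a @ [s, t] @ b" "v = a @ [t, s] @ b" "a \<in> lists S" "b \<in> lists S" "s \<in> S" "t \<in> S" "m s t = 2"
    unfolding artin_step_def by blast
  then have "(w @ u, w @ v) \<in> artin_step S m" using artin_stepI [of "w @ a" b s t] step by simp
  then show ?case by (rule rel_step)
qed (auto intro: rel_refl rel_sym rel_trans)

lemma rel_append_right: "(u, v) \<in> R \<Longrightarrow> w \<in> lists S \<Longrightarrow> (u @ w, v @ w) \<in> R"
proof (induction rule: rel_induct)
  case (step u v)
  then obtain a b s t where "u = a @ [s, t] @ b" "v = a @ [t, s] @ b" "a \<in> lists S" "b \<in> lists S" "s \<in> S" "t \<in> S" "m s t = 2"
    unfolding artin_step_def by blast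
  then have "(u @ w, v @ w) \<in> artin_step S m" using artin_stepI [of a "b @ w" s t] step by simp
  then show ?case by (rule rel_step)
qed (auto intro: rel_refl rel_sym rel_trans)

lemma rel_append: "(u, u') \<in> R \<Longrightarrow> (v, v') \<in> R \<Longrightarrow> (u @ v, u' @ v') \<in> R"
  using rel_append_left rel_append_right rel_trans rel_lists by meson

lemma rel_Cons: "(u, v) \<in> R \<Longrightarrow> s \<in> S \<Longrightarrow> (s # u, s # v) \<in> R"
  using rel_append_left [of u v "[s]"] by simp

lemma rel_length: "(u, v) \<in> R \<Longrightarrow> length u = length v"
  by (induction rule: rel_induct) (auto simp: artin_step_def)

lemma rel_swap: "s \<in> S \<Longrightarrow> t \<in> S \<Longrightarrow> m s t = 2 \<Longrightarrow> w \<in> lists S \<Longrightarrow> (s # t # w, t # s # w) \<in> R"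
  using rel_step [OF artin_stepI [of "[]" w s t]] by simp

lemma equiv_R: "equiv (lists S) R"
proof (rule equivI)
  show "R \<subseteq> lists S \<times> lists S" using rel_lists by auto
  show "refl_on (lists S) R" using rel_refl rel_lists unfolding refl_on_def by blast
  show "sym R" using rel_sym by (rule symI)
  show "trans R" using rel_trans by (rule transI)
qed

lemma cls_eq_iff: "u \<in> lists S \<Longrightarrow> v \<in> lists S \<Longrightarrow> cls u = cls v \<longleftrightarrow> (u, v) \<in> R"
  using eq_equiv_class_iff [OF equiv_R] by blast

lemma remove_initial_lists: "remove_initial m s w = Some x \<Longrightarrow> w \<in> lists S \<Longrightarrow> x \<in> lists S"
  by (induction w arbitrary: x) (auto split: if_splits)

lemma remove_initial_rel:
  assumes s: "s \<in> S" and "w \<in> lists S" "remove_initial m s w = Some x"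
  shows "(w, s # x) \<in> R"
  using assms(2,3)
proof (induction w arbitrary: x rule: list.induct)
  case (Cons t w)
  show ?case
  proof (cases "t = s")
    case True then show ?thesis using Cons rel_refl by auto
  next
    case False
    then obtain y where y: "m s t = 2" "remove_initial m s w = Some y" "x = t # y"
      using Cons.prems by (auto split: if_splits)
    have t: "t \<in> S" "w \<in> lists S" using Cons.prems(1) by simp_all
    have "(t # w, t # s # y) \<in> R" using Cons.IH y t rel_Cons by blast
    moreover have "(t # s # y, s # t # y) \<in> R"
      using rel_swap [OF t(1) s] y m_sym [OF s t(1)] remove_initial_lists t by simp
    ultimately show ?thesis using y rel_trans by blast
  qed
qed simp

lemma rel_option_map_Cons: "rel_option (\<lambda>x y. (x, y) \<in> R) a b \<Longrightarrow> t \<in> S \<Longrightarrow>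
    rel_option (\<lambda>x y. (x, y) \<in> R) (map_option ((#) t) a) (map_option ((#) t) b)"
  by (cases a; cases b) (auto intro: rel_Cons)

lemma remove_initial_step:
  assumes s: "s \<in> S" and a: "a \<in> S" and b: "b \<in> S" and ab: "m a b = 2" and v: "v \<in> lists S"
  shows "u \<in> lists S \<Longrightarrow> rel_option (\<lambda>x y. (x, y) \<in> R) (remove_initial m s (u @ [a, b] @ v)) (remove_initial m s (u @ [b, a] @ v))"
proof (induction u)
  case Nil
  have ba: "a \<noteq> b" "m b a = 2" using m_two_neq [OF a ab] m_sym [OF a b] ab by auto
  show ?case
  proof (cases "remove_initial m s v")
    case None then show ?thesis using ab ba a b v rel_refl by auto
  next
    case (Some x)
    then have "(a # b # x, b # a # x) \<in> R" using rel_swap a b ab remove_initial_lists v by blast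
    then show ?thesis using Some ab ba a b v rel_refl by auto
  qed
next
  case (Cons t u)
  have t: "t \<in> S" "u \<in> lists S" using Cons.prems by auto
  have "(u @ [a, b] @ v, u @ [b, a] @ v) \<in> R"
    using rel_append_left [OF rel_swap [OF a b ab v] t(2)] by simp
  then show ?case using rel_option_map_Cons [OF Cons.IH t(1)] t by simp
qed

text \<open>
  This gives the solution of the word problem that is needed: equality of \<open>[s u]\<close> and \<open>[s v]\<close> implies that of \<open>[u]\<close>
  and \<open>[v]\<close>, and divisibility by \<open>s\<close> can be read off from any representing word.
\<close>

lemma remove_initial_invariant:
  assumes "s \<in> S" "(u, v) \<in> R"
  shows "rel_option (\<lambda>x y. (x, y) \<in> R) (remove_initial m s u) (remove_initial m s v)"
  using assms(2)
proof (induction rule: rel_induct)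
  case (refl u) then show ?case using remove_initial_lists rel_refl by (cases "remove_initial m s u") auto
next
  case (trans u v w) then show ?case
    by (cases "remove_initial m s u"; cases "remove_initial m s v"; cases "remove_initial m s w") (auto intro: rel_trans)
next
  case (sym u v) then show ?case
    by (cases "remove_initial m s u"; cases "remove_initial m s v") (auto intro: rel_sym)
next
  case (step u v) then show ?case unfolding artin_step_def using remove_initial_step [OF assms(1)] by auto
qed

lemma remove_initial_append:
  "s \<in> S \<Longrightarrow> remove_initial m s (w @ v) = (case remove_initial m s w of Some x \<Rightarrow> Some (x @ v)
    | None \<Rightarrow> if \<forall>t\<in>set w. m s t = 2 then map_option ((@) w) (remove_initial m s v) else None)"
proof (induction w)
  case Nil then show ?case by (cases "remove_initial m s v") simp_all
next
  case (Cons t w)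
  then show ?case
    using m_two_neq [of s t] by (cases "remove_initial m s v") (auto split: option.splits)
qed

lemma commute_generator:
  assumes "s \<in> S" "w \<in> lists S" "remove_initial m s w = None" "\<forall>t\<in>set w. m s t = 2"
  shows "(w @ [s], s # w) \<in> R"
  using remove_initial_rel [of s "w @ [s]" w] assms by (simp add: remove_initial_append)

abbreviation A :: "'s list set monoid" where "A \<equiv> artin_monoid S m"

lemma carrier_iff: "x \<in> carrier A \<longleftrightarrow> (\<exists>w\<in>lists S. x = cls w)"
  by (auto simp: artin_monoid_def quotient_def)

lemma cls_closed: "w \<in> lists S \<Longrightarrow> cls w \<in> carrier A"
  by (auto simp: carrier_iff)

lemma cls_mult:
  assumes u: "u \<in> lists S" and v: "v \<in> lists S"
  shows "cls u \<otimes>\<^bsub>A\<^esub> cls v = cls (u @ v)"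
proof -
  have "cls (u' @ v') = cls (u @ v)" if "u' \<in> cls u" "v' \<in> cls v" for u' v'
  proof -
    have "(u, u') \<in> R" "(v, v') \<in> R" using that by simp_all
    then have "(u' @ v', u @ v) \<in> R" by (rule rel_sym [OF rel_append])
    then show ?thesis by (rule equiv_class_eq [OF equiv_R])
  qed
  then have "(\<Union>u'\<in>cls u. \<Union>v'\<in>cls v. cls (u' @ v')) = (\<Union>u'\<in>cls u. \<Union>v'\<in>cls v. cls (u @ v))"
    by (intro SUP_cong refl)
  also have "\<dots> = cls (u @ v)"
  proof -
    have "cls u \<noteq> {}" "cls v \<noteq> {}" using u v rel_refl by blast+
    then show ?thesis by simp
  qed
  finally show ?thesis by (simp add: artin_monoid_def)
qed

lemma one_eq: "\<one>\<^bsub>A\<^esub> = cls []"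
  by (simp add: artin_monoid_def)

definition class_length :: "'s list set \<Rightarrow> nat"
  where "class_length C = length (SOME w. w \<in> C)"

lemma class_length_cls: "w \<in> lists S \<Longrightarrow> class_length (cls w) = length w"
proof -
  assume w: "w \<in> lists S"
  have "w \<in> cls w" using rel_refl [OF w] by simp
  then have "(SOME v. v \<in> cls w) \<in> cls w" by (rule someI)
  then have "(w, SOME v. v \<in> cls w) \<in> R" by simp
  then show ?thesis using rel_length by (simp add: class_length_def)
qed

lemma artin_generators_iff: "x \<in> artin_generators S m \<longleftrightarrow> (\<exists>s\<in>S. x = cls [s])"
  by (auto simp: artin_generators_def)

text \<open>
  For a generator \<open>s\<close> and a word \<open>w\<close> there are three cases. If \<open>s\<close> divides \<open>w\<close>, the join is \<open>w\<close>. Otherwise a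
  common multiple \<open>w v\<close> of both contains an initial \<open>s\<close> that lies in \<open>v\<close>; then \<open>s\<close> commutes with all
  letters of \<open>w\<close>, and the join is \<open>s w = w s\<close>. If \<open>s\<close> neither divides \<open>w\<close> nor commutes with its letters,
  there is no common multiple.
\<close>

theorem graded_join_monoid_artin: "graded_join_monoid A (artin_generators S m) class_length"
proof -
  have mon: "monoid A"
  proof (rule monoidI)
    fix x y assume "x \<in> carrier A" "y \<in> carrier A"
    then obtain u v where "u \<in> lists S" "v \<in> lists S" "x = cls u" "y = cls v" by (auto simp: carrier_iff)
    then show "x \<otimes>\<^bsub>A\<^esub> y \<in> carrier A" using cls_closed [of "u @ v"] by (simp add: cls_mult)
  next
    show "\<one>\<^bsub>A\<^esub> \<in> carrier A" by (auto simp: one_eq carrier_iff)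
  next
    fix x y z assume "x \<in> carrier A" "y \<in> carrier A" "z \<in> carrier A"
    then show "x \<otimes>\<^bsub>A\<^esub> y \<otimes>\<^bsub>A\<^esub> z = x \<otimes>\<^bsub>A\<^esub> (y \<otimes>\<^bsub>A\<^esub> z)" by (auto simp: carrier_iff cls_mult)
  next
    fix x assume "x \<in> carrier A"
    then show "\<one>\<^bsub>A\<^esub> \<otimes>\<^bsub>A\<^esub> x = x" "x \<otimes>\<^bsub>A\<^esub> \<one>\<^bsub>A\<^esub> = x" by (auto simp: carrier_iff cls_mult one_eq)
  qed
  interpret monoid A by (rule mon)
  show ?thesis
  proof
    fix x y assume "x \<in> carrier A" "y \<in> carrier A"
    then show "class_length (x \<otimes>\<^bsub>A\<^esub> y) = class_length x + class_length y"
      by (auto simp: carrier_iff cls_mult class_length_cls)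
  next
    fix x assume "x \<in> carrier A" "class_length x = 0"
    then show "x = \<one>\<^bsub>A\<^esub>" by (auto simp: carrier_iff class_length_cls one_eq)
  next
    show "artin_generators S m = {x \<in> carrier A. class_length x = 1}"
    proof (intro equalityI subsetI)
      fix x assume "x \<in> artin_generators S m"
      then show "x \<in> {x \<in> carrier A. class_length x = 1}"
        by (auto simp: artin_generators_iff class_length_cls cls_closed)
    next
      fix x assume "x \<in> {x \<in> carrier A. class_length x = 1}"
      then obtain w where w: "w \<in> lists S" "x = cls w" "class_length x = 1" by (auto simp: carrier_iff)
      then have "length w = 1" by (simp add: class_length_cls)
      then obtain s where "w = [s]" by (auto simp: length_Suc_conv)
      then show "x \<in> artin_generators S m" using w by (auto simp: artin_generators_iff)
    qed
  next
    fix x assume "x \<in> carrier A" "x \<noteq> \<one>\<^bsub>A\<^esub>"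
    then obtain v where v: "v \<in> lists S" "x = cls v" "v \<noteq> []" by (auto simp: carrier_iff one_eq)
    then obtain s w where "s \<in> S" "w \<in> lists S" "x = cls (s # w)" by (cases v) auto
    then have "cls [s] \<in> artin_generators S m" "cls w \<in> carrier A" "x = cls [s] \<otimes>\<^bsub>A\<^esub> cls w"
      using cls_mult [of "[s]" w] by (auto simp: artin_generators_iff intro: cls_closed)
    then show "\<exists>g\<in>artin_generators S m. \<exists>y\<in>carrier A. x = g \<otimes>\<^bsub>A\<^esub> y" by blast
  next
    fix g x y assume g: "g \<in> artin_generators S m" and xy: "x \<in> carrier A" "y \<in> carrier A" "g \<otimes>\<^bsub>A\<^esub> x = g \<otimes>\<^bsub>A\<^esub> y"
    obtain s u v where s: "s \<in> S" "g = cls [s]" and u: "u \<in> lists S" "x = cls u" and v: "v \<in> lists S" "y = cls v"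
      using g xy by (auto simp: artin_generators_iff carrier_iff)
    have "(s # u, s # v) \<in> R" using xy s u v cls_mult [of "[s]"] cls_eq_iff [of "s # u" "s # v"] by simp
    then have "(u, v) \<in> R" using remove_initial_invariant [OF s(1)] by fastforce
    then show "x = y" using u v cls_eq_iff by simp
  next
    fix g x assume g: "g \<in> artin_generators S m" and x: "x \<in> carrier A"
    obtain s w where s: "s \<in> S" "g = cls [s]" and w: "w \<in> lists S" "x = cls w"
      using g x by (auto simp: artin_generators_iff carrier_iff)
    let ?I = "\<lambda>x. x <#\<^bsub>A\<^esub> carrier A"
    have coset: "z \<in> ?I x \<longleftrightarrow> (\<exists>h\<in>carrier A. z = x \<otimes>\<^bsub>A\<^esub> h)" for z x by (auto simp: l_coset_def)
    have common: "\<exists>u v. u \<in> lists S \<and> v \<in> lists S \<and> z = cls (w @ v) \<and> (s # u, w @ v) \<in> R" if z: "z \<in> ?I g \<inter> ?I x" for z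
    proof -
      obtain h k where hk: "h \<in> carrier A" "z = g \<otimes>\<^bsub>A\<^esub> h" "k \<in> carrier A" "z = x \<otimes>\<^bsub>A\<^esub> k"
        using z by (auto simp: coset)
      then obtain u v where "u \<in> lists S" "h = cls u" "v \<in> lists S" "k = cls v" by (auto simp: carrier_iff)
      then show ?thesis
        using hk s w cls_mult [of "[s]" u] cls_mult [of w v] cls_eq_iff [of "s # u" "w @ v"] by auto
    qed
    show "?I g \<inter> ?I x = {} \<or> (\<exists>y\<in>carrier A. ?I g \<inter> ?I x = ?I (g \<otimes>\<^bsub>A\<^esub> y) \<and> class_length y \<le> class_length x)"
    proof (cases "remove_initial m s w")
      case (Some y)
      have y: "y \<in> lists S" "(w, s # y) \<in> R" using remove_initial_lists remove_initial_rel s w Some by auto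
      have gy: "x = g \<otimes>\<^bsub>A\<^esub> cls y" using y s w cls_mult [of "[s]" y] cls_eq_iff [of w "s # y"] by simp
      have "?I x \<subseteq> ?I g"
      proof
        have cl: "g \<in> carrier A" "cls y \<in> carrier A" using y s cls_closed by simp_all
        fix z assume "z \<in> ?I x"
        then obtain h where h: "h \<in> carrier A" "z = g \<otimes>\<^bsub>A\<^esub> cls y \<otimes>\<^bsub>A\<^esub> h" by (auto simp: coset gy)
        then have "z = g \<otimes>\<^bsub>A\<^esub> (cls y \<otimes>\<^bsub>A\<^esub> h)" "cls y \<otimes>\<^bsub>A\<^esub> h \<in> carrier A" using cl by (simp_all add: m_assoc)
        then show "z \<in> ?I g" unfolding coset by blast
      qed
      then have "?I g \<inter> ?I x = ?I (g \<otimes>\<^bsub>A\<^esub> cls y)" using gy by auto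
      moreover have "class_length (cls y) \<le> class_length x"
        using rel_length [OF y(2)] y w by (simp add: class_length_cls)
      ultimately show ?thesis using y cls_closed by blast
    next
      case None
      show ?thesis
      proof (cases "\<forall>t\<in>set w. m s t = 2")
        case True
        have sw: "(w @ [s], s # w) \<in> R" using commute_generator s w None True by blast
        have xg: "x \<otimes>\<^bsub>A\<^esub> g = g \<otimes>\<^bsub>A\<^esub> x"
          using sw s w cls_mult [of w "[s]"] cls_mult [of "[s]" w] cls_eq_iff [of "w @ [s]" "s # w"] by simp
        have gc: "g \<in> carrier A" using s cls_closed by simp
        have "?I g \<inter> ?I x = ?I (g \<otimes>\<^bsub>A\<^esub> x)"
        proof
          show "?I (g \<otimes>\<^bsub>A\<^esub> x) \<subseteq> ?I g \<inter> ?I x"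
          proof
            fix z assume "z \<in> ?I (g \<otimes>\<^bsub>A\<^esub> x)"
            then obtain h where h: "h \<in> carrier A" "z = g \<otimes>\<^bsub>A\<^esub> x \<otimes>\<^bsub>A\<^esub> h" by (auto simp: coset)
            have "z = g \<otimes>\<^bsub>A\<^esub> (x \<otimes>\<^bsub>A\<^esub> h)" "z = x \<otimes>\<^bsub>A\<^esub> (g \<otimes>\<^bsub>A\<^esub> h)"
              using h gc x by (simp_all add: m_assoc flip: xg)
                (simp add: xg flip: m_assoc)
            then show "z \<in> ?I g \<inter> ?I x" using h gc x by (auto simp: coset)
          qed
          show "?I g \<inter> ?I x \<subseteq> ?I (g \<otimes>\<^bsub>A\<^esub> x)"
          proof
            fix z assume "z \<in> ?I g \<inter> ?I x"
            then obtain u v where uv: "u \<in> lists S" "v \<in> lists S" "z = cls (w @ v)" "(s # u, w @ v) \<in> R"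
              using common by blast
            have "remove_initial m s (w @ v) \<noteq> None" using remove_initial_invariant [OF s(1) uv(4)] by (auto simp: option_rel_Some1)
            then obtain v' where v': "remove_initial m s v = Some v'"
              using None True s by (auto simp: remove_initial_append)
            have vv: "v' \<in> lists S" "(v, s # v') \<in> R" using remove_initial_lists remove_initial_rel s uv v' by auto
            have "cls v = g \<otimes>\<^bsub>A\<^esub> cls v'" using vv uv s cls_mult [of "[s]" v'] cls_eq_iff [of v "s # v'"] by simp
            then have "z = x \<otimes>\<^bsub>A\<^esub> (g \<otimes>\<^bsub>A\<^esub> cls v')" using uv w cls_mult [of w v] by simp
            then have "z = g \<otimes>\<^bsub>A\<^esub> x \<otimes>\<^bsub>A\<^esub> cls v'"
              using gc x vv cls_closed by (simp add: xg flip: m_assoc)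
            then show "z \<in> ?I (g \<otimes>\<^bsub>A\<^esub> x)" using vv cls_closed by (auto simp: coset)
          qed
        qed
        then show ?thesis using x by blast
      next
        case False
        have "?I g \<inter> ?I x = {}"
        proof (rule ccontr)
          assume "?I g \<inter> ?I x \<noteq> {}"
          then obtain u v where "(s # u, w @ v) \<in> R" using common by blast
          then have "remove_initial m s (w @ v) \<noteq> None" using remove_initial_invariant [OF s(1)] by (force simp: option_rel_Some1)
          then show False using None False s by (simp add: remove_initial_append)
        qed
        then show ?thesis by blast
      qed
    qed
  qed
qed

end

section \<open>Reduction of positivity to generators\<close>

locale graded_product_system = graded_join_monoid P G len + traced_product_system P X mul j \<tau>
  for P :: "('p, 'k) monoid_scheme" (structure) and G :: "'p set" and len :: "'p \<Rightarrow> nat"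
    and X :: "'p \<Rightarrow> ('x::complex_vector, 'a::cstar_algebra) correspondence"
    and mul :: "'p \<Rightarrow> 'p \<Rightarrow> 'x \<Rightarrow> 'x \<Rightarrow> 'x"
    and j :: "'a \<Rightarrow> 'x" and \<tau> :: "'a \<Rightarrow> complex" +
  fixes N :: "'p \<Rightarrow> real" and \<beta> :: real
  assumes N_pos: "p \<in> carrier P \<Longrightarrow> N p > 0"
    and N_mult: "p \<in> carrier P \<Longrightarrow> q \<in> carrier P \<Longrightarrow> N (p \<otimes> q) = N p * N q"
begin

text \<open>The value \<open>0\<close> at the empty ideal is the convention for \<open>\<or>K = \<infinity>\<close>.\<close>

definition summand :: "'a \<Rightarrow> 'p set \<Rightarrow> real"
  where "summand a I = (if I = {} then 0
    else N (generator_of I) powr (- \<beta>) * real_of_ereal (Tr (generator_of I) a))"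

definition traces_finite :: bool
  where "traces_finite \<longleftrightarrow> (\<forall>r\<in>carrier P. \<forall>a\<in>positive_elements. Tr r a < \<infinity>)"

lemma N_one: "N \<one> = 1"
  using N_mult [of \<one> \<one>] N_pos [of \<one>] by simp

lemma summand_ideal: "r \<in> carrier P \<Longrightarrow> summand a (ideal r) = N r powr (- \<beta>) * real_of_ereal (Tr r a)"
  using ideal_self [of r] by (auto simp: summand_def generator_of_ideal)

lemma positivity_sum_eq:
  assumes fin: traces_finite and a: "a \<in> positive_elements" and us: "distinct us" "set us \<subseteq> carrier P"
  shows "positivity_sum P X N \<beta> \<tau> a (set us) = ereal (altsum (summand a) (carrier P) (map ideal us))"
proof -
  define T where "T K = (- 1) ^ card K * summand a (carrier P \<inter> (\<Inter>k\<in>K. ideal k))" for K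
  obtain b where b: "a = star b * b" using a by (auto simp: positive_elements_def)
  have "summand a (ideal \<one>) = tr a"
    using Tr_one [of b] by (subst summand_ideal) (simp_all add: N_one b)
  then have T0: "T {} = Re (\<tau> a)" by (simp add: T_def ideal_one tr_def)
  have T1: "(case join P K of None \<Rightarrow> 0
      | Some r \<Rightarrow> ereal ((- 1) ^ card K * N r powr (- \<beta>)) * induced_trace (X r) \<tau> (lmult (X r) a)) = ereal (T K)"
    if K: "K \<in> Pow (set us) - {{}}" for K
  proof -
    have KK: "finite K" "K \<noteq> {}" "K \<subseteq> carrier P" using K us finite_subset [of K "set us"] by auto
    have pr: "principal (\<Inter>k\<in>K. ideal k)" by (rule principal_INT [OF KK])
    then have sub: "carrier P \<inter> (\<Inter>k\<in>K. ideal k) = (\<Inter>k\<in>K. ideal k)" using principal_subset by blast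
    show ?thesis
    proof (cases "(\<Inter>k\<in>K. ideal k) = {}")
      case True then show ?thesis using join_eq [of K] by (simp add: T_def sub summand_def)
    next
      case False
      then obtain r where r: "r \<in> carrier P" "(\<Inter>k\<in>K. ideal k) = ideal r" using pr by (auto simp: principal_def)
      have "Tr r a < \<infinity>" using fin a r(1) unfolding traces_finite_def by blast
      then obtain t where t: "Tr r a = ereal t" using Tr_nonneg [OF r(1), of a] by (cases "Tr r a") auto
      have "join P K = Some r" using join_eq [of K] False r by (simp add: generator_of_ideal)
      moreover have "T K = (- 1) ^ card K * (N r powr (- \<beta>) * t)"
        using sub summand_ideal [OF r(1), of a] by (simp add: T_def r(2) t)
      ultimately show ?thesis by (simp add: t)
    qed
  qed
  have "positivity_sum P X N \<beta> \<tau> a (set us) = ereal (T {}) + (\<Sum>K\<in>Pow (set us) - {{}}. ereal (T K))"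
    unfolding positivity_sum_def T0 by (intro arg_cong2 [where f = "(+)"] sum.cong refl T1)
  also have "\<dots> = ereal (T {} + (\<Sum>K\<in>Pow (set us) - {{}}. T K))" by simp
  also have "T {} + (\<Sum>K\<in>Pow (set us) - {{}}. T K) = (\<Sum>K\<in>Pow (set us). T K)"
    by (rule sum.remove [symmetric]) auto
  also have "\<dots> = altsum (summand a) (carrier P) (map ideal us)"
    using us by (simp add: altsum_eq_sum T_def)
  finally show ?thesis .
qed

text \<open>
  Together with \<open>tensor_trace_bounded\<close> this makes all the traces finite, so that the positivity sums become
  alternating sums of real numbers.
\<close>

lemma generator_trace_bounded:
  assumes g: "g \<in> G" and pos: "positivity_sum P X N \<beta> \<tau> a {g} \<ge> 0"
  shows "Tr g a \<le> ereal (N g powr \<beta> * tr a)"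
proof -
  have gc: "g \<in> carrier P" using g by (rule G_carrier)
  have "ideal g \<noteq> {}" using ideal_self gc by blast
  then have "join P {g} = Some g"
    using join_eq [of "{g}"] principal_ideal [OF gc] by (simp add: generator_of_ideal gc)
  moreover have "Pow {g} - {{}} = {{g}}" by auto
  ultimately have *: "0 \<le> ereal (tr a) + ereal (- (N g powr (- \<beta>))) * Tr g a"
    using pos by (simp add: positivity_sum_def tr_def)
  have n: "N g powr (- \<beta>) > 0" using N_pos [OF gc] by simp
  then obtain t where t: "Tr g a = ereal t" using * Tr_nonneg [OF gc, of a] by (cases "Tr g a") auto
  have "N g powr (- \<beta>) * t \<le> tr a" using * t by simp
  then have "N g powr \<beta> * (N g powr (- \<beta>) * t) \<le> N g powr \<beta> * tr a" by (intro mult_left_mono) auto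
  moreover have "N g powr \<beta> * N g powr (- \<beta>) = 1"
    using N_pos [OF gc] by (simp add: less_imp_neq [symmetric] flip: powr_add)
  ultimately show ?thesis by (simp add: t flip: mult.assoc)
qed

lemma traces_finite_if_positive_on_generators:
  assumes pos: "\<And>a g. a \<in> positive_elements \<Longrightarrow> g \<in> G \<Longrightarrow> positivity_sum P X N \<beta> \<tau> a {g} \<ge> 0"
  shows traces_finite
proof -
  have "\<exists>C\<ge>0. \<forall>b. Tr r (star b * b) \<le> ereal (C * tr (star b * b))" if "r \<in> carrier P" for r
    using that
  proof (induction "len r" arbitrary: r)
    case 0
    then have "r = \<one>" using len_zero by simp
    then show ?case using Tr_one by (intro exI [of _ 1]) simp
  next
    case (Suc n)
    then have "r \<noteq> \<one>" by auto
    then obtain g y where g: "g \<in> G" and y: "y \<in> carrier P" "r = g \<otimes> y" using first_generator Suc.prems by blast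
    have gc: "g \<in> carrier P" "len g = 1" using g by (simp_all add: generators)
    have "n = len y" using Suc.hyps(2) gc y by (simp add: len_mult)
    then obtain C where C: "C \<ge> 0" "\<And>b. Tr y (star b * b) \<le> ereal (C * tr (star b * b))"
      using Suc.hyps(1) y(1) by blast
    have D: "Tr g (star b * b) \<le> ereal (N g powr \<beta> * tr (star b * b))" for b
      by (rule generator_trace_bounded [OF g pos]) (simp_all add: g)
    have "Tr r (star b * b) \<le> ereal (C * (N g powr \<beta>) * tr (star b * b))" for b
      unfolding y(2) by (rule tensor_trace_bounded [OF gc(1) G_not_one [OF g] y(1) C _ D]) simp
    then show ?case using C(1) by (intro exI [of _ "C * (N g powr \<beta>)"]) simp
  qed
  note bound = this
  show ?thesis
    unfolding traces_finite_def
  proof (intro ballI)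
    fix r and a :: 'a assume "r \<in> carrier P" "a \<in> positive_elements"
    then obtain C b where "Tr r a \<le> ereal (C * tr (star b * b))"
      using bound unfolding positive_elements_def by blast
    then show "Tr r a < \<infinity>" by (rule le_less_trans) simp
  qed
qed

text \<open>
  The alternating sum for the joins \<open>g r\<close> is, up to an arbitrarily small error, a combination with
  positive coefficients of the alternating sums for the \<open>r\<close>, at other positive elements of the algebra.
\<close>

lemma altsum_translate_nonneg:
  assumes fin: traces_finite and g: "g \<in> G" and xs: "set xs \<subseteq> entries"
    and nonneg: "\<And>c. c \<in> positive_elements \<Longrightarrow> 0 \<le> altsum (summand c) (carrier P) (map ideal_opt xs)"
    and a: "a \<in> positive_elements"
  shows "0 \<le> altsum (\<lambda>I. summand a (g <# I)) (carrier P) (map ideal_opt xs)"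
proof -
  obtain b where b: "a = star b * b" using a by (auto simp: positive_elements_def)
  have gc: "g \<in> carrier P" "g \<noteq> \<one>" using g G_carrier G_not_one by auto
  interpret Xg: traced_correspondence "X g" \<tau> by (rule traced [OF gc(1)])
  let ?As = "map ideal_opt xs"
  define Q where "Q = generator_of ` (meets (carrier P) ?As - {{}})"
  have pm: "principal J" if "J \<in> meets (carrier P) ?As" for J
  proof (rule principal_meets [OF _ _ that])
    show "principal (carrier P)" using principal_ideal [of \<one>] by (simp add: ideal_one)
    show "principal A" if "A \<in> set ?As" for A using that xs principal_ideal_opt by auto
  qed
  have "finite Q" by (simp add: Q_def finite_meets)
  moreover have "generator_of J \<in> carrier P" if "J \<in> meets (carrier P) ?As" "J \<noteq> {}" for J
    using pm [OF that(1)] that(2) by (auto simp: principal_def generator_of_ideal)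
  ultimately have Q: "finite Q" "Q \<subseteq> carrier P" by (auto simp: Q_def)
  define n where "n = N g powr (- \<beta>)"
  have n: "n > 0" using N_pos [OF gc(1)] by (simp add: n_def)
  have "- e \<le> altsum (\<lambda>I. summand a (g <# I)) (carrier P) ?As" if e: "e > 0" for e
  proof -
    define M where "M = 1 + (\<Sum>q\<in>Q. n * N q powr (- \<beta>))"
    have Mq: "n * N q powr (- \<beta>) \<le> M" if "q \<in> Q" for q
      using member_le_sum [OF that, of "\<lambda>q. n * N q powr (- \<beta>)"] Q n by (simp add: M_def)
    have M: "M > 0" using n by (simp add: M_def add_pos_nonneg sum_nonneg)
    define \<epsilon> where "\<epsilon> = e / (2 ^ length ?As * M)"
    have eps: "\<epsilon> > 0" using e M by (simp add: \<epsilon>_def)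
    have fin': "\<And>r a. r \<in> carrier P \<Longrightarrow> a \<in> positive_elements \<Longrightarrow> Tr r a < \<infinity>"
      using fin by (simp add: traces_finite_def)
    define c where "c \<xi> = inprod (X g) (lmult (X g) (star b) \<xi>) (lmult (X g) (star b) \<xi>)" for \<xi>
    obtain H where H: "finite H" "H \<subseteq> vecs (X g)"
      "\<forall>q\<in>Q. \<bar>real_of_ereal (Tr (g \<otimes> q) (star b * b)) - (\<Sum>\<xi>\<in>H. real_of_ereal (Tr q (c \<xi>)))\<bar> \<le> \<epsilon>"
      unfolding c_def by (rule tensor_traces_simultaneously [OF gc Q eps fin', of b])
    define h where "h I = n * (\<Sum>\<xi>\<in>H. summand (c \<xi>) I)" for I
    have close: "\<bar>summand a (g <# J) - h J\<bar> \<le> M * \<epsilon>" if J: "J \<in> meets (carrier P) ?As" for J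
    proof (cases "J = {}")
      case True
      then show ?thesis using M eps by (simp add: h_def summand_def l_coset_def)
    next
      case False
      then obtain r where r: "r \<in> carrier P" "J = ideal r" using pm [OF J] by (auto simp: principal_def)
      have rQ: "r \<in> Q" using J False r generator_of_ideal by (force simp: Q_def)
      have s: "summand a (g <# J) = n * N r powr (- \<beta>) * real_of_ereal (Tr (g \<otimes> r) (star b * b))"
        using gc r N_pos by (simp add: ideal_mult summand_ideal N_mult powr_mult n_def b less_imp_le)
      have t: "h J = n * N r powr (- \<beta>) * (\<Sum>\<xi>\<in>H. real_of_ereal (Tr r (c \<xi>)))"
        using r by (simp add: h_def summand_ideal sum_distrib_left mult.assoc)
      have "\<bar>summand a (g <# J) - h J\<bar>
          = n * N r powr (- \<beta>) * \<bar>real_of_ereal (Tr (g \<otimes> r) (star b * b)) - (\<Sum>\<xi>\<in>H. real_of_ereal (Tr r (c \<xi>)))\<bar>"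
        unfolding s t right_diff_distrib [symmetric] abs_mult using n by simp
      also have "\<dots> \<le> M * \<epsilon>"
        using H(3) rQ Mq [OF rQ] M by (intro mult_mono) auto
      finally show ?thesis .
    qed
    have "c \<xi> \<in> positive_elements" if "\<xi> \<in> H" for \<xi>
      unfolding c_def using that H(2) by (intro Xg.inprod_positive Xg.lmult_closed) auto
    then have "0 \<le> altsum h (carrier P) ?As"
      unfolding h_def altsum_scale altsum_sum using n by (intro mult_nonneg_nonneg sum_nonneg nonneg) auto
    moreover have "\<bar>altsum (\<lambda>I. summand a (g <# I)) (carrier P) ?As - altsum h (carrier P) ?As\<bar> \<le> 2 ^ length ?As * (M * \<epsilon>)"
      by (rule altsum_close) (rule close)
    moreover have "2 ^ length ?As * (M * \<epsilon>) = e" using M by (simp add: \<epsilon>_def)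
    ultimately show ?thesis by linarith
  qed
  then have "0 \<le> altsum (\<lambda>I. summand a (g <# I)) (carrier P) ?As + e" if "e > 0" for e
    using that by (metis add.commute add.right_neutral neg_le_iff_le minus_le_iff le_add_same_cancel1 diff_0 diff_le_eq)
  then show ?thesis by (rule field_le_epsilon)
qed

text \<open>
  Induction along the tree. At a leaf the list consists of generators and \<open>\<infinity>\<close>, where the hypothesis applies, or
  it contains the identity, and then all terms cancel.
\<close>

lemma altsum_nonneg:
  assumes fin: traces_finite
    and gens: "\<And>a J. a \<in> positive_elements \<Longrightarrow> finite J \<Longrightarrow> J \<subseteq> G \<Longrightarrow> positivity_sum P X N \<beta> \<tau> a J \<ge> 0"
    and "set xs \<subseteq> entries" "a \<in> positive_elements"
  shows "0 \<le> altsum (summand a) (carrier P) (map ideal_opt xs)"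
  using assms(3,4)
proof (induction "weight xs" arbitrary: xs a rule: less_induct)
  case less
  show ?case
  proof (cases "is_leaf P G xs")
    case False
    obtain g q where g: "g \<in> G" and q: "q \<in> carrier P" "q \<noteq> \<one>" and eq: "xs ! split_index P xs = Some (g \<otimes> q)"
      using split_index_works(2) [OF less.prems(1) False] by blast
    note i = split_index_works(1) [OF less.prems(1) False]
    note w = weight_children [OF less.prems(1) i g q eq]
    have "0 \<le> altsum (summand a) (carrier P) (map ideal_opt (left_child P g xs))"
      using less.hyps w less.prems by blast
    moreover have "0 \<le> altsum (\<lambda>I. summand a (g <# I)) (carrier P) (map ideal_opt (right_child P g xs))"
      using less.hyps [OF w(4) w(2)] by (intro altsum_translate_nonneg fin g w(2) less.prems(2))
    ultimately show ?thesis using altsum_split [OF less.prems(1) i g q(1) eq] by simp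
  next
    case True
    show ?thesis
    proof (cases "Some \<one> \<in> set xs")
      case True
      then have "carrier P \<in> set (map ideal_opt xs)" by (force simp: ideal_one)
      then show ?thesis using altsum_absorb [of "carrier P" "map ideal_opt xs" "carrier P"] by simp
    next
      case False
      then have xs: "set xs \<subseteq> insert None (Some ` G)" using True by (simp add: is_leaf_def)
      define J where "J = {g. Some g \<in> set xs}"
      have J: "finite J" "J \<subseteq> G"
        using xs finite_vimageI [of "set xs" Some] by (auto simp: J_def vimage_def)
      obtain us where us: "set us = J" "distinct us" using finite_distinct_list J by blast
      have usc: "set us \<subseteq> carrier P" using us J G_carrier by blast
      have inj: "inj_on ideal (set us)" using usc by (intro inj_onI) (rule ideal_inject, auto)
      let ?As = "remdups (filter (\<lambda>A. A \<noteq> {}) (map ideal_opt xs))"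
      have "set ?As = ideal ` J"
      proof -
        have "ideal g \<noteq> {}" if "g \<in> J" for g using that J G_carrier ideal_self by blast
        then show ?thesis using xs by (force simp: J_def)
      qed
      then have "altsum (summand a) (carrier P) ?As = altsum (summand a) (carrier P) (map ideal us)"
        using altsum_eq_sum [of ?As "summand a" "carrier P" "\<lambda>A. A"]
          altsum_eq_sum [of "map ideal us" "summand a" "carrier P" "\<lambda>A. A"] us inj
        by (simp add: distinct_map)
      moreover have "altsum (summand a) (carrier P) (map ideal_opt xs) = altsum (summand a) (carrier P) ?As"
        by (rule altsum_reduce) (simp add: summand_def)
      moreover have "0 \<le> altsum (summand a) (carrier P) (map ideal us)"
        using gens [OF less.prems(2) J] positivity_sum_eq [OF fin less.prems(2) us(2) usc] us by simp
      ultimately show ?thesis by simp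
    qed
  qed
qed

theorem positivity_reduces_to_generators:
  "(\<forall>a\<in>positive_elements. \<forall>J. finite J \<longrightarrow> J \<subseteq> carrier P - {\<one>} \<longrightarrow> positivity_sum P X N \<beta> \<tau> a J \<ge> 0) \<longleftrightarrow>
   (\<forall>a\<in>positive_elements. \<forall>J. finite J \<longrightarrow> J \<subseteq> G \<longrightarrow> positivity_sum P X N \<beta> \<tau> a J \<ge> 0)"
proof
  assume "\<forall>a\<in>positive_elements. \<forall>J. finite J \<longrightarrow> J \<subseteq> carrier P - {\<one>} \<longrightarrow> positivity_sum P X N \<beta> \<tau> a J \<ge> 0"
  moreover have "G \<subseteq> carrier P - {\<one>}" using G_carrier G_not_one by blast
  ultimately show "\<forall>a\<in>positive_elements. \<forall>J. finite J \<longrightarrow> J \<subseteq> G \<longrightarrow> positivity_sum P X N \<beta> \<tau> a J \<ge> 0"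
    by (meson order_trans)
next
  assume gens: "\<forall>a\<in>positive_elements. \<forall>J. finite J \<longrightarrow> J \<subseteq> G \<longrightarrow> positivity_sum P X N \<beta> \<tau> a J \<ge> 0"
  then have fin: traces_finite by (intro traces_finite_if_positive_on_generators) auto
  show "\<forall>a\<in>positive_elements. \<forall>J. finite J \<longrightarrow> J \<subseteq> carrier P - {\<one>} \<longrightarrow> positivity_sum P X N \<beta> \<tau> a J \<ge> 0"
  proof (intro ballI allI impI)
    fix a :: 'a and J assume a: "a \<in> positive_elements" and J: "finite J" "J \<subseteq> carrier P - {\<one>}"
    obtain us where us: "set us = J" "distinct us" using finite_distinct_list J by blast
    have usc: "set us \<subseteq> carrier P" using us J by blast
    have "0 \<le> altsum (summand a) (carrier P) (map ideal_opt (map Some us))"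
      using gens usc by (intro altsum_nonneg fin a) auto
    then show "positivity_sum P X N \<beta> \<tau> a J \<ge> 0"
      using positivity_sum_eq [OF fin a us(2) usc] us by (simp add: comp_def)
  qed
qed

end

theorem proposition4p12:
  fixes S :: "'s set" and m :: "'s \<Rightarrow> 's \<Rightarrow> enat"
    and P :: "'s list set monoid" and G :: "'s list set set"
    and lam :: "'s list set list"
  assumes matrix: "right_angled_matrix S m"
    and P: "P = artin_monoid S m"
    and G: "G = artin_generators S m"
    and lam: "set lam \<subseteq> carrier P"
  shows "(\<forall>ch. splitting_choice P G ch \<longrightarrow> finite (tree_nodes P G ch (map Some lam))) \<and>
    (\<forall>(X :: 's list set \<Rightarrow> ('x::complex_vector, 'a::cstar_algebra) correspondence) mul j N \<beta> \<tau>.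
      product_system P X mul j \<longrightarrow>
      (\<forall>p\<in>carrier P. essential (X p)) \<longrightarrow>
      compactly_aligned P X mul \<longrightarrow>
      (\<forall>p\<in>carrier P. N p > 0) \<longrightarrow>
      (\<forall>p\<in>carrier P. \<forall>q\<in>carrier P. N (p \<otimes>\<^bsub>P\<^esub> q) = N p * N q) \<longrightarrow>
      tracial_state \<tau> \<longrightarrow>
      ((\<forall>a\<in>positive_elements. \<forall>J. finite J \<longrightarrow> J \<subseteq> carrier P - {\<one>\<^bsub>P\<^esub>} \<longrightarrow>
          positivity_sum P X N \<beta> \<tau> a J \<ge> 0) \<longleftrightarrow>
       (\<forall>a\<in>positive_elements. \<forall>J. finite J \<longrightarrow> J \<subseteq> G \<longrightarrow>
          positivity_sum P X N \<beta> \<tau> a J \<ge> 0)))"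
proof -
  interpret R: right_angled S m by (rule right_angled.intro [OF matrix])
  interpret graded_join_monoid P G R.class_length
    unfolding P G by (rule R.graded_join_monoid_artin)
  show ?thesis
  proof (intro conjI allI impI)
    fix ch assume "splitting_choice P G ch"
    then show "finite (tree_nodes P G ch (map Some lam))" using lam by (intro finite_tree) auto
  next
    fix X :: "'s list set \<Rightarrow> ('x, 'a) correspondence" and mul and j :: "'a \<Rightarrow> 'x"
      and N :: "'s list set \<Rightarrow> real" and \<beta> :: real and \<tau> :: "'a \<Rightarrow> complex"
    assume X: "product_system P X mul j" and N: "\<forall>p\<in>carrier P. N p > 0"
      "\<forall>p\<in>carrier P. \<forall>q\<in>carrier P. N (p \<otimes>\<^bsub>P\<^esub> q) = N p * N q" and \<tau>: "tracial_state \<tau>"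
    interpret graded_product_system P G R.class_length X mul j \<tau> N \<beta>
      using X N \<tau> graded_join_monoid_axioms
      by (simp add: graded_product_system_def graded_product_system_axioms_def traced_product_system_def
          trace_state_def)
    show "(\<forall>a\<in>positive_elements. \<forall>J. finite J \<longrightarrow> J \<subseteq> carrier P - {\<one>\<^bsub>P\<^esub>} \<longrightarrow>
          positivity_sum P X N \<beta> \<tau> a J \<ge> 0) \<longleftrightarrow>
       (\<forall>a\<in>positive_elements. \<forall>J. finite J \<longrightarrow> J \<subseteq> G \<longrightarrow> positivity_sum P X N \<beta> \<tau> a J \<ge> 0)"
      by (rule positivity_reduces_to_generators)
  qed
qed

end
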